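(* Let $R=\mathbb Z_{(3)}$. Let $\Psi$ be the quiver with four vertices $\tilde{\mathrm e}_3,\tilde{\mathrm e}_4,\tilde{\mathrm e}_5,\tilde{\mathrm e}_6$ and four arrows $$\tilde\tau_1:\tilde{\mathrm e}_6\to\tilde{\mathrm e}_3,\quad\tilde\tau_2:\tilde{\mathrm e}_3\to\tilde{\mathrm e}_6,\quad\tilde\tau_3:\tilde{\mathrm e}_6\to\tilde{\mathrm e}_4,\quad\tilde\tau_4:\tilde{\mathrm e}_4\to\tilde{\mathrm e}_6,$$ and let $I=(\tilde\tau_4\tilde\tau_3,\ \tilde\tau_2\tilde\tau_1,\ \tilde\tau_4\tilde\tau_1,\ \tilde\tau_2\tilde\tau_3)$, an ideal of the path algebra $R\Psi$. There is an isomorphism of $R$-algebras $\Lambda'_{(3)}\to R\Psi/I$ with $\mathrm e_i\mapsto\tilde{\mathrm e}_i+I$ for $i\in\{3,4,5,6\}$ and $\tau_i\mapsto\tilde\tau_i+I$ for $i\in\{1,2,3,4\}$. Moreover, $\mathrm{B}_{\mathbb Z_{(3)}}(S_3,S_3)$ is Morita equivalent to $\Lambda'_{(3)}$.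
   Context: **Double Burnside algebra.** For a finite group $G$ and a commutative ring $R$, $\mathrm{B}_R(G,G)$ is the $R$-module generated by the isomorphism classes $[M]$ of finite $(G,G)$-bisets (finite sets with commuting left and right $G$-actions) modulo $[M\sqcup N]=[M]+[N]$, with multiplication induced by $[M]\cdot[N]=[M\times_G N]$, where $M\times_G N$ is the set of $G$-orbits on $M\times N$ under $g(m,n)=(mg^{-1},gn)$, with biset structure induced by $h(m,n)p=(hm,np)$. **The algebra $A$.** Let $\mathbb Q[\bar\eta,\bar\xi]=\mathbb Q[\eta,\xi]/(\eta^2,\eta\xi,\xi^2)$, with $\mathbb Q$-basis $1,\bar\eta,\bar\xi$. $A$ consists of arrays $[a_{i,j}]_{i,j\in\{1,2,3,4\}}$ with $a_{i,j}\in A_{i,j}$, where $A_{1,1}=\mathbb Q^{3\times3}$, $A_{1,4}=\mathbb Q^{3\times1}$, $A_{4,1}=\mathbb Q^{1\times3}$, $A_{2,2}=A_{2,4}=A_{3,3}=A_{4,2}=\mathbb Q$, $A_{4,4}=\mathbb Q[\bar\eta,\bar\xi]$, and all other $A_{i,j}=0$. Addition is entrywise; the product of $[a_{i,j}]$ and $[a'_{i,j}]$ has $(i,j)$ entry $\sum_r\alpha_{i,r,j}(a_{i,r},a'_{r,j})$, where the bilinear maps $\alpha_{i,j,k}:A_{i,j}\times A_{j,k}\to A_{i,k}$ are: zero whenever one of $A_{i,j},A_{j,k},A_{i,k}$ is zero; $\alpha_{1,4,1}=0$, $\alpha_{2,4,2}=0$; $\alpha_{4,1,4}(x,y)=(xy)\bar\eta$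 (row times column); $\alpha_{4,2,4}(x,y)=xy(\bar\xi-12\bar\eta)$; $\alpha_{4,4,4}$ is multiplication in $\mathbb Q[\bar\eta,\bar\xi]$; in $\alpha_{1,4,4},\alpha_{2,4,4},\alpha_{4,4,1},\alpha_{4,4,2}$ an element $a+b\bar\eta+c\bar\xi\in A_{4,4}$ acts as multiplication by its constant term $a$; and $\alpha_{1,1,1},\alpha_{1,1,4},\alpha_{4,1,1},\alpha_{2,2,2},\alpha_{2,2,4},\alpha_{4,2,2},\alpha_{3,3,3}$ are the usual (matrix) products. Elements of $A$ are written as $6\times6$ arrays with block sizes $3,1,1,1$. **The order $\Lambda_{(3)}$.** With $R=\mathbb Z_{(3)}$, $\Lambda_{(3)}$ is the $R$-subalgebra of $A$ consisting of all $$\begin{bmatrix} s_{1,1}&s_{1,2}&s_{1,3}&0&0&t_1\\ s_{2,1}&s_{2,2}&s_{2,3}&0&0&t_2\\ s_{3,1}&s_{3,2}&s_{3,3}&0&0&t_3\\ 0&0&0&u&0&v\\ 0&0&0&0&w&0\\ x_1&x_2&x_3&y&0&z_1+z_2\bar\eta+z_3\bar\xi\end{bmatrix}$$ with $s_{i,j},t_i,u,v,w,x_i,y,z_i\in R$ satisfying $x_1\equiv x_2\equiv x_3\equiv z_2\equiv0\pmod 3$. **Elements.** Each of the following has a single nonzero entry (in $6\times6$ array positions): $\mathrm e_3,\mathrm e_4,\mathrm e_5,\mathrm e_6$ have entry $1$ at $(3,3),(4,4),(5,5),(6,6)$ respectively; $\tau_1$ has entry $3$ at $(6,3)$; $\tau_2$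 has entry $1$ at $(3,6)$; $\tau_3$ has entry $1$ at $(6,4)$; $\tau_4$ has entry $1$ at $(4,6)$. Put $\Lambda'_{(3)}=(\mathrm e_3+\mathrm e_4+\mathrm e_5+\mathrm e_6)\Lambda_{(3)}(\mathrm e_3+\mathrm e_4+\mathrm e_5+\mathrm e_6)$. **Path algebra convention.** Paths are composed from left to right: $\alpha\beta$ means first the arrow $\alpha$, then $\beta$; an arrow $\alpha:x\to y$ satisfies $x\alpha y=\alpha$, where the vertices also denote the corresponding idempotents (trivial paths). Parentheses denote the two-sided ideal generated. *)

theory Defs
  imports
    "HOL-Algebra.Sym_Groups"
    "HOL-Algebra.QuotRing"
    "HOL-Algebra.Module"
    "HOL-Analysis.Cartesian_Space"
    "HOL-Library.Infinite_Typeclass"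
    "Graph_Theory.Arc_Walk"
begin

section \<open>Algebras over a commutative ring\<close>

text \<open>The library locale \<open>algebra\<close> demands commutativity, so associative unital algebras are
  introduced here.\<close>

definition r_algebra :: "('r, 'k) ring_scheme \<Rightarrow> ('r, 'a, 'l) module_scheme \<Rightarrow> bool" where
  "r_algebra R A \<longleftrightarrow> Module.module R A \<and> Ring.ring A \<and>
     (\<forall>r\<in>carrier R. \<forall>x\<in>carrier A. \<forall>y\<in>carrier A.
        (r \<odot>\<^bsub>A\<^esub> x) \<otimes>\<^bsub>A\<^esub> y = r \<odot>\<^bsub>A\<^esub> (x \<otimes>\<^bsub>A\<^esub> y) \<and>
        x \<otimes>\<^bsub>A\<^esub> (r \<odot>\<^bsub>A\<^esub> y) = r \<odot>\<^bsub>A\<^esub> (x \<otimes>\<^bsub>A\<^esub> y))"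

definition r_algebra_iso ::
  "('r, 'k) ring_scheme \<Rightarrow> ('r, 'a, 'l) module_scheme \<Rightarrow> ('r, 'b, 'm) module_scheme \<Rightarrow>
   ('a \<Rightarrow> 'b) set" where
  "r_algebra_iso R A B = {\<phi>. r_algebra R A \<and> r_algebra R B \<and> \<phi> \<in> ring_iso A B \<and>
     (\<forall>r\<in>carrier R. \<forall>x\<in>carrier A. \<phi> (r \<odot>\<^bsub>A\<^esub> x) = r \<odot>\<^bsub>B\<^esub> \<phi> x)}"

text \<open>The library's \<open>M Quot I\<close> together with the induced scalar multiplication.\<close>

definition quot_algebra :: "('r, 'a, 'l) module_scheme \<Rightarrow> 'a set \<Rightarrow> ('r, 'a set) module" where
  "quot_algebra M I =
    \<lparr>carrier = carrier (M Quot I), mult = mult (M Quot I), one = one (M Quot I),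
     zero = zero (M Quot I), add = add (M Quot I),
     smult = (\<lambda>r X. \<Union>x\<in>X. I +>\<^bsub>M\<^esub> (r \<odot>\<^bsub>M\<^esub> x))\<rparr>"

definition module_span ::
  "('r, 'k) ring_scheme \<Rightarrow> ('r, 'a, 'l) module_scheme \<Rightarrow> 'a set \<Rightarrow> 'a set" where
  "module_span R M X = \<Inter>{H. submodule H R M \<and> X \<subseteq> H}"

text \<open>The free \<open>R\<close>-module on a set \<open>S\<close> (finitely supported functions, extended by zero outside \<open>S\<close>)
  with the bilinear multiplication given on basis elements by a partial operation, where
  \<open>None\<close> means that the product is zero. The unit is the sum of the basis elements in the finite
  set \<open>E\<close>.\<close>

definition free_algebra_on ::
  "('r, 'k) ring_scheme \<Rightarrow> 's set \<Rightarrow> ('s \<Rightarrow> 's \<Rightarrow> 's option) \<Rightarrow> 's set \<Rightarrow> ('r, 's \<Rightarrow> 'r) module" where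
  "free_algebra_on R S opr E =
    \<lparr>carrier = {f. (\<forall>s\<in>S. f s \<in> carrier R) \<and> (\<forall>s. s \<notin> S \<longrightarrow> f s = \<zero>\<^bsub>R\<^esub>) \<and>
                   finite {s. f s \<noteq> \<zero>\<^bsub>R\<^esub>}},
     mult = (\<lambda>f g s. \<Oplus>\<^bsub>R\<^esub>p\<in>{(a, b). f a \<noteq> \<zero>\<^bsub>R\<^esub> \<and> g b \<noteq> \<zero>\<^bsub>R\<^esub> \<and> opr a b = Some s}.
                       f (fst p) \<otimes>\<^bsub>R\<^esub> g (snd p)),
     one = (\<lambda>s. if s \<in> E then \<one>\<^bsub>R\<^esub> else \<zero>\<^bsub>R\<^esub>),
     zero = (\<lambda>s. \<zero>\<^bsub>R\<^esub>),
     add = (\<lambda>f g s. f s \<oplus>\<^bsub>R\<^esub> g s),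
     smult = (\<lambda>r f s. r \<otimes>\<^bsub>R\<^esub> f s)\<rparr>"

definition basis_elem :: "('r, 'k) ring_scheme \<Rightarrow> 's \<Rightarrow> 's \<Rightarrow> 'r" where
  "basis_elem R s = (\<lambda>t. if t = s then \<one>\<^bsub>R\<^esub> else \<zero>\<^bsub>R\<^esub>)"


section \<open>The double Burnside algebra\<close>

record ('g, 'm) biset =
  bset :: "'m set"
  lact :: "'g \<Rightarrow> 'm \<Rightarrow> 'm"
  ract :: "'m \<Rightarrow> 'g \<Rightarrow> 'm"

definition finite_biset :: "('g, 'k) monoid_scheme \<Rightarrow> ('g, 'm) biset \<Rightarrow> bool" where
  "finite_biset G M \<longleftrightarrow> finite (bset M) \<and>
     (\<forall>m\<in>bset M. lact M \<one>\<^bsub>G\<^esub> m = m \<and> ract M m \<one>\<^bsub>G\<^esub> = m) \<and>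
     (\<forall>g\<in>carrier G. \<forall>m\<in>bset M. lact M g m \<in> bset M \<and> ract M m g \<in> bset M) \<and>
     (\<forall>g\<in>carrier G. \<forall>h\<in>carrier G. \<forall>m\<in>bset M.
        lact M (g \<otimes>\<^bsub>G\<^esub> h) m = lact M g (lact M h m) \<and>
        ract M m (g \<otimes>\<^bsub>G\<^esub> h) = ract M (ract M m g) h \<and>
        ract M (lact M g m) h = lact M g (ract M m h))"

definition biset_isomorphic ::
  "('g, 'k) monoid_scheme \<Rightarrow> ('g, 'm) biset \<Rightarrow> ('g, 'n) biset \<Rightarrow> bool" where
  "biset_isomorphic G M N \<longleftrightarrow> (\<exists>f. bij_betw f (bset M) (bset N) \<and>
     (\<forall>g\<in>carrier G. \<forall>m\<in>bset M.
        f (lact M g m) = lact N g (f m) \<and> f (ract M m g) = ract N (f m) g))"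

text \<open>The isomorphism class of a finite biset over an arbitrary type is represented by the set of
  those bisets on sets of natural numbers which are isomorphic to it. As every finite set is in
  bijection with a set of natural numbers, no isomorphism class is lost.\<close>

definition biset_class ::
  "('g, 'k) monoid_scheme \<Rightarrow> ('g, 'm) biset \<Rightarrow> ('g, nat) biset set" where
  "biset_class G M = {P. finite_biset G P \<and> biset_isomorphic G M P}"

definition biset_classes :: "('g, 'k) monoid_scheme \<Rightarrow> ('g, nat) biset set set" where
  "biset_classes G = {biset_class G M | M :: ('g, nat) biset. finite_biset G M}"

definition biset_union :: "('g, 'm) biset \<Rightarrow> ('g, 'n) biset \<Rightarrow> ('g, 'm + 'n) biset" where
  "biset_union M N =
    \<lparr>bset = bset M <+> bset N,
     lact = (\<lambda>g. map_sum (lact M g) (lact N g)),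
     ract = (\<lambda>m g. map_sum (\<lambda>x. ract M x g) (\<lambda>y. ract N y g) m)\<rparr>"

definition biset_orbit ::
  "('g, 'k) monoid_scheme \<Rightarrow> ('g, 'm) biset \<Rightarrow> ('g, 'n) biset \<Rightarrow> 'm \<times> 'n \<Rightarrow> ('m \<times> 'n) set" where
  "biset_orbit G M N p =
     (\<lambda>g. (ract M (fst p) (inv\<^bsub>G\<^esub> g), lact N g (snd p))) ` carrier G"

definition biset_tensor ::
  "('g, 'k) monoid_scheme \<Rightarrow> ('g, 'm) biset \<Rightarrow> ('g, 'n) biset \<Rightarrow> ('g, ('m \<times> 'n) set) biset" where
  "biset_tensor G M N =
    \<lparr>bset = biset_orbit G M N ` (bset M \<times> bset N),
     lact = (\<lambda>h X. map_prod (lact M h) id ` X),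
     ract = (\<lambda>X p. map_prod id (\<lambda>n. ract N n p) ` X)\<rparr>"

definition regular_biset :: "('g, 'k) monoid_scheme \<Rightarrow> ('g, 'g) biset" where
  "regular_biset G = \<lparr>bset = carrier G, lact = mult G, ract = mult G\<rparr>"

text \<open>The union below runs over representatives of \<open>X\<close> and \<open>Y\<close>, all of which yield the same class.\<close>

definition biset_class_mult ::
  "('g, 'k) monoid_scheme \<Rightarrow> ('g, nat) biset set \<Rightarrow> ('g, nat) biset set \<Rightarrow> ('g, nat) biset set" where
  "biset_class_mult G X Y = (\<Union>M\<in>X. \<Union>N\<in>Y. biset_class G (biset_tensor G M N))"

definition free_biset_algebra ::
  "('r, 'k) ring_scheme \<Rightarrow> ('g, 'l) monoid_scheme \<Rightarrow> ('r, ('g, nat) biset set \<Rightarrow> 'r) module" where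
  "free_biset_algebra R G =
     free_algebra_on R (biset_classes G) (\<lambda>X Y. Some (biset_class_mult G X Y))
       {biset_class G (regular_biset G)}"

definition biset_relations ::
  "('r, 'k) ring_scheme \<Rightarrow> ('g, 'l) monoid_scheme \<Rightarrow> (('g, nat) biset set \<Rightarrow> 'r) set" where
  "biset_relations R G =
     (let F = free_biset_algebra R G; b = (\<lambda>X. basis_elem R X) in
      {b (biset_class G (biset_union M N)) \<ominus>\<^bsub>F\<^esub> (b (biset_class G M) \<oplus>\<^bsub>F\<^esub> b (biset_class G N))
        | (M :: ('g, nat) biset) (N :: ('g, nat) biset).
            finite_biset G M \<and> finite_biset G N})"

definition double_burnside ::
  "('r, 'k) ring_scheme \<Rightarrow> ('g, 'l) monoid_scheme \<Rightarrow>
   ('r, (('g, nat) biset set \<Rightarrow> 'r) set) module" where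
  "double_burnside R G =
     quot_algebra (free_biset_algebra R G)
       (module_span R (free_biset_algebra R G) (biset_relations R G))"


section \<open>Path algebras\<close>

text \<open>A quiver is a directed multigraph; a path from \<open>u\<close> to \<open>v\<close> with list of arrows \<open>p\<close> is the
  triple \<open>(u, p, v)\<close>, and the trivial path at \<open>v\<close> is \<open>(v, [], v)\<close>.\<close>

definition paths :: "('v, 'e) pre_digraph \<Rightarrow> ('v \<times> 'e list \<times> 'v) set" where
  "paths Q = {(u, p, v). pre_digraph.awalk Q u p v}"

fun path_comp :: "'v \<times> 'e list \<times> 'v \<Rightarrow> 'v \<times> 'e list \<times> 'v \<Rightarrow> ('v \<times> 'e list \<times> 'v) option" where
  "path_comp (u, p, v) (v', q, w) = (if v = v' then Some (u, p @ q, w) else None)"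

definition path_algebra ::
  "('r, 'k) ring_scheme \<Rightarrow> ('v, 'e) pre_digraph \<Rightarrow> ('r, 'v \<times> 'e list \<times> 'v \<Rightarrow> 'r) module" where
  "path_algebra R Q = free_algebra_on R (paths Q) path_comp ((\<lambda>v. (v, [], v)) ` verts Q)"

definition vertex_elem ::
  "('r, 'k) ring_scheme \<Rightarrow> 'v \<Rightarrow> ('v \<times> 'e list \<times> 'v \<Rightarrow> 'r)" where
  "vertex_elem R v = basis_elem R (v, [], v)"

definition arrow_elem ::
  "('r, 'k) ring_scheme \<Rightarrow> ('v, 'e) pre_digraph \<Rightarrow> 'e \<Rightarrow> ('v \<times> 'e list \<times> 'v \<Rightarrow> 'r)" where
  "arrow_elem R Q e = basis_elem R (tail Q e, [e], head Q e)"

datatype psi_vertex = V3 | V4 | V5 | V6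
datatype psi_arrow = T1 | T2 | T3 | T4

definition Psi :: "(psi_vertex, psi_arrow) pre_digraph" where
  "Psi = \<lparr>verts = UNIV, arcs = UNIV,
     tail = (\<lambda>a. case a of T1 \<Rightarrow> V6 | T2 \<Rightarrow> V3 | T3 \<Rightarrow> V6 | T4 \<Rightarrow> V4),
     head = (\<lambda>a. case a of T1 \<Rightarrow> V3 | T2 \<Rightarrow> V6 | T3 \<Rightarrow> V4 | T4 \<Rightarrow> V6)\<rparr>"

definition Psi_ideal ::
  "('r, 'k) ring_scheme \<Rightarrow> (psi_vertex \<times> psi_arrow list \<times> psi_vertex \<Rightarrow> 'r) set" where
  "Psi_ideal R = (let P = path_algebra R Psi; t = arrow_elem R Psi in
     genideal P {t T4 \<otimes>\<^bsub>P\<^esub> t T3, t T2 \<otimes>\<^bsub>P\<^esub> t T1, t T4 \<otimes>\<^bsub>P\<^esub> t T1, t T2 \<otimes>\<^bsub>P\<^esub> t T3})"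


section \<open>The algebra \<open>A\<close>\<close>

text \<open>The ring \<open>\<rat>[\<eta>, \<xi>]/(\<eta>\<^sup>2, \<eta>\<xi>, \<xi>\<^sup>2)\<close> by coordinates: \<open>QEX a b c\<close> stands for
  \<open>a + b \<eta> + c \<xi>\<close>.\<close>

datatype qex = QEX (cst: rat) (eta_part: rat) (xi_part: rat)

lemma qex_eq_iff: "x = y \<longleftrightarrow> cst x = cst y \<and> eta_part x = eta_part y \<and> xi_part x = xi_part y"
  using qex.expand by auto

instantiation qex :: comm_ring_1
begin

definition "0 = QEX 0 0 0"
definition "1 = QEX 1 0 0"
definition "x + y = QEX (cst x + cst y) (eta_part x + eta_part y) (xi_part x + xi_part y)"
definition "x - y = QEX (cst x - cst y) (eta_part x - eta_part y) (xi_part x - xi_part y)"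
definition "- x = QEX (- cst x) (- eta_part x) (- xi_part x)"
definition "x * y = QEX (cst x * cst y) (cst x * eta_part y + eta_part x * cst y)
                        (cst x * xi_part y + xi_part x * cst y)"

instance
  by standard
    (simp_all add: qex_eq_iff zero_qex_def one_qex_def plus_qex_def minus_qex_def uminus_qex_def
      times_qex_def algebra_simps)

end

definition qex_eta :: qex where "qex_eta = QEX 0 1 0"
definition qex_xi :: qex where "qex_xi = QEX 0 0 1"

definition qex_of_rat :: "rat \<Rightarrow> qex" where "qex_of_rat a = QEX a 0 0"

text \<open>The nonzero blocks of an array, where row and column \<open>i\<close> of the \<open>6\<times>6\<close> array for \<open>i \<le> 3\<close>
  correspond to the index \<open>i :: 3\<close> within the first block (so that the third one has index
  \<open>3 = (0 :: 3)\<close>), and \<open>4\<close>, \<open>5\<close>, \<open>6\<close> correspond to the blocks \<open>2\<close>, \<open>3\<close>, \<open>4\<close>.\<close>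

datatype alg = Alg
  (b11: "rat^3^3") (b14: "rat^3")
  (b22: rat) (b24: rat)
  (b33: rat)
  (b41: "rat^3") (b42: rat) (b44: qex)

lemma alg_eq_iff:
  "x = y \<longleftrightarrow> b11 x = b11 y \<and> b14 x = b14 y \<and> b22 x = b22 y \<and> b24 x = b24 y \<and>
     b33 x = b33 y \<and> b41 x = b41 y \<and> b42 x = b42 y \<and> b44 x = b44 y"
  using alg.expand by auto

definition row_col :: "rat^3 \<Rightarrow> rat^3 \<Rightarrow> rat" where
  "row_col x y = (\<Sum>i\<in>UNIV. x $ i * y $ i)"

text \<open>In the multiplication, the \<open>(1,1)\<close> and \<open>(2,2)\<close> entries have a single summand because
  \<open>\<alpha>\<^sub>1\<^sub>,\<^sub>4\<^sub>,\<^sub>1\<close> and \<open>\<alpha>\<^sub>2\<^sub>,\<^sub>4\<^sub>,\<^sub>2\<close> are zero.\<close>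

instantiation alg :: ring_1
begin

definition "0 = Alg 0 0 0 0 0 0 0 0"
definition "1 = Alg (mat 1) 0 1 0 1 0 0 1"
definition "x + y = Alg (b11 x + b11 y) (b14 x + b14 y) (b22 x + b22 y) (b24 x + b24 y)
  (b33 x + b33 y) (b41 x + b41 y) (b42 x + b42 y) (b44 x + b44 y)"
definition "x - y = Alg (b11 x - b11 y) (b14 x - b14 y) (b22 x - b22 y) (b24 x - b24 y)
  (b33 x - b33 y) (b41 x - b41 y) (b42 x - b42 y) (b44 x - b44 y)"
definition "- x = Alg (- b11 x) (- b14 x) (- b22 x) (- b24 x)
  (- b33 x) (- b41 x) (- b42 x) (- b44 x)"
definition "x * y = Alg
  (b11 x ** b11 y)
  (b11 x *v b14 y + cst (b44 y) *s b14 x)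
  (b22 x * b22 y)
  (b22 x * b24 y + b24 x * cst (b44 y))
  (b33 x * b33 y)
  (b41 x v* b11 y + cst (b44 x) *s b41 y)
  (b42 x * b22 y + cst (b44 x) * b42 y)
  (qex_of_rat (row_col (b41 x) (b14 y)) * qex_eta
    + qex_of_rat (b42 x * b24 y) * (qex_xi - 12 * qex_eta)
    + b44 x * b44 y)"

lemmas alg_ops = zero_alg_def one_alg_def plus_alg_def minus_alg_def uminus_alg_def times_alg_def

lemmas qex_ops = qex_eq_iff zero_qex_def one_qex_def plus_qex_def minus_qex_def uminus_qex_def
  times_qex_def qex_of_rat_def qex_eta_def qex_xi_def

lemma numeral_qex: "numeral n = QEX (numeral n) 0 0"
  by (induction n) (simp_all only: numeral_One numeral_Bit0 numeral_Bit1 one_qex_def plus_qex_def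
      qex.sel add_0_right)

lemmas block_ops = vec_eq_iff matrix_matrix_mult_def matrix_vector_mult_def
  vector_matrix_mult_def row_col_def mat_def

lemma block_distrib:
  fixes M M' :: "rat^3^3" and v w :: "rat^3"
  shows "(M + M') ** N = M ** N + M' ** N" "N ** (M + M') = N ** M + N ** M'"
    "(M + M') *v v = M *v v + M' *v v" "M *v (v + w) = M *v v + M *v w"
    "(v + w) v* M = v v* M + w v* M" "v v* (M + M') = v v* M + v v* M'"
    "row_col (v + w) u = row_col v u + row_col w u"
    "row_col u (v + w) = row_col u v + row_col u w"
  by (simp_all add: block_ops sum.distrib distrib_left distrib_right)

lemma block_assoc:
  fixes M N :: "rat^3^3" and v w :: "rat^3"
  shows "M ** N ** L = M ** (N ** L)" "M ** N *v v = M *v (N *v v)"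
    "v v* M v* N = v v* (M ** N)" "row_col (v v* M) w = row_col v (M *v w)"
    "M *v (r *s v) = r *s (M *v v)" "(r *s v) v* M = r *s (v v* M)"
    "row_col (r *s v) w = r * row_col v w" "row_col v (r *s w) = r * row_col v w"
  by (simp_all only: block_ops vec_lambda_beta sum_3 vector_smult_component)
    (simp_all add: algebra_simps)

lemma block_one:
  fixes M :: "rat^3^3" and v :: "rat^3"
  shows "mat 1 ** M = M" "M ** mat 1 = M" "mat 1 *v v = v" "v v* mat 1 = v"
    "0 *v v = 0" "M *v 0 = 0" "0 v* M = 0" "v v* 0 = 0" "row_col 0 v = 0" "row_col v 0 = 0"
  by (simp_all add: row_col_def)

instance
proof
  fix a b c :: alg
  show "a * b * c = a * (b * c)"
    by (simp add: alg_eq_iff alg_ops block_distrib block_assoc qex_ops numeral_qex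
        vector_add_ldistrib vector_smult_assoc algebra_simps)
  show "1 * a = a" "a * 1 = a"
    by (simp_all add: alg_eq_iff alg_ops block_one qex_ops numeral_qex)
  show "(a + b) * c = a * c + b * c" "a * (b + c) = a * b + a * c"
    by (simp_all add: alg_eq_iff alg_ops block_distrib qex_ops numeral_qex
        vector_add_ldistrib vector_sadd_rdistrib algebra_simps)
  show "(0 :: alg) \<noteq> 1" by (simp add: alg_eq_iff alg_ops)
qed (simp_all add: alg_eq_iff alg_ops)

end

definition alg_scale :: "rat \<Rightarrow> alg \<Rightarrow> alg" where
  "alg_scale r x = Alg (\<chi> i. r *s (b11 x $ i)) (r *s b14 x) (r * b22 x) (r * b24 x)
     (r * b33 x) (r *s b41 x) (r * b42 x) (qex_of_rat r * b44 x)"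


section \<open>The order \<open>\<Lambda>\<^sub>(\<^sub>3\<^sub>)\<close> and its corner \<open>\<Lambda>'\<^sub>(\<^sub>3\<^sub>)\<close>\<close>

text \<open>The localization of the integers at the prime ideal generated by \<open>p\<close>.\<close>

definition zloc :: "nat \<Rightarrow> rat set" where
  "zloc p = {of_int a / of_int b | a b :: int. \<not> int p dvd b}"

definition zloc_ring :: "nat \<Rightarrow> rat ring" where
  "zloc_ring p = \<lparr>carrier = zloc p, mult = (*), one = 1, zero = 0, add = (+)\<rparr>"

definition Lam3 :: "alg set" where
  "Lam3 = {x.
     (\<forall>i j. b11 x $ i $ j \<in> zloc 3) \<and> (\<forall>i. b14 x $ i \<in> zloc 3) \<and>
     b22 x \<in> zloc 3 \<and> b24 x \<in> zloc 3 \<and> b33 x \<in> zloc 3 \<and>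
     (\<forall>i. b41 x $ i \<in> (*) 3 ` zloc 3) \<and> b42 x \<in> zloc 3 \<and>
     cst (b44 x) \<in> zloc 3 \<and> eta_part (b44 x) \<in> (*) 3 ` zloc 3 \<and> xi_part (b44 x) \<in> zloc 3}"

definition e3 :: alg where
  "e3 = Alg (\<chi> i j. if i = 3 \<and> j = 3 then 1 else 0) 0 0 0 0 0 0 0"
definition e4 :: alg where "e4 = Alg 0 0 1 0 0 0 0 0"
definition e5 :: alg where "e5 = Alg 0 0 0 0 1 0 0 0"
definition e6 :: alg where "e6 = Alg 0 0 0 0 0 0 0 1"

definition tau1 :: alg where "tau1 = Alg 0 0 0 0 0 (axis 3 3) 0 0"
definition tau2 :: alg where "tau2 = Alg 0 (axis 3 1) 0 0 0 0 0 0"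
definition tau3 :: alg where "tau3 = Alg 0 0 0 0 0 0 1 0"
definition tau4 :: alg where "tau4 = Alg 0 0 0 1 0 0 0 0"

definition Lam3' :: "(rat, alg) module" where
  "Lam3' = (let e = e3 + e4 + e5 + e6 in
    \<lparr>carrier = (\<lambda>x. e * x * e) ` Lam3, mult = (*), one = e, zero = 0, add = (+),
     smult = alg_scale\<rparr>)"


section \<open>Morita equivalence\<close>

locale left_module = A?: Ring.ring A + M?: abelian_group M for A (structure) and M (structure) +
  assumes lsmult_closed: "\<lbrakk>a \<in> carrier A; x \<in> carrier M\<rbrakk> \<Longrightarrow> a \<odot>\<^bsub>M\<^esub> x \<in> carrier M"
    and lsmult_l_distr: "\<lbrakk>a \<in> carrier A; b \<in> carrier A; x \<in> carrier M\<rbrakk> \<Longrightarrow>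
      (a \<oplus> b) \<odot>\<^bsub>M\<^esub> x = a \<odot>\<^bsub>M\<^esub> x \<oplus>\<^bsub>M\<^esub> b \<odot>\<^bsub>M\<^esub> x"
    and lsmult_r_distr: "\<lbrakk>a \<in> carrier A; x \<in> carrier M; y \<in> carrier M\<rbrakk> \<Longrightarrow>
      a \<odot>\<^bsub>M\<^esub> (x \<oplus>\<^bsub>M\<^esub> y) = a \<odot>\<^bsub>M\<^esub> x \<oplus>\<^bsub>M\<^esub> a \<odot>\<^bsub>M\<^esub> y"
    and lsmult_assoc: "\<lbrakk>a \<in> carrier A; b \<in> carrier A; x \<in> carrier M\<rbrakk> \<Longrightarrow>
      (a \<otimes> b) \<odot>\<^bsub>M\<^esub> x = a \<odot>\<^bsub>M\<^esub> (b \<odot>\<^bsub>M\<^esub> x)"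
    and lsmult_one: "x \<in> carrier M \<Longrightarrow> \<one> \<odot>\<^bsub>M\<^esub> x = x"

text \<open>The category of left modules over \<open>A\<close> whose underlying set lies in the type \<open>'u\<close>. Morphisms
  are extensional functions, so that equality of morphisms is equality of functions.\<close>

definition lmods :: "('a, 'k) ring_scheme \<Rightarrow> ('a, 'u) module set" where
  "lmods A = {M. left_module A M}"

definition lmod_hom ::
  "('a, 'k) ring_scheme \<Rightarrow> ('a, 'u) module \<Rightarrow> ('a, 'u) module \<Rightarrow> ('u \<Rightarrow> 'u) set" where
  "lmod_hom A M N = {f \<in> carrier M \<rightarrow>\<^sub>E carrier N.
     (\<forall>x\<in>carrier M. \<forall>y\<in>carrier M. f (x \<oplus>\<^bsub>M\<^esub> y) = f x \<oplus>\<^bsub>N\<^esub> f y) \<and>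
     (\<forall>a\<in>carrier A. \<forall>x\<in>carrier M. f (a \<odot>\<^bsub>M\<^esub> x) = a \<odot>\<^bsub>N\<^esub> f x)}"

definition additive_functor ::
  "('a, 'k) ring_scheme \<Rightarrow> ('b, 'l) ring_scheme \<Rightarrow> (('a, 'u) module \<Rightarrow> ('b, 'u) module) \<Rightarrow>
   (('a, 'u) module \<Rightarrow> ('a, 'u) module \<Rightarrow> ('u \<Rightarrow> 'u) \<Rightarrow> ('u \<Rightarrow> 'u)) \<Rightarrow> bool" where
  "additive_functor A B Fo Fm \<longleftrightarrow>
     (\<forall>M\<in>lmods A. Fo M \<in> lmods B) \<and>
     (\<forall>M\<in>lmods A. Fm M M (\<lambda>x\<in>carrier M. x) = (\<lambda>x\<in>carrier (Fo M). x)) \<and>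
     (\<forall>M\<in>lmods A. \<forall>N\<in>lmods A. \<forall>f\<in>lmod_hom A M N. Fm M N f \<in> lmod_hom B (Fo M) (Fo N)) \<and>
     (\<forall>L\<in>lmods A. \<forall>M\<in>lmods A. \<forall>N\<in>lmods A. \<forall>f\<in>lmod_hom A L M. \<forall>g\<in>lmod_hom A M N.
        Fm L N (compose (carrier L) g f) = compose (carrier (Fo L)) (Fm M N g) (Fm L M f)) \<and>
     (\<forall>M\<in>lmods A. \<forall>N\<in>lmods A. \<forall>f\<in>lmod_hom A M N. \<forall>g\<in>lmod_hom A M N.
        Fm M N (\<lambda>x\<in>carrier M. f x \<oplus>\<^bsub>N\<^esub> g x) =
          (\<lambda>x\<in>carrier (Fo M). Fm M N f x \<oplus>\<^bsub>Fo N\<^esub> Fm M N g x))"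

text \<open>A natural isomorphism from the endofunctor \<open>(To, Tm)\<close> to the identity functor.\<close>

definition natural_iso_to_id ::
  "('a, 'k) ring_scheme \<Rightarrow> (('a, 'u) module \<Rightarrow> ('a, 'u) module) \<Rightarrow>
   (('a, 'u) module \<Rightarrow> ('a, 'u) module \<Rightarrow> ('u \<Rightarrow> 'u) \<Rightarrow> ('u \<Rightarrow> 'u)) \<Rightarrow>
   (('a, 'u) module \<Rightarrow> ('u \<Rightarrow> 'u)) \<Rightarrow> bool" where
  "natural_iso_to_id A To Tm \<theta> \<longleftrightarrow>
     (\<forall>M\<in>lmods A. \<theta> M \<in> lmod_hom A (To M) M \<and> bij_betw (\<theta> M) (carrier (To M)) (carrier M)) \<and>
     (\<forall>M\<in>lmods A. \<forall>N\<in>lmods A. \<forall>f\<in>lmod_hom A M N.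
        compose (carrier (To M)) f (\<theta> M) = compose (carrier (To M)) (\<theta> N) (Tm M N f))"

text \<open>Equivalence of module categories. The type \<open>'u\<close> plays the role of the universe of sets; it
  should be infinite and at least as large as the two rings, and a statement for all such \<open>'u\<close>
  covers modules of arbitrary size.\<close>

definition morita_equivalent ::
  "'u itself \<Rightarrow> ('a, 'k) ring_scheme \<Rightarrow> ('b, 'l) ring_scheme \<Rightarrow> bool" where
  "morita_equivalent U A B \<longleftrightarrow> Ring.ring A \<and> Ring.ring B \<and>
     (\<exists>(Fo :: ('a, 'u) module \<Rightarrow> ('b, 'u) module) Fm
       (Go :: ('b, 'u) module \<Rightarrow> ('a, 'u) module) Gm \<theta> \<kappa>.
        additive_functor A B Fo Fm \<and> additive_functor B A Go Gm \<and>
        natural_iso_to_id A (\<lambda>M. Go (Fo M)) (\<lambda>M N f. Gm (Fo M) (Fo N) (Fm M N f)) \<theta> \<and>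
        natural_iso_to_id B (\<lambda>M. Fo (Go M)) (\<lambda>M N f. Fm (Go M) (Go N) (Gm M N f)) \<kappa>)"

end

theory Submission
  imports Defs "HOL-Computational_Algebra.Primes"
begin

text \<open>
  A \<open>(G, G)\<close>-biset \<open>M\<close> is recorded by the stabilizers \<open>stab m = {(g, h). g m = m h}\<close> of its points. As
  \<open>stab [m, n] = stab m O stab n\<close>, a weight \<open>w\<close> on the subgroups of \<open>G \<times> G\<close> makes
  \<open>M \<mapsto> (\<Sum>m\<in>M. w (stab m))\<close> multiplicative once a finite identity holds for every pair of subgroups
  (\<open>kf\<close> below). For \<open>G = S\<^sub>3\<close> the group \<open>G \<times> G\<close> has 22 classes of subgroups; for the weights given by
  \<open>rel_mark\<close> the identity is checked by rewriting for representatives, and since the resulting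
  \<open>22 \<times> 22\<close> matrix of values is invertible over \<open>\<int>\<^sub>(\<^sub>3\<^sub>)\<close>, the double Burnside algebra is isomorphic to
  \<open>\<Lambda>\<^sub>(\<^sub>3\<^sub>)\<close>. The three diagonal idempotents of the matrix block being equivalent, \<open>\<Lambda>'\<^sub>(\<^sub>3\<^sub>)\<close> is a full
  corner of \<open>\<Lambda>\<^sub>(\<^sub>3\<^sub>)\<close>. Evaluation of paths at the elements \<open>\<tau>\<^sub>i\<close> maps the path algebra onto \<open>\<Lambda>'\<^sub>(\<^sub>3\<^sub>)\<close>; its
  kernel is \<open>I\<close> because only ten paths avoid the four generators of \<open>I\<close>, and their values are linearly
  independent.
\<close>

section \<open>Quotients presented by a surjection\<close>

text \<open>The finite identity comes from averaging. If every pair (m, n) is counted with the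
  number of h such that m h = m and h n = n, each point of the tensor product is counted |G| times.
  Replacing m by m g permutes M and conjugates the second coordinate of stab m. Summing over g as
  well, multiplicativity follows from an equation about two subgroups only, and outer conjugations
  do not affect that equation. The double Burnside algebra is a free module modulo the span of
  relations, and neither associativity of the tensor product nor the ideal property of the span is
  proved directly. The span is shown to be the kernel of a multiplicative linear map onto the order,
  and the ring structure is read back through that map. Module categories live over one type 'u,
  whereas the inverse of M -> e M is built from functions on e A. These functions must be coded
  inside 'u, which works because each is determined by finitely many values in an infinite
  type.\<close>

locale ring_presentation = F: abelian_group F + T: Ring.ring T
  for F :: "('r, 'a, 'l) module_scheme" (structure) and T :: "('b, 'm) ring_scheme"
  and h :: "'a \<Rightarrow> 'b" +
  assumes h_onto: "h ` carrier F = carrier T"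
    and h_add: "\<lbrakk>x \<in> carrier F; y \<in> carrier F\<rbrakk> \<Longrightarrow> h (x \<oplus> y) = h x \<oplus>\<^bsub>T\<^esub> h y"
    and mult_closed: "\<lbrakk>x \<in> carrier F; y \<in> carrier F\<rbrakk> \<Longrightarrow> x \<otimes> y \<in> carrier F"
    and h_mult: "\<lbrakk>x \<in> carrier F; y \<in> carrier F\<rbrakk> \<Longrightarrow> h (x \<otimes> y) = h x \<otimes>\<^bsub>T\<^esub> h y"
    and one_closed: "\<one> \<in> carrier F"
    and h_one: "h \<one> = \<one>\<^bsub>T\<^esub>"
begin

text \<open>The fibres of \<open>h\<close> are the cosets of its kernel, so \<open>fib\<close>
  inverts the induced map F/Ker -> T. Multiplication on F is only assumed to be closed; the ring
  axioms of the quotient are carried over from T.\<close>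

definition fib :: "'b \<Rightarrow> 'a set" where
  "fib t = {x \<in> carrier F. h x = t}"

abbreviation Ker :: "'a set" where "Ker \<equiv> fib \<zero>\<^bsub>T\<^esub>"

lemma h_closed: "x \<in> carrier F \<Longrightarrow> h x \<in> carrier T"
  using h_onto by blast

lemma h_minus:
  assumes "x \<in> carrier F" "y \<in> carrier F"
  shows "h (x \<ominus> y) = h x \<ominus>\<^bsub>T\<^esub> h y"
proof -
  have "h (x \<ominus> y) \<oplus>\<^bsub>T\<^esub> h y = h x"
    using h_add[of "x \<ominus> y" y] assms
    by (simp add: F.minus_closed) (simp add: F.minus_eq F.add.m_assoc F.l_neg)
  then show ?thesis
    using assms h_closed F.minus_closed
    by (metis T.minus_eq T.add.inv_solve_right h_closed)
qed

lemma coset_eq_fib: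
  assumes "a \<in> carrier F"
  shows "Ker +> a = fib (h a)"
proof
  show "Ker +> a \<subseteq> fib (h a)"
    using assms h_add h_closed by (auto simp: a_r_coset_def r_coset_def fib_def)
  show "fib (h a) \<subseteq> Ker +> a"
  proof
    fix x assume "x \<in> fib (h a)"
    then have x: "x \<in> carrier F" "h x = h a" by (auto simp: fib_def)
    have "x \<ominus> a \<in> Ker"
      using x assms by (simp add: fib_def h_minus F.minus_closed T.minus_eq T.r_neg h_closed)
    moreover have "x = (x \<ominus> a) \<oplus> a"
      using x assms by (simp add: F.minus_eq F.add.m_assoc F.l_neg)
    ultimately show "x \<in> Ker +> a" by (auto simp: a_r_coset_def r_coset_def)
  qed
qed

lemma fib_nonempty: "t \<in> carrier T \<Longrightarrow> \<exists>x\<in>carrier F. h x = t"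
  using h_onto by (metis imageE)

lemma fib_inj: "inj_on fib (carrier T)"
  using fib_nonempty by (fastforce simp: inj_on_def fib_def)

lemma quot_carrier: "carrier (quot_algebra F Ker) = fib ` carrier T"
proof -
  have "carrier (quot_algebra F Ker) = (\<lambda>a. Ker +> a) ` carrier F"
    by (auto simp: quot_algebra_def FactRing_def A_RCOSETS_def' )
  also have "\<dots> = (\<lambda>a. fib (h a)) ` carrier F"
    using coset_eq_fib by (auto intro!: image_cong)
  also have "\<dots> = fib ` carrier T"
    using h_onto by (metis image_image)
  finally show ?thesis .
qed

lemma fib_add:
  assumes "s \<in> carrier T" "t \<in> carrier T"
  shows "fib s \<oplus>\<^bsub>quot_algebra F Ker\<^esub> fib t = fib (s \<oplus>\<^bsub>T\<^esub> t)"
proof -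
  have "set_add F (fib s) (fib t) = fib (s \<oplus>\<^bsub>T\<^esub> t)"
  proof
    show "set_add F (fib s) (fib t) \<subseteq> fib (s \<oplus>\<^bsub>T\<^esub> t)"
      using h_add by (auto simp: set_add_def set_mult_def fib_def)
    show "fib (s \<oplus>\<^bsub>T\<^esub> t) \<subseteq> set_add F (fib s) (fib t)"
    proof
      fix x assume "x \<in> fib (s \<oplus>\<^bsub>T\<^esub> t)"
      then have x: "x \<in> carrier F" "h x = s \<oplus>\<^bsub>T\<^esub> t" by (auto simp: fib_def)
      obtain b where b: "b \<in> carrier F" "h b = t" using fib_nonempty assms by blast
      have "x \<ominus> b \<in> fib s"
        using x b assms by (simp add: fib_def h_minus F.minus_closed)
          (simp add: T.minus_eq T.add.m_assoc T.r_neg)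
      moreover have "x = (x \<ominus> b) \<oplus> b"
        using x b by (simp add: F.minus_eq F.add.m_assoc F.l_neg)
      ultimately show "x \<in> set_add F (fib s) (fib t)"
        using b by (auto simp: set_add_def set_mult_def fib_def)
    qed
  qed
  then show ?thesis by (simp add: quot_algebra_def FactRing_def)
qed

lemma fib_mult:
  assumes "s \<in> carrier T" "t \<in> carrier T"
  shows "fib s \<otimes>\<^bsub>quot_algebra F Ker\<^esub> fib t = fib (s \<otimes>\<^bsub>T\<^esub> t)"
proof -
  have "Ker +> (a \<otimes> b) = fib (s \<otimes>\<^bsub>T\<^esub> t)" if "a \<in> fib s" "b \<in> fib t" for a b
    using that coset_eq_fib[of "a \<otimes> b"] by (auto simp: mult_closed h_mult fib_def)
  moreover obtain a b where "a \<in> fib s" "b \<in> fib t"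
    using fib_nonempty assms by (fastforce simp: fib_def)
  ultimately have "rcoset_mult F Ker (fib s) (fib t) = fib (s \<otimes>\<^bsub>T\<^esub> t)"
    unfolding rcoset_mult_def by blast
  then show ?thesis by (simp add: quot_algebra_def FactRing_def)
qed

lemma fib_one: "fib \<one>\<^bsub>T\<^esub> = \<one>\<^bsub>quot_algebra F Ker\<^esub>"
  using coset_eq_fib[OF one_closed] by (simp add: quot_algebra_def FactRing_def h_one)

lemma fib_iso: "fib \<in> ring_iso T (quot_algebra F Ker)"
  using fib_inj by (intro ring_iso_memI) (auto simp: quot_carrier fib_add fib_mult fib_one bij_betw_def)

lemma quot_is_ring: "Ring.ring (quot_algebra F Ker)"
proof -
  have "Ring.ring (quot_algebra F Ker\<lparr>carrier := fib ` carrier T, zero := Ker\<rparr>)"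
    using T.ring_hom_imp_img_ring fib_iso by (auto simp: ring_iso_def)
  then show ?thesis
    by (simp flip: quot_carrier) (simp add: quot_algebra_def FactRing_def)
qed

text \<open>Scalar multiplication on the quotient is a union over representatives; compatibility of
  \<open>h\<close> with scalars makes all members of this union equal.\<close>

lemma fib_smult:
  assumes closed: "\<And>x. x \<in> carrier F \<Longrightarrow> r \<odot> x \<in> carrier F"
    and h_smult: "\<And>x. x \<in> carrier F \<Longrightarrow> h (r \<odot> x) = f (h x)"
    and t: "t \<in> carrier T"
  shows "r \<odot>\<^bsub>quot_algebra F Ker\<^esub> fib t = fib (f t)"
proof -
  have "Ker +> (r \<odot> x) = fib (f t)" if "x \<in> fib t" for x
    using that coset_eq_fib[of "r \<odot> x"] by (auto simp: closed h_smult fib_def)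
  moreover obtain x where "x \<in> fib t"
    using fib_nonempty t by (fastforce simp: fib_def)
  ultimately show ?thesis by (auto simp: quot_algebra_def)
qed

end

section \<open>Morita equivalence with a full corner\<close>

lemma infinite_pairing: "\<exists>f :: 'u::infinite \<times> 'u \<Rightarrow> 'u. inj f"
  using card_of_Times_same_infinite[of "UNIV :: 'u set"] infinite_UNIV
  by (metis UNIV_Times_UNIV card_of_ordLeq ordIso_iff_ordLeq)

text \<open>A homomorphism will be recorded by the list of its values at \<open>n\<close>
  generators, and this injection turns the list into a single element of the target type.\<close>

lemma infinite_lists_of_length:
  "\<exists>f :: 'u::infinite list \<Rightarrow> 'u. inj_on f {xs. length xs = n}"
proof (induction n)
  case 0
  show ?case by (auto simp: inj_on_def)
next
  case (Suc n)
  then obtain f :: "'u list \<Rightarrow> 'u" where f: "inj_on f {xs. length xs = n}" by blast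
  obtain p :: "'u \<times> 'u \<Rightarrow> 'u" where p: "inj p" using infinite_pairing by blast
  have "inj_on (\<lambda>xs. p (hd xs, f (tl xs))) {xs. length xs = Suc n}"
  proof (rule inj_onI)
    fix xs ys :: "'u list"
    assume len: "xs \<in> {xs. length xs = Suc n}" "ys \<in> {xs. length xs = Suc n}"
      and eq: "p (hd xs, f (tl xs)) = p (hd ys, f (tl ys))"
    from eq have "hd xs = hd ys" "f (tl xs) = f (tl ys)"
      using p by (auto dest: injD)
    moreover from this have "tl xs = tl ys"
      using inj_onD[OF f, of "tl xs" "tl ys"] len by simp
    ultimately show "xs = ys"
      using len by (intro list.expand) auto
  qed
  then show ?case by blast
qed

section \<open>Left modules and transport of structure\<close>

context left_module
begin

lemma lsmult_zero: "a \<in> carrier A \<Longrightarrow> a \<odot>\<^bsub>M\<^esub> \<zero>\<^bsub>M\<^esub> = \<zero>\<^bsub>M\<^esub>"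
  using lsmult_r_distr[of a "\<zero>\<^bsub>M\<^esub>" "\<zero>\<^bsub>M\<^esub>"] lsmult_closed[of a "\<zero>\<^bsub>M\<^esub>"] M.add.l_cancel_one
  by simp

lemma zero_lsmult: "x \<in> carrier M \<Longrightarrow> \<zero> \<odot>\<^bsub>M\<^esub> x = \<zero>\<^bsub>M\<^esub>"
  using lsmult_l_distr[of \<zero> \<zero> x] lsmult_closed[of \<zero> x] M.add.l_cancel_one
  by simp

lemma lsmult_a_inv:
  assumes "a \<in> carrier A" "x \<in> carrier M"
  shows "a \<odot>\<^bsub>M\<^esub> (\<ominus>\<^bsub>M\<^esub> x) = \<ominus>\<^bsub>M\<^esub> (a \<odot>\<^bsub>M\<^esub> x)"
proof -
  have "a \<odot>\<^bsub>M\<^esub> (\<ominus>\<^bsub>M\<^esub> x) \<oplus>\<^bsub>M\<^esub> a \<odot>\<^bsub>M\<^esub> x = \<zero>\<^bsub>M\<^esub>"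
    using assms lsmult_r_distr[of a "\<ominus>\<^bsub>M\<^esub> x" x] lsmult_zero by (simp add: M.l_neg)
  then show ?thesis
    using assms lsmult_closed by (simp add: M.minus_equality)
qed

end

definition transported :: "('m \<Rightarrow> 'n) \<Rightarrow> ('a, 'm) module \<Rightarrow> ('a, 'n) module" where
  "transported f M = (let g = inv_into (carrier M) f in
    \<lparr>carrier = f ` carrier M, mult = undefined, one = undefined, zero = f \<zero>\<^bsub>M\<^esub>,
     add = (\<lambda>x y. f (g x \<oplus>\<^bsub>M\<^esub> g y)), smult = (\<lambda>a x. f (a \<odot>\<^bsub>M\<^esub> g x))\<rparr>)"

lemma left_module_transported:
  assumes "left_module A M" and f: "inj_on f (carrier M)"
  shows "left_module A (transported f M)"
proof -
  interpret left_module A M by fact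
  note [simp] = inv_into_f_f[OF f]
  show ?thesis
  proof (intro left_module.intro left_module_axioms.intro A.ring_axioms abelian_groupI)
    fix x assume "x \<in> carrier (transported f M)"
    then obtain z where "z \<in> carrier M" "x = f z" by (auto simp: transported_def Let_def)
    then have "f (\<ominus>\<^bsub>M\<^esub> z) \<in> carrier (transported f M)
        \<and> f (\<ominus>\<^bsub>M\<^esub> z) \<oplus>\<^bsub>transported f M\<^esub> x = \<zero>\<^bsub>transported f M\<^esub>"
      by (auto simp: transported_def Let_def M.l_neg)
    then show "\<exists>y\<in>carrier (transported f M). y \<oplus>\<^bsub>transported f M\<^esub> x = \<zero>\<^bsub>transported f M\<^esub>"
      by blast
  qed (auto simp: transported_def Let_def lsmult_closed lsmult_l_distr lsmult_r_distr lsmult_assoc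
      lsmult_one M.a_ac)
qed

text \<open>B is identified with the corner e A e, where e = emb 1. Fullness A e A = A is given by
  witnesses: c_i in A e and d_i in e A with sum c_i d_i = 1. For x in e A this yields x = sum (x
  c_i) d_i with all x c_i in e A e. So the d_i generate e A as a left B-module, and the bijectivity
  arguments below compute with this expansion.\<close>

locale full_corner = A: Ring.ring A + B: Ring.ring B
  for A :: "('a, 'k) ring_scheme" (structure) and B :: "('b, 'l) ring_scheme"
  and emb :: "'b \<Rightarrow> 'a" and n :: nat and c d :: "nat \<Rightarrow> 'a" +
  assumes emb_closed: "x \<in> carrier B \<Longrightarrow> emb x \<in> carrier A"
    and emb_add: "\<lbrakk>x \<in> carrier B; y \<in> carrier B\<rbrakk> \<Longrightarrow> emb (x \<oplus>\<^bsub>B\<^esub> y) = emb x \<oplus> emb y"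
    and emb_mult: "\<lbrakk>x \<in> carrier B; y \<in> carrier B\<rbrakk> \<Longrightarrow> emb (x \<otimes>\<^bsub>B\<^esub> y) = emb x \<otimes> emb y"
    and emb_inj: "inj_on emb (carrier B)"
    and emb_image: "emb ` carrier B = (\<lambda>x. emb \<one>\<^bsub>B\<^esub> \<otimes> x \<otimes> emb \<one>\<^bsub>B\<^esub>) ` carrier A"
    and c_closed: "i < n \<Longrightarrow> c i \<in> carrier A" and c_idem: "i < n \<Longrightarrow> c i \<otimes> emb \<one>\<^bsub>B\<^esub> = c i"
    and d_closed: "i < n \<Longrightarrow> d i \<in> carrier A" and d_idem: "i < n \<Longrightarrow> emb \<one>\<^bsub>B\<^esub> \<otimes> d i = d i"
    and full: "(\<Oplus>i\<in>{..<n}. c i \<otimes> d i) = \<one>"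
begin

abbreviation e :: 'a where "e \<equiv> emb \<one>\<^bsub>B\<^esub>"

definition eA :: "'a set" where "eA = {x \<in> carrier A. e \<otimes> x = x}"

lemma e_closed: "e \<in> carrier A"
  by (simp add: emb_closed)

lemma e_idem: "e \<otimes> e = e"
  using emb_mult[of "\<one>\<^bsub>B\<^esub>" "\<one>\<^bsub>B\<^esub>"] by simp

lemma e_emb: "b \<in> carrier B \<Longrightarrow> e \<otimes> emb b = emb b" "b \<in> carrier B \<Longrightarrow> emb b \<otimes> e = emb b"
  using emb_mult[of "\<one>\<^bsub>B\<^esub>" b] emb_mult[of b "\<one>\<^bsub>B\<^esub>"] by simp_all

lemma eA_closed: "x \<in> eA \<Longrightarrow> x \<in> carrier A"
  by (simp add: eA_def)

lemma e_in: "e \<in> eA"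
  by (simp add: eA_def e_closed e_idem)

lemma d_in: "i < n \<Longrightarrow> d i \<in> eA"
  by (simp add: eA_def d_closed d_idem)

lemma eA_add: "\<lbrakk>x \<in> eA; y \<in> eA\<rbrakk> \<Longrightarrow> x \<oplus> y \<in> eA"
  by (simp add: eA_def e_closed A.r_distr)

lemma eA_mult: "\<lbrakk>x \<in> eA; a \<in> carrier A\<rbrakk> \<Longrightarrow> x \<otimes> a \<in> eA"
  by (simp add: eA_def e_closed flip: A.m_assoc)

lemma emb_eA: "\<lbrakk>b \<in> carrier B; x \<in> eA\<rbrakk> \<Longrightarrow> emb b \<otimes> x \<in> eA"
  by (simp add: eA_def e_closed emb_closed e_emb flip: A.m_assoc)

lemma emb_ex:
  assumes "x \<in> eA" "x \<otimes> e = x" shows "\<exists>b\<in>carrier B. x = emb b"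
proof -
  have "x = e \<otimes> x \<otimes> e" using assms by (simp add: eA_def)
  then have "x \<in> emb ` carrier B" using assms
    unfolding emb_image by (intro image_eqI[of _ _ x]) (auto simp: eA_def)
  then show ?thesis by blast
qed

lemma emb_ex_c: "\<lbrakk>x \<in> eA; i < n\<rbrakk> \<Longrightarrow> \<exists>b\<in>carrier B. x \<otimes> c i = emb b"
  by (rule emb_ex) (simp_all add: eA_mult c_closed c_idem A.m_assoc eA_closed e_closed)

text \<open>Partial sums turn the expansion x = x (sum c_i d_i) into an induction on the number of
  summands, in which additivity of a map is only used for two terms.\<close>

definition psum :: "nat \<Rightarrow> 'a" where "psum k = (\<Oplus>i\<in>{..<k}. c i \<otimes> d i)"

lemma psum_0: "psum 0 = \<zero>"
  by (simp add: psum_def)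

lemma psum_closed: "k \<le> n \<Longrightarrow> psum k \<in> carrier A"
  by (auto simp: psum_def c_closed d_closed)

lemma psum_Suc: "k < n \<Longrightarrow> psum (Suc k) = c k \<otimes> d k \<oplus> psum k"
  unfolding psum_def lessThan_Suc by (subst A.finsum_insert) (auto simp: c_closed d_closed)

lemma psum_n: "psum n = \<one>"
  by (simp add: psum_def full)

text \<open>The functors are \<open>M \<mapsto> eM\<close> and \<open>N \<mapsto> Hom\<^sub>B(eA, N)\<close>. A homomorphism on \<open>eA\<close> is determined by its
  values at \<open>d 0, \<dots>, d (n - 1)\<close>, so that these modules of functions can be moved into the type
  of \<open>N\<close> if that is infinite.\<close>

definition corner_module :: "('a, 'u) module \<Rightarrow> ('b, 'u) module" where
  "corner_module M = \<lparr>carrier = {x \<in> carrier M. e \<odot>\<^bsub>M\<^esub> x = x}, mult = undefined, one = undefined,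
     zero = \<zero>\<^bsub>M\<^esub>, add = add M, smult = (\<lambda>b. smult M (emb b))\<rparr>"

lemma corner_carrier: "x \<in> carrier (corner_module M) \<longleftrightarrow> x \<in> carrier M \<and> e \<odot>\<^bsub>M\<^esub> x = x"
  by (simp add: corner_module_def)

lemma left_module_corner:
  assumes "left_module A M" shows "left_module B (corner_module M)"
proof -
  interpret left_module A M by fact
  have emb_e: "e \<odot>\<^bsub>M\<^esub> (emb b \<odot>\<^bsub>M\<^esub> x) = emb b \<odot>\<^bsub>M\<^esub> x"
    if "b \<in> carrier B" "x \<in> carrier M" for b x
    using that by (simp add: emb_closed e_emb flip: lsmult_assoc)
  show ?thesis
  proof (intro left_module.intro left_module_axioms.intro B.ring_axioms abelian_groupI)
    fix x assume "x \<in> carrier (corner_module M)"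
    then have "\<ominus>\<^bsub>M\<^esub> x \<in> carrier (corner_module M) \<and> \<ominus>\<^bsub>M\<^esub> x \<oplus>\<^bsub>corner_module M\<^esub> x = \<zero>\<^bsub>corner_module M\<^esub>"
      by (auto simp: corner_module_def lsmult_a_inv e_closed M.l_neg)
    then show "\<exists>y\<in>carrier (corner_module M). y \<oplus>\<^bsub>corner_module M\<^esub> x = \<zero>\<^bsub>corner_module M\<^esub>"
      by blast
  qed (auto simp: corner_module_def lsmult_closed lsmult_l_distr lsmult_r_distr lsmult_assoc lsmult_zero
      e_closed emb_closed emb_add emb_mult emb_e M.a_ac)
qed

section \<open>The B-linear maps from e A to N, and their copies inside the type of N\<close>

definition homs :: "('b, 'u) module \<Rightarrow> ('a \<Rightarrow> 'u) set" where
  "homs N = {\<phi> \<in> eA \<rightarrow>\<^sub>E carrier N.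
     (\<forall>x\<in>eA. \<forall>y\<in>eA. \<phi> (x \<oplus> y) = \<phi> x \<oplus>\<^bsub>N\<^esub> \<phi> y) \<and>
     (\<forall>b\<in>carrier B. \<forall>x\<in>eA. \<phi> (emb b \<otimes> x) = b \<odot>\<^bsub>N\<^esub> \<phi> x)}"

lemma homsD:
  assumes "\<phi> \<in> homs N"
  shows "x \<in> eA \<Longrightarrow> \<phi> x \<in> carrier N"
    and "\<lbrakk>x \<in> eA; y \<in> eA\<rbrakk> \<Longrightarrow> \<phi> (x \<oplus> y) = \<phi> x \<oplus>\<^bsub>N\<^esub> \<phi> y"
    and "\<lbrakk>b \<in> carrier B; x \<in> eA\<rbrakk> \<Longrightarrow> \<phi> (emb b \<otimes> x) = b \<odot>\<^bsub>N\<^esub> \<phi> x"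
    and "\<phi> \<in> extensional eA"
  using assms by (auto simp: homs_def PiE_iff)

lemma homsI:
  assumes "\<And>x. x \<in> eA \<Longrightarrow> \<phi> x \<in> carrier N"
    and "\<And>x y. \<lbrakk>x \<in> eA; y \<in> eA\<rbrakk> \<Longrightarrow> \<phi> (x \<oplus> y) = \<phi> x \<oplus>\<^bsub>N\<^esub> \<phi> y"
    and "\<And>b x. \<lbrakk>b \<in> carrier B; x \<in> eA\<rbrakk> \<Longrightarrow> \<phi> (emb b \<otimes> x) = b \<odot>\<^bsub>N\<^esub> \<phi> x"
  shows "restrict \<phi> eA \<in> homs N"
  using assms by (auto simp: homs_def eA_add emb_eA)

text \<open>Right translation of the argument is a left action: (a b) phi and a (b phi) both send x
  to phi(x a b).\<close>

definition hom_module :: "('b, 'u) module \<Rightarrow> ('a, 'a \<Rightarrow> 'u) module" where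
  "hom_module N = \<lparr>carrier = homs N, mult = undefined, one = undefined,
     zero = (\<lambda>x\<in>eA. \<zero>\<^bsub>N\<^esub>), add = (\<lambda>\<phi> \<psi>. \<lambda>x\<in>eA. \<phi> x \<oplus>\<^bsub>N\<^esub> \<psi> x),
     smult = (\<lambda>a \<phi>. \<lambda>x\<in>eA. \<phi> (x \<otimes> a))\<rparr>"

lemma homs_ext: "\<lbrakk>\<phi> \<in> homs N; \<psi> \<in> homs N; \<And>x. x \<in> eA \<Longrightarrow> \<phi> x = \<psi> x\<rbrakk> \<Longrightarrow> \<phi> = \<psi>"
  using homsD(4) extensionalityI by metis

lemma left_module_hom:
  assumes "left_module B N" shows "left_module A (hom_module N)"
proof -
  interpret N: left_module B N by fact
  have add: "(\<lambda>x\<in>eA. \<phi> x \<oplus>\<^bsub>N\<^esub> \<psi> x) \<in> homs N" if "\<phi> \<in> homs N" "\<psi> \<in> homs N" for \<phi> \<psi>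
    using that homsD[OF that(1)] homsD[OF that(2)]
    by (intro homsI) (auto simp: N.M.a_ac N.lsmult_r_distr)
  have smult: "(\<lambda>x\<in>eA. \<phi> (x \<otimes> a)) \<in> homs N" if "\<phi> \<in> homs N" "a \<in> carrier A" for \<phi> a
    using that homsD[OF that(1)]
    by (intro homsI) (auto simp: eA_mult A.l_distr A.m_assoc eA_closed emb_closed)
  have zero: "(\<lambda>x\<in>eA. \<zero>\<^bsub>N\<^esub>) \<in> homs N"
    by (intro homsI) (auto simp: N.lsmult_zero)
  show ?thesis
  proof (intro left_module.intro left_module_axioms.intro A.ring_axioms abelian_groupI)
    fix \<phi> assume \<phi>: "\<phi> \<in> carrier (hom_module N)"
    define \<psi> where "\<psi> = (\<lambda>x\<in>eA. \<ominus>\<^bsub>N\<^esub> \<phi> x)"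
    have "\<psi> \<in> homs N"
      unfolding \<psi>_def using \<phi> homsD[of \<phi> N]
      by (intro homsI) (auto simp: hom_module_def N.M.minus_add N.M.a_comm N.lsmult_a_inv)
    moreover have "\<psi> \<oplus>\<^bsub>hom_module N\<^esub> \<phi> = \<zero>\<^bsub>hom_module N\<^esub>"
      using \<phi> homsD(1)[of \<phi> N] by (auto simp: hom_module_def \<psi>_def N.M.l_neg intro!: restrict_ext)
    ultimately show "\<exists>\<psi>\<in>carrier (hom_module N). \<psi> \<oplus>\<^bsub>hom_module N\<^esub> \<phi> = \<zero>\<^bsub>hom_module N\<^esub>"
      by (auto simp: hom_module_def)
  next
    fix \<phi> \<psi> \<omega> assume *: "\<phi> \<in> carrier (hom_module N)" "\<psi> \<in> carrier (hom_module N)"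
      "\<omega> \<in> carrier (hom_module N)"
    then show "\<phi> \<oplus>\<^bsub>hom_module N\<^esub> \<psi> \<oplus>\<^bsub>hom_module N\<^esub> \<omega> = \<phi> \<oplus>\<^bsub>hom_module N\<^esub> (\<psi> \<oplus>\<^bsub>hom_module N\<^esub> \<omega>)"
      by (auto simp: hom_module_def homsD N.M.a_assoc intro!: restrict_ext)
  next
    fix \<phi> \<psi> assume *: "\<phi> \<in> carrier (hom_module N)" "\<psi> \<in> carrier (hom_module N)"
    then show "\<phi> \<oplus>\<^bsub>hom_module N\<^esub> \<psi> = \<psi> \<oplus>\<^bsub>hom_module N\<^esub> \<phi>"
      by (auto simp: hom_module_def homsD N.M.a_comm intro!: restrict_ext)
  next
    fix \<phi> assume *: "\<phi> \<in> carrier (hom_module N)"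
    then have \<phi>: "\<phi> \<in> homs N" by (simp add: hom_module_def)
    show "\<zero>\<^bsub>hom_module N\<^esub> \<oplus>\<^bsub>hom_module N\<^esub> \<phi> = \<phi>"
      using add[OF zero \<phi>] \<phi>
      by (intro homs_ext[where N = N]) (auto simp: hom_module_def homsD)
    show "\<one> \<odot>\<^bsub>hom_module N\<^esub> \<phi> = \<phi>"
      using smult[OF \<phi> A.one_closed] \<phi>
      by (intro homs_ext[where N = N]) (auto simp: hom_module_def eA_closed)
  next
    fix a b \<phi> assume *: "a \<in> carrier A" "b \<in> carrier A" "\<phi> \<in> carrier (hom_module N)"
    then show "(a \<oplus> b) \<odot>\<^bsub>hom_module N\<^esub> \<phi> = a \<odot>\<^bsub>hom_module N\<^esub> \<phi> \<oplus>\<^bsub>hom_module N\<^esub> b \<odot>\<^bsub>hom_module N\<^esub> \<phi>"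
      and "(a \<otimes> b) \<odot>\<^bsub>hom_module N\<^esub> \<phi> = a \<odot>\<^bsub>hom_module N\<^esub> (b \<odot>\<^bsub>hom_module N\<^esub> \<phi>)"
      by (auto simp: hom_module_def homsD A.r_distr eA_mult eA_closed A.m_assoc intro!: restrict_ext)
  next
    fix a \<phi> \<psi> assume *: "a \<in> carrier A" "\<phi> \<in> carrier (hom_module N)" "\<psi> \<in> carrier (hom_module N)"
    then show "a \<odot>\<^bsub>hom_module N\<^esub> (\<phi> \<oplus>\<^bsub>hom_module N\<^esub> \<psi>) =
        a \<odot>\<^bsub>hom_module N\<^esub> \<phi> \<oplus>\<^bsub>hom_module N\<^esub> a \<odot>\<^bsub>hom_module N\<^esub> \<psi>"
      by (auto simp: hom_module_def eA_mult intro!: restrict_ext)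
  qed (simp_all add: hom_module_def add smult zero)
qed

text \<open>Expand x as sum (x c_i) d_i and read x c_i as an element of B; linearity gives phi x =
  sum (x c_i) phi(d_i).\<close>

lemma homs_determined:
  assumes N: "left_module B N" and \<phi>: "\<phi> \<in> homs N" and \<psi>: "\<psi> \<in> homs N"
    and eq: "\<And>i. i < n \<Longrightarrow> \<phi> (d i) = \<psi> (d i)"
  shows "\<phi> = \<psi>"
proof (rule homs_ext[OF \<phi> \<psi>])
  fix x assume x: "x \<in> eA"
  interpret N: left_module B N by fact
  have "\<phi> (x \<otimes> psum k) = \<psi> (x \<otimes> psum k)" if "k \<le> n" for k
    using that
  proof (induction k)
    case 0
    have "emb \<zero>\<^bsub>B\<^esub> \<oplus> emb \<zero>\<^bsub>B\<^esub> = emb \<zero>\<^bsub>B\<^esub>" using emb_add[of "\<zero>\<^bsub>B\<^esub>" "\<zero>\<^bsub>B\<^esub>"] by simp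
    then have "emb \<zero>\<^bsub>B\<^esub> = \<zero>" using emb_closed[of "\<zero>\<^bsub>B\<^esub>"] A.add.l_cancel_one by simp
    then have "x \<otimes> psum 0 = emb \<zero>\<^bsub>B\<^esub> \<otimes> x" using x by (simp add: psum_0 eA_closed)
    then show ?case
      using x homsD[OF \<phi>] homsD[OF \<psi>] by (simp add: N.zero_lsmult)
  next
    case (Suc k)
    obtain b where b: "b \<in> carrier B" "x \<otimes> c k = emb b" using emb_ex_c[of x k] x Suc by auto
    have "x \<otimes> psum (Suc k) = emb b \<otimes> d k \<oplus> x \<otimes> psum k"
      using Suc x b(2)[symmetric]
      by (simp add: psum_Suc A.r_distr psum_closed c_closed d_closed eA_closed A.m_assoc)
    moreover have "x \<otimes> psum k \<in> eA" "emb b \<otimes> d k \<in> eA"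
      using Suc x b by (simp_all add: eA_mult psum_closed emb_eA d_in)
    ultimately show ?case
      using Suc homsD[OF \<phi>] homsD[OF \<psi>] b eq d_in by simp
  qed
  from this[of n] show "\<phi> x = \<psi> x" using x by (simp add: psum_n eA_closed)
qed

text \<open>One injection is fixed for each N, so that the coinduced module is a function of N
  alone.\<close>

definition code :: "('b, 'u::infinite) module \<Rightarrow> ('a \<Rightarrow> 'u) \<Rightarrow> 'u" where
  "code N = (SOME f. inj_on f (homs N))"

text \<open>The witness lists the values at d_0, ..., d_(n-1) and codes this list by one
  element.\<close>

lemma code_inj:
  assumes "left_module B (N :: ('b, 'u::infinite) module)"
  shows "inj_on (code N) (homs N)"
proof -
  obtain f :: "'u list \<Rightarrow> 'u" where f: "inj_on f {xs. length xs = n}"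
    using infinite_lists_of_length by blast
  have "inj_on (\<lambda>\<phi>. f (map (\<lambda>i. \<phi> (d i)) [0..<n])) (homs N)"
  proof (rule inj_onI)
    fix \<phi> \<psi> assume *: "\<phi> \<in> homs N" "\<psi> \<in> homs N"
      "f (map (\<lambda>i. \<phi> (d i)) [0..<n]) = f (map (\<lambda>i. \<psi> (d i)) [0..<n])"
    then have "map (\<lambda>i. \<phi> (d i)) [0..<n] = map (\<lambda>i. \<psi> (d i)) [0..<n]"
      by (intro inj_onD[OF f]) simp_all
    then have "\<phi> (d i) = \<psi> (d i)" if "i < n" for i
      using that by simp
    then show "\<phi> = \<psi>" by (rule homs_determined[OF assms *(1,2)])
  qed
  then show ?thesis unfolding code_def by (rule someI[where P = "\<lambda>f. inj_on f (homs N)"])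
qed

definition decode :: "('b, 'u::infinite) module \<Rightarrow> 'u \<Rightarrow> ('a \<Rightarrow> 'u)" where
  "decode N = inv_into (homs N) (code N)"

definition coind :: "('b, 'u::infinite) module \<Rightarrow> ('a, 'u) module" where
  "coind N = transported (code N) (hom_module N)"

lemma left_module_coind: "left_module B N \<Longrightarrow> left_module A (coind N)"
  unfolding coind_def
  by (intro left_module_transported left_module_hom) (simp_all add: hom_module_def code_inj)

lemma coind_carrier: "carrier (coind N) = code N ` homs N"
  by (simp add: coind_def transported_def hom_module_def Let_def)

lemma decode_code: "\<lbrakk>left_module B N; \<phi> \<in> homs N\<rbrakk> \<Longrightarrow> decode N (code N \<phi>) = \<phi>"
  by (simp add: decode_def code_inj)

lemma decode_in: "x \<in> carrier (coind N) \<Longrightarrow> decode N x \<in> homs N"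
  by (simp add: coind_carrier decode_def inv_into_into)

lemma decode_closed: "\<lbrakk>x \<in> carrier (coind N); z \<in> eA\<rbrakk> \<Longrightarrow> decode N x z \<in> carrier N"
  by (rule homsD(1)[OF decode_in])

lemma code_decode: "x \<in> carrier (coind N) \<Longrightarrow> code N (decode N x) = x"
  by (simp add: coind_carrier decode_def f_inv_into_f)

lemma decode_add:
  assumes N: "left_module B N" and "x \<in> carrier (coind N)" "y \<in> carrier (coind N)" "z \<in> eA"
  shows "decode N (x \<oplus>\<^bsub>coind N\<^esub> y) z = decode N x z \<oplus>\<^bsub>N\<^esub> decode N y z"
proof -
  interpret H: left_module A "hom_module N" by (rule left_module_hom[OF N])
  have "decode N x \<oplus>\<^bsub>hom_module N\<^esub> decode N y \<in> homs N"
    using H.M.a_closed[of "decode N x" "decode N y"] decode_in[OF assms(2)] decode_in[OF assms(3)] by (simp add: hom_module_def)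
  then have "decode N (x \<oplus>\<^bsub>coind N\<^esub> y) = decode N x \<oplus>\<^bsub>hom_module N\<^esub> decode N y"
    using decode_code[OF N] by (simp add: coind_def transported_def Let_def decode_def hom_module_def)
  then show ?thesis using assms by (simp add: hom_module_def)
qed

lemma decode_smult:
  assumes N: "left_module B N" and "a \<in> carrier A" "x \<in> carrier (coind N)" "z \<in> eA"
  shows "decode N (a \<odot>\<^bsub>coind N\<^esub> x) z = decode N x (z \<otimes> a)"
proof -
  interpret H: left_module A "hom_module N" by (rule left_module_hom[OF N])
  have "a \<odot>\<^bsub>hom_module N\<^esub> decode N x \<in> homs N"
    using H.lsmult_closed[of a "decode N x"] decode_in[OF assms(3)] assms(2) by (simp add: hom_module_def)
  then have "decode N (a \<odot>\<^bsub>coind N\<^esub> x) = a \<odot>\<^bsub>hom_module N\<^esub> decode N x"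
    using decode_code[OF N] by (simp add: coind_def transported_def Let_def decode_def hom_module_def)
  then show ?thesis using assms by (simp add: hom_module_def)
qed

lemma coind_eqI:
  assumes "x \<in> carrier (coind N)" "y \<in> carrier (coind N)" "\<And>z. z \<in> eA \<Longrightarrow> decode N x z = decode N y z"
  shows "x = y"
  using homs_ext[OF decode_in[OF assms(1)] decode_in[OF assms(2)] assms(3)] code_decode assms(1,2) by metis

text \<open>m = sum c_i (d_i m), and every d_i lies in e A.\<close>

lemma lsmult_determined:
  assumes M: "left_module A M" and m: "m \<in> carrier M" "m' \<in> carrier M"
    and eq: "\<And>x. x \<in> eA \<Longrightarrow> x \<odot>\<^bsub>M\<^esub> m = x \<odot>\<^bsub>M\<^esub> m'"
  shows "m = m'"
proof -
  interpret left_module A M by fact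
  have "psum k \<odot>\<^bsub>M\<^esub> m = psum k \<odot>\<^bsub>M\<^esub> m'" if "k \<le> n" for k
    using that
  proof (induction k)
    case 0
    then show ?case using m by (simp add: psum_0 zero_lsmult)
  next
    case (Suc k)
    then show ?case
      using m eq[of "d k"]
      by (simp add: psum_Suc lsmult_l_distr psum_closed c_closed d_closed lsmult_assoc d_in)
  qed
  from this[of n] show ?thesis using m by (simp add: psum_n lsmult_one)
qed

text \<open>The element is m = sum c_i phi(d_i): for x in e A, linearity over B gives x m = sum (x
  c_i) phi(d_i) = phi(sum x c_i d_i) = phi x. The induction builds m one summand at a time.\<close>

lemma homs_corner:
  assumes M: "left_module A M" and \<phi>: "\<phi> \<in> homs (corner_module M)"
  shows "\<exists>m\<in>carrier M. \<forall>x\<in>eA. \<phi> x = x \<odot>\<^bsub>M\<^esub> m"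
proof -
  interpret left_module A M by fact
  interpret N: left_module B "corner_module M" by (rule left_module_corner[OF M])
  have \<phi>M: "\<phi> x \<in> carrier M" if "x \<in> eA" for x
    using homsD(1)[OF \<phi> that] by (simp add: corner_module_def)
  have "\<exists>m\<in>carrier M. \<forall>x\<in>eA. \<phi> (x \<otimes> psum k) = x \<odot>\<^bsub>M\<^esub> m" if "k \<le> n" for k
    using that
  proof (induction k)
    case 0
    have zero: "\<zero> \<in> eA" by (simp add: eA_def e_closed)
    have "\<phi> \<zero> \<oplus>\<^bsub>M\<^esub> \<phi> \<zero> = \<phi> \<zero>"
      using homsD(2)[OF \<phi> zero zero] by (simp add: corner_module_def)
    then have "\<phi> \<zero> = \<zero>\<^bsub>M\<^esub>" using \<phi>M[OF zero] M.add.l_cancel_one by simp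
    then show ?case
      by (intro bexI[of _ "\<zero>\<^bsub>M\<^esub>"]) (simp_all add: psum_0 eA_closed lsmult_zero)
  next
    case (Suc k)
    then obtain m where m: "m \<in> carrier M" "\<And>x. x \<in> eA \<Longrightarrow> \<phi> (x \<otimes> psum k) = x \<odot>\<^bsub>M\<^esub> m"
      by auto
    have "\<phi> (x \<otimes> psum (Suc k)) = x \<odot>\<^bsub>M\<^esub> (c k \<odot>\<^bsub>M\<^esub> \<phi> (d k) \<oplus>\<^bsub>M\<^esub> m)" if x: "x \<in> eA" for x
    proof -
      obtain b where b: "b \<in> carrier B" "x \<otimes> c k = emb b" using emb_ex_c[of x k] x Suc by auto
      have "x \<otimes> psum (Suc k) = emb b \<otimes> d k \<oplus> x \<otimes> psum k"
        using Suc x b(2)[symmetric]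
        by (simp add: psum_Suc A.r_distr psum_closed c_closed d_closed eA_closed A.m_assoc)
      moreover have "x \<otimes> psum k \<in> eA" "emb b \<otimes> d k \<in> eA" "d k \<in> eA"
        using Suc x b by (simp_all add: eA_mult psum_closed emb_eA d_in)
      ultimately have "\<phi> (x \<otimes> psum (Suc k)) = emb b \<odot>\<^bsub>M\<^esub> \<phi> (d k) \<oplus>\<^bsub>M\<^esub> \<phi> (x \<otimes> psum k)"
        using homsD(2,3)[OF \<phi>] b by (simp add: corner_module_def)
      also have "\<dots> = x \<odot>\<^bsub>M\<^esub> (c k \<odot>\<^bsub>M\<^esub> \<phi> (d k) \<oplus>\<^bsub>M\<^esub> m)"
        using m x Suc \<phi>M[OF d_in, of k] b(2)[symmetric]
        by (simp add: lsmult_r_distr lsmult_assoc c_closed eA_closed lsmult_closed)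
      finally show ?thesis .
    qed
    then show ?case
      using m Suc \<phi>M[OF d_in, of k]
      by (intro bexI[of _ "c k \<odot>\<^bsub>M\<^esub> \<phi> (d k) \<oplus>\<^bsub>M\<^esub> m"]) (simp_all add: c_closed lsmult_closed)
  qed
  from this[of n] show ?thesis by (auto simp: psum_n eA_closed)
qed

lemma lsmult_homs:
  assumes M: "left_module A M" and m: "m \<in> carrier M"
  shows "(\<lambda>x\<in>eA. x \<odot>\<^bsub>M\<^esub> m) \<in> homs (corner_module M)"
proof -
  interpret left_module A M by fact
  have "e \<odot>\<^bsub>M\<^esub> (x \<odot>\<^bsub>M\<^esub> m) = x \<odot>\<^bsub>M\<^esub> m" if "x \<in> eA" for x
    using that m e_closed by (simp add: eA_def flip: lsmult_assoc)
  then show ?thesis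
    using m by (intro homsI)
      (simp_all add: corner_module_def eA_closed lsmult_closed lsmult_l_distr lsmult_assoc emb_closed)
qed

text \<open>The inverse of the usual unit, which sends m in M to the map x -> x m from e A to e M;
  \<open>natural_iso_to_id\<close> asks for isomorphisms pointing towards the identity. Existence of
  m is \<open>homs_corner\<close>, uniqueness \<open>lsmult_determined\<close>.\<close>

definition unit_map :: "('a, 'u::infinite) module \<Rightarrow> 'u \<Rightarrow> 'u" where
  "unit_map M = (\<lambda>x\<in>carrier (coind (corner_module M)).
     THE m. m \<in> carrier M \<and> (\<forall>z\<in>eA. decode (corner_module M) x z = z \<odot>\<^bsub>M\<^esub> m))"

lemma unit_map:
  assumes M: "left_module A M" and x: "x \<in> carrier (coind (corner_module M))"
  shows "unit_map M x \<in> carrier M"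
    and "z \<in> eA \<Longrightarrow> decode (corner_module M) x z = z \<odot>\<^bsub>M\<^esub> unit_map M x"
proof -
  define P where "P m \<longleftrightarrow> m \<in> carrier M \<and> (\<forall>z\<in>eA. decode (corner_module M) x z = z \<odot>\<^bsub>M\<^esub> m)" for m
  have "\<exists>!m. P m"
    using homs_corner[OF M decode_in[OF x]] lsmult_determined[OF M] unfolding P_def by metis
  then have "P (THE m. P m)" by (rule theI')
  moreover have "unit_map M x = (THE m. P m)"
    using x by (simp add: unit_map_def P_def)
  ultimately have "P (unit_map M x)" by simp
  then show "unit_map M x \<in> carrier M"
    and "z \<in> eA \<Longrightarrow> decode (corner_module M) x z = z \<odot>\<^bsub>M\<^esub> unit_map M x"
    by (auto simp: P_def)
qed

lemma unit_map_eqI: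
  assumes "left_module A M" "x \<in> carrier (coind (corner_module M))" "m \<in> carrier M"
    and "\<And>z. z \<in> eA \<Longrightarrow> decode (corner_module M) x z = z \<odot>\<^bsub>M\<^esub> m"
  shows "unit_map M x = m"
  using lsmult_determined[OF assms(1) unit_map(1)[OF assms(1,2)] assms(3)] unit_map(2)[OF assms(1,2)] assms(4)
  by simp

lemma unit_map_hom:
  assumes M: "left_module A M"
  shows "unit_map M \<in> lmod_hom A (coind (corner_module M)) M"
proof -
  interpret left_module A M by fact
  let ?N = "corner_module M"
  have N: "left_module B ?N" by (rule left_module_corner[OF M])
  interpret C: left_module A "coind ?N" by (rule left_module_coind[OF N])
  have "unit_map M (x \<oplus>\<^bsub>coind ?N\<^esub> y) = unit_map M x \<oplus>\<^bsub>M\<^esub> unit_map M y"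
    if "x \<in> carrier (coind ?N)" "y \<in> carrier (coind ?N)" for x y
  proof (rule unit_map_eqI[OF M])
    fix z assume z: "z \<in> eA"
    show "decode ?N (x \<oplus>\<^bsub>coind ?N\<^esub> y) z = z \<odot>\<^bsub>M\<^esub> (unit_map M x \<oplus>\<^bsub>M\<^esub> unit_map M y)"
      using that z unit_map[OF M that(1)] unit_map[OF M that(2)] decode_add[OF N that z]
      by (simp add: lsmult_r_distr eA_closed) (simp add: corner_module_def)
  qed (use that unit_map(1)[OF M] in auto)
  moreover have "unit_map M (a \<odot>\<^bsub>coind ?N\<^esub> x) = a \<odot>\<^bsub>M\<^esub> unit_map M x"
    if "a \<in> carrier A" "x \<in> carrier (coind ?N)" for a x
  proof (rule unit_map_eqI[OF M])
    fix z assume z: "z \<in> eA"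
    show "decode ?N (a \<odot>\<^bsub>coind ?N\<^esub> x) z = z \<odot>\<^bsub>M\<^esub> (a \<odot>\<^bsub>M\<^esub> unit_map M x)"
      using that z unit_map[OF M that(2)] decode_smult[OF N that z]
      by (simp add: eA_closed eA_mult lsmult_assoc)
  qed (use that unit_map(1)[OF M] lsmult_closed C.lsmult_closed in auto)
  ultimately show ?thesis
    using unit_map(1)[OF M] by (auto simp: lmod_hom_def unit_map_def)
qed

lemma unit_map_bij:
  assumes M: "left_module A M"
  shows "bij_betw (unit_map M) (carrier (coind (corner_module M))) (carrier M)"
proof (rule bij_betwI')
  let ?N = "corner_module M"
  have N: "left_module B ?N" by (rule left_module_corner[OF M])
  fix x y assume xy: "x \<in> carrier (coind ?N)" "y \<in> carrier (coind ?N)"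
  show "unit_map M x = unit_map M y \<longleftrightarrow> x = y"
    using coind_eqI[OF xy] unit_map(2)[OF M xy(1)] unit_map(2)[OF M xy(2)] by auto
next
  fix x assume "x \<in> carrier (coind (corner_module M))"
  then show "unit_map M x \<in> carrier M" by (rule unit_map(1)[OF M])
next
  let ?N = "corner_module M"
  fix m assume m: "m \<in> carrier M"
  let ?x = "code ?N (\<lambda>x\<in>eA. x \<odot>\<^bsub>M\<^esub> m)"
  have N: "left_module B ?N" by (rule left_module_corner[OF M])
  have x: "?x \<in> carrier (coind ?N)" using lsmult_homs[OF M m] by (simp add: coind_carrier)
  have "unit_map M ?x = m"
    by (rule unit_map_eqI[OF M x m]) (simp add: decode_code[OF N lsmult_homs[OF M m]])
  then show "\<exists>x\<in>carrier (coind ?N). m = unit_map M x" using x by metis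
qed

text \<open>Evaluation at e. An element of e Hom_B(e A, N) factors through z -> z e, hence through e
  A e = B, and a B-linear map on B is its value at the unit.\<close>

definition counit_map :: "('b, 'u::infinite) module \<Rightarrow> 'u \<Rightarrow> 'u" where
  "counit_map N = (\<lambda>x\<in>carrier (corner_module (coind N)). decode N x e)"

lemma corner_coind_carrier:
  "x \<in> carrier (corner_module (coind N)) \<longleftrightarrow> x \<in> carrier (coind N) \<and> e \<odot>\<^bsub>coind N\<^esub> x = x"
  by (simp add: corner_module_def)

text \<open>If e phi = phi, then phi(z) = phi(z e) since A translates the argument, and z e = (z e)
  e is a B-multiple of e.\<close>

lemma corner_coind_decode:
  assumes N: "left_module B N" and x: "x \<in> carrier (corner_module (coind N))" and z: "z \<in> eA"
  obtains b where "b \<in> carrier B" "z \<otimes> e = emb b" "decode N x z = b \<odot>\<^bsub>N\<^esub> counit_map N x"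
proof -
  have x': "x \<in> carrier (coind N)" using x by (simp add: corner_coind_carrier)
  obtain b where b: "b \<in> carrier B" "z \<otimes> e = emb b"
    using emb_ex[of "z \<otimes> e"] z by (auto simp: eA_mult e_closed A.m_assoc eA_closed e_idem)
  have "decode N x z = decode N x (z \<otimes> e)"
    using decode_smult[OF N e_closed x' z] x by (simp add: corner_coind_carrier)
  also have "\<dots> = decode N x (emb b \<otimes> e)"
    by (simp add: e_emb(2)[OF b(1)] b(2))
  also have "\<dots> = b \<odot>\<^bsub>N\<^esub> counit_map N x"
    using homsD(3)[OF decode_in[OF x'] b(1) e_in] x by (simp add: counit_map_def)
  finally show ?thesis using that b by blast
qed

lemma counit_map_hom:
  assumes N: "left_module B N"
  shows "counit_map N \<in> lmod_hom B (corner_module (coind N)) N"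
proof -
  interpret left_module B N by fact
  interpret C: left_module A "coind N" by (rule left_module_coind[OF N])
  interpret D: left_module B "corner_module (coind N)" by (rule left_module_corner[OF C.left_module_axioms])
  have "counit_map N (x \<oplus>\<^bsub>corner_module (coind N)\<^esub> y) = counit_map N x \<oplus>\<^bsub>N\<^esub> counit_map N y"
    if "x \<in> carrier (corner_module (coind N))" "y \<in> carrier (corner_module (coind N))" for x y
  proof -
    have "counit_map N (x \<oplus>\<^bsub>corner_module (coind N)\<^esub> y) = decode N (x \<oplus>\<^bsub>coind N\<^esub> y) e"
      using D.M.a_closed[OF that] by (simp add: counit_map_def) (simp add: corner_module_def)
    then show ?thesis
      using that by (simp add: corner_coind_carrier decode_add[OF N] e_in counit_map_def)
  qed
  moreover have "counit_map N (b \<odot>\<^bsub>corner_module (coind N)\<^esub> x) = b \<odot>\<^bsub>N\<^esub> counit_map N x"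
    if b: "b \<in> carrier B" and x: "x \<in> carrier (corner_module (coind N))" for b x
  proof -
    have x': "x \<in> carrier (coind N)" using x by (simp add: corner_coind_carrier)
    have "counit_map N (b \<odot>\<^bsub>corner_module (coind N)\<^esub> x) = decode N (emb b \<odot>\<^bsub>coind N\<^esub> x) e"
      using D.lsmult_closed[OF that] by (simp add: counit_map_def) (simp add: corner_module_def)
    also have "\<dots> = decode N x (emb b \<otimes> e)"
      using decode_smult[OF N emb_closed[OF b] x' e_in] b by (simp add: e_emb)
    also have "\<dots> = b \<odot>\<^bsub>N\<^esub> counit_map N x"
      using homsD(3)[OF decode_in[OF x'] b e_in] x by (simp add: counit_map_def)
    finally show ?thesis .
  qed
  moreover have "counit_map N x \<in> carrier N" if "x \<in> carrier (corner_module (coind N))" for x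
    using that homsD(1)[OF decode_in e_in, of x N] by (simp add: counit_map_def corner_coind_carrier)
  ultimately show ?thesis by (auto simp: lmod_hom_def counit_map_def)
qed

lemma counit_map_bij:
  assumes N: "left_module B N"
  shows "bij_betw (counit_map N) (carrier (corner_module (coind N))) (carrier N)"
proof (rule bij_betwI')
  fix x y assume xy: "x \<in> carrier (corner_module (coind N))" "y \<in> carrier (corner_module (coind N))"
  show "counit_map N x = counit_map N y \<longleftrightarrow> x = y"
  proof
    assume eq: "counit_map N x = counit_map N y"
    show "x = y"
    proof (rule coind_eqI)
      fix z assume z: "z \<in> eA"
      obtain b where b: "b \<in> carrier B" "z \<otimes> e = emb b" "decode N x z = b \<odot>\<^bsub>N\<^esub> counit_map N x"
        using corner_coind_decode[OF N xy(1) z] by blast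
      obtain b' where b': "b' \<in> carrier B" "z \<otimes> e = emb b'" "decode N y z = b' \<odot>\<^bsub>N\<^esub> counit_map N y"
        using corner_coind_decode[OF N xy(2) z] by blast
      have "b = b'" using inj_onD[OF emb_inj] b b' by simp
      then show "decode N x z = decode N y z" using b b' eq by simp
    qed (use xy in \<open>simp_all add: corner_coind_carrier\<close>)
  qed simp
next
  fix x assume "x \<in> carrier (corner_module (coind N))"
  then show "counit_map N x \<in> carrier N"
    using counit_map_hom[OF N] by (auto simp: lmod_hom_def)
next
  fix y assume y: "y \<in> carrier N"
  interpret left_module B N by fact
  interpret C: left_module A "coind N" by (rule left_module_coind[OF N])
  \<comment> \<open>\<open>coef z\<close> is the element of B whose image is z e. The preimage of y
    is the map z -> (coef z) y; the facts below make it B-linear, invariant under e, and equal to y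
    at e.\<close>
  define coef where "coef z = inv_into (carrier B) emb (z \<otimes> e)" for z
  have coef: "coef z \<in> carrier B" "emb (coef z) = z \<otimes> e" if z: "z \<in> eA" for z
  proof -
    have "z \<otimes> e \<in> emb ` carrier B"
      using emb_ex[of "z \<otimes> e"] z by (auto simp: eA_mult e_closed A.m_assoc eA_closed e_idem)
    then show "coef z \<in> carrier B" "emb (coef z) = z \<otimes> e"
      by (simp_all add: coef_def inv_into_into f_inv_into_f)
  qed
  have coefI: "coef z = b" if "z \<in> eA" "b \<in> carrier B" "emb b = z \<otimes> e" for z b
    using inj_onD[OF emb_inj] coef[OF that(1)] that by simp
  have add: "coef (z \<oplus> w) = coef z \<oplus>\<^bsub>B\<^esub> coef w" if "z \<in> eA" "w \<in> eA" for z w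
    using that coef by (intro coefI) (auto simp: eA_add emb_add A.l_distr eA_closed e_closed)
  have mult: "coef (emb b \<otimes> z) = b \<otimes>\<^bsub>B\<^esub> coef z" if "z \<in> eA" "b \<in> carrier B" for z b
    using that coef by (intro coefI) (auto simp: emb_eA emb_mult emb_closed A.m_assoc eA_closed e_closed)
  let ?\<phi> = "\<lambda>z\<in>eA. coef z \<odot>\<^bsub>N\<^esub> y"
  have \<phi>: "?\<phi> \<in> homs N"
    using y coef(1) by (intro homsI) (simp_all add: lsmult_closed add mult lsmult_l_distr lsmult_assoc)
  let ?x = "code N ?\<phi>"
  have x: "?x \<in> carrier (coind N)" using \<phi> by (simp add: coind_carrier)
  have "coef (z \<otimes> e) = coef z" if "z \<in> eA" for z
    using that coef by (intro coefI) (simp_all add: eA_mult e_closed A.m_assoc eA_closed e_idem)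
  then have "e \<odot>\<^bsub>coind N\<^esub> ?x = ?x"
    using x by - (rule coind_eqI[where N = N, OF C.lsmult_closed], simp_all add: e_closed decode_smult[OF N] decode_code[OF N \<phi>] eA_mult)
  then have x': "?x \<in> carrier (corner_module (coind N))" using x by (simp add: corner_coind_carrier)
  have "coef e = \<one>\<^bsub>B\<^esub>" by (intro coefI) (simp_all add: e_in e_idem)
  then have "counit_map N ?x = y"
    using x' y by (simp add: counit_map_def decode_code[OF N \<phi>] e_in lsmult_one)
  then show "\<exists>x\<in>carrier (corner_module (coind N)). y = counit_map N x" using x' by metis
qed

section \<open>The two functors on morphisms and the equivalence\<close>

definition coind_map ::
  "('b, 'u::infinite) module \<Rightarrow> ('b, 'u) module \<Rightarrow> ('u \<Rightarrow> 'u) \<Rightarrow> 'u \<Rightarrow> 'u" where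
  "coind_map N N' f = (\<lambda>x\<in>carrier (coind N). code N' (\<lambda>z\<in>eA. f (decode N x z)))"

lemma coind_map_homs:
  assumes f: "f \<in> lmod_hom B N N'" and x: "x \<in> carrier (coind N)"
  shows "(\<lambda>z\<in>eA. f (decode N x z)) \<in> homs N'"
  using f homsD[OF decode_in[OF x]] by (intro homsI) (auto simp: lmod_hom_def)

lemma coind_map_closed:
  assumes "f \<in> lmod_hom B N N'" "x \<in> carrier (coind N)"
  shows "coind_map N N' f x \<in> carrier (coind N')"
  using coind_map_homs[OF assms] assms(2) by (simp add: coind_map_def coind_carrier)

lemma decode_coind_map:
  assumes "left_module B N'" "f \<in> lmod_hom B N N'" "x \<in> carrier (coind N)" "z \<in> eA"
  shows "decode N' (coind_map N N' f x) z = f (decode N x z)"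
  using decode_code[OF assms(1) coind_map_homs[OF assms(2,3)]] assms by (simp add: coind_map_def)

lemma lmod_homI:
  assumes "f \<in> carrier M \<rightarrow>\<^sub>E carrier N"
    and "\<And>x y. \<lbrakk>x \<in> carrier M; y \<in> carrier M\<rbrakk> \<Longrightarrow> f (x \<oplus>\<^bsub>M\<^esub> y) = f x \<oplus>\<^bsub>N\<^esub> f y"
    and "\<And>a x. \<lbrakk>a \<in> carrier R; x \<in> carrier M\<rbrakk> \<Longrightarrow> f (a \<odot>\<^bsub>M\<^esub> x) = a \<odot>\<^bsub>N\<^esub> f x"
  shows "f \<in> lmod_hom R M N"
  using assms by (simp add: lmod_hom_def)

lemma lmod_homD:
  assumes "f \<in> lmod_hom R M N"
  shows "x \<in> carrier M \<Longrightarrow> f x \<in> carrier N"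
    and "\<lbrakk>x \<in> carrier M; y \<in> carrier M\<rbrakk> \<Longrightarrow> f (x \<oplus>\<^bsub>M\<^esub> y) = f x \<oplus>\<^bsub>N\<^esub> f y"
    and "\<lbrakk>a \<in> carrier R; x \<in> carrier M\<rbrakk> \<Longrightarrow> f (a \<odot>\<^bsub>M\<^esub> x) = a \<odot>\<^bsub>N\<^esub> f x"
    and "f \<in> extensional (carrier M)"
  using assms by (auto simp: lmod_hom_def PiE_iff)

lemma coind_map_hom:
  assumes N: "left_module B N" "left_module B N'" and f: "f \<in> lmod_hom B N N'"
  shows "coind_map N N' f \<in> lmod_hom A (coind N) (coind N')"
proof -
  interpret C: left_module A "coind N" by (rule left_module_coind[OF N(1)])
  interpret C': left_module A "coind N'" by (rule left_module_coind[OF N(2)])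
  note closed = coind_map_closed[OF f] and decode = decode_coind_map[OF N(2) f]
  show ?thesis
  proof (rule lmod_homI)
    show "coind_map N N' f \<in> carrier (coind N) \<rightarrow>\<^sub>E carrier (coind N')"
      using closed by (auto simp: coind_map_def)
  next
    fix x y assume xy: "x \<in> carrier (coind N)" "y \<in> carrier (coind N)"
    show "coind_map N N' f (x \<oplus>\<^bsub>coind N\<^esub> y) = coind_map N N' f x \<oplus>\<^bsub>coind N'\<^esub> coind_map N N' f y"
      using xy closed lmod_homD[OF f]
      by - (rule coind_eqI[where N = N'], simp_all add: decode decode_closed decode_add[OF N(1)] decode_add[OF N(2)])
  next
    fix a x assume ax: "a \<in> carrier A" "x \<in> carrier (coind N)"
    show "coind_map N N' f (a \<odot>\<^bsub>coind N\<^esub> x) = a \<odot>\<^bsub>coind N'\<^esub> coind_map N N' f x"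
      using ax closed C.lsmult_closed C'.lsmult_closed
      by - (rule coind_eqI[where N = N'], simp_all add: decode decode_smult[OF N(1)] decode_smult[OF N(2)] eA_mult)
  qed
qed

definition corner_map :: "('a, 'u) module \<Rightarrow> ('a, 'u) module \<Rightarrow> ('u \<Rightarrow> 'u) \<Rightarrow> 'u \<Rightarrow> 'u" where
  "corner_map M M' f = restrict f (carrier (corner_module M))"

lemma corner_map_hom:
  assumes M: "left_module A M" and f: "f \<in> lmod_hom A M M'"
  shows "corner_map M M' f \<in> lmod_hom B (corner_module M) (corner_module M')"
proof -
  interpret left_module A M by fact
  interpret D: left_module B "corner_module M" by (rule left_module_corner[OF M])
  have carr: "carrier (corner_module M) = {x \<in> carrier M. e \<odot>\<^bsub>M\<^esub> x = x}" for M :: "('a, 'x) module"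
    by (simp add: corner_module_def)
  note closed = D.M.a_closed D.lsmult_closed
  show ?thesis
  proof (rule lmod_homI)
    show "corner_map M M' f \<in> carrier (corner_module M) \<rightarrow>\<^sub>E carrier (corner_module M')"
      using lmod_homD[OF f] e_closed by (auto simp: corner_map_def carr) metis
  next
    fix x y assume xy: "x \<in> carrier (corner_module M)" "y \<in> carrier (corner_module M)"
    then have "corner_map M M' f (x \<oplus>\<^bsub>corner_module M\<^esub> y) = f (x \<oplus>\<^bsub>M\<^esub> y)"
      using closed(1)[OF xy] by (simp add: corner_map_def) (simp add: corner_module_def)
    then show "corner_map M M' f (x \<oplus>\<^bsub>corner_module M\<^esub> y) =
        corner_map M M' f x \<oplus>\<^bsub>corner_module M'\<^esub> corner_map M M' f y"
      using lmod_homD(2)[OF f] xy by (simp add: corner_map_def) (simp add: corner_module_def)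
  next
    fix b x assume bx: "b \<in> carrier B" "x \<in> carrier (corner_module M)"
    then have "corner_map M M' f (b \<odot>\<^bsub>corner_module M\<^esub> x) = f (emb b \<odot>\<^bsub>M\<^esub> x)"
      using closed(2)[OF bx] by (simp add: corner_map_def) (simp add: corner_module_def)
    then show "corner_map M M' f (b \<odot>\<^bsub>corner_module M\<^esub> x) = b \<odot>\<^bsub>corner_module M'\<^esub> corner_map M M' f x"
      using lmod_homD(3)[OF f emb_closed] bx by (simp add: corner_map_def) (simp add: corner_module_def)
  qed
qed

lemma corner_functor:
  "additive_functor A B (corner_module :: ('a, 'u::infinite) module \<Rightarrow> _) corner_map"
  unfolding additive_functor_def
proof (intro conjI ballI)
  fix M :: "('a, 'u) module" assume "M \<in> lmods A"
  then have M: "left_module A M" by (simp add: lmods_def)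
  show "corner_module M \<in> lmods B" by (simp add: lmods_def left_module_corner[OF M])
  show "corner_map M M (\<lambda>x\<in>carrier M. x) = (\<lambda>x\<in>carrier (corner_module M). x)"
    by (auto simp: corner_map_def corner_module_def intro!: restrict_ext)
  fix N :: "('a, 'u) module" assume "N \<in> lmods A"
  then have N: "left_module A N" by (simp add: lmods_def)
  fix f assume f: "f \<in> lmod_hom A M N"
  show "corner_map M N f \<in> lmod_hom B (corner_module M) (corner_module N)"
    by (rule corner_map_hom[OF M f])
  fix g
  show "corner_map M N (\<lambda>x\<in>carrier M. f x \<oplus>\<^bsub>N\<^esub> g x) =
     (\<lambda>x\<in>carrier (corner_module M). corner_map M N f x \<oplus>\<^bsub>corner_module N\<^esub> corner_map M N g x)"
    by (auto simp: corner_map_def corner_module_def intro!: restrict_ext)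
next
  fix L M N :: "('a, 'u) module" and f g
  assume "L \<in> lmods A" "M \<in> lmods A" and f: "f \<in> lmod_hom A L M"
  then have Lf: "corner_map L M f \<in> lmod_hom B (corner_module L) (corner_module M)"
    by (intro corner_map_hom) (simp_all add: lmods_def)
  have "f x \<in> carrier (corner_module M)" if "x \<in> carrier (corner_module L)" for x
    using lmod_homD(1)[OF Lf that] that by (simp add: corner_map_def)
  then show "corner_map L N (compose (carrier L) g f) =
      compose (carrier (corner_module L)) (corner_map M N g) (corner_map L M f)"
    using corner_carrier[of _ L] by (auto simp: corner_map_def compose_def fun_eq_iff restrict_def)
qed

lemma coind_functor:
  "additive_functor B A (coind :: ('b, 'u::infinite) module \<Rightarrow> _) coind_map"
  unfolding additive_functor_def
proof (intro conjI ballI)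
  fix M :: "('b, 'u) module" assume "M \<in> lmods B"
  then have M: "left_module B M" by (simp add: lmods_def)
  interpret M: left_module B M by fact
  interpret CM: left_module A "coind M" by (rule left_module_coind[OF M])
  show "coind M \<in> lmods A" by (simp add: lmods_def left_module_coind[OF M])
  have id: "(\<lambda>x\<in>carrier M. x) \<in> lmod_hom B M M"
    by (intro lmod_homI) (auto simp: M.lsmult_closed)
  show "coind_map M M (\<lambda>x\<in>carrier M. x) = (\<lambda>x\<in>carrier (coind M). x)"
  proof (rule extensionalityI[of _ "carrier (coind M)"])
    fix x assume x: "x \<in> carrier (coind M)"
    then show "coind_map M M (\<lambda>x\<in>carrier M. x) x = (\<lambda>x\<in>carrier (coind M). x) x"
      using coind_map_closed[OF id x]
      by - (rule coind_eqI[where N = M], simp_all add: decode_closed decode_coind_map[OF M id x])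
  qed (simp_all add: coind_map_def)
  fix N :: "('b, 'u) module" assume "N \<in> lmods B"
  then have N: "left_module B N" by (simp add: lmods_def)
  interpret N: left_module B N by fact
  interpret CN: left_module A "coind N" by (rule left_module_coind[OF N])
  fix f assume f: "f \<in> lmod_hom B M N"
  show "coind_map M N f \<in> lmod_hom A (coind M) (coind N)"
    by (rule coind_map_hom[OF M N f])
  fix g assume g: "g \<in> lmod_hom B M N"
  have fg: "(\<lambda>x\<in>carrier M. f x \<oplus>\<^bsub>N\<^esub> g x) \<in> lmod_hom B M N"
    using lmod_homD[OF f] lmod_homD[OF g]
    by (intro lmod_homI) (auto simp: N.M.a_ac N.lsmult_r_distr M.lsmult_closed)
  show "coind_map M N (\<lambda>x\<in>carrier M. f x \<oplus>\<^bsub>N\<^esub> g x) =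
     (\<lambda>x\<in>carrier (coind M). coind_map M N f x \<oplus>\<^bsub>coind N\<^esub> coind_map M N g x)"
  proof (rule extensionalityI[of _ "carrier (coind M)"])
    fix x assume x: "x \<in> carrier (coind M)"
    then show "coind_map M N (\<lambda>x\<in>carrier M. f x \<oplus>\<^bsub>N\<^esub> g x) x =
        (\<lambda>x\<in>carrier (coind M). coind_map M N f x \<oplus>\<^bsub>coind N\<^esub> coind_map M N g x) x"
      using coind_map_closed[OF fg x] coind_map_closed[OF f x] coind_map_closed[OF g x]
      by - (rule coind_eqI[where N = N], simp_all add: decode_closed decode_coind_map[OF N fg x] decode_coind_map[OF N f x]
          decode_coind_map[OF N g x] decode_add[OF N])
  qed (simp_all add: coind_map_def)
next
  fix L M N :: "('b, 'u) module" and f g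
  assume "L \<in> lmods B" "M \<in> lmods B" "N \<in> lmods B"
    and f: "f \<in> lmod_hom B L M" and g: "g \<in> lmod_hom B M N"
  then have L: "left_module B L" and M: "left_module B M" and N: "left_module B N"
    by (simp_all add: lmods_def)
  interpret L: left_module B L by fact
  have gf: "compose (carrier L) g f \<in> lmod_hom B L N"
    using lmod_homD[OF f] lmod_homD[OF g]
    by (intro lmod_homI) (auto simp: compose_def L.lsmult_closed)
  show "coind_map L N (compose (carrier L) g f) =
      compose (carrier (coind L)) (coind_map M N g) (coind_map L M f)"
  proof (rule extensionalityI[of _ "carrier (coind L)"])
    fix x assume x: "x \<in> carrier (coind L)"
    note fx = coind_map_closed[OF f x]
    show "coind_map L N (compose (carrier L) g f) x =
        compose (carrier (coind L)) (coind_map M N g) (coind_map L M f) x"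
      using x coind_map_closed[OF gf x] coind_map_closed[OF g fx]
      by - (rule coind_eqI[where N = N], simp_all add: compose_def decode_closed decode_coind_map[OF N gf x, unfolded compose_def]
          decode_coind_map[OF N g fx] decode_coind_map[OF M f x])
  qed (simp_all add: coind_map_def)
qed

theorem morita_full_corner: "morita_equivalent TYPE('u::infinite) A B"
proof -
  have "natural_iso_to_id A (\<lambda>M :: ('a, 'u) module. coind (corner_module M))
      (\<lambda>M N f. coind_map (corner_module M) (corner_module N) (corner_map M N f)) unit_map"
    unfolding natural_iso_to_id_def
  proof (intro conjI ballI)
    fix M :: "('a, 'u) module" assume "M \<in> lmods A"
    then have M: "left_module A M" by (simp add: lmods_def)
    show "unit_map M \<in> lmod_hom A (coind (corner_module M)) M" by (rule unit_map_hom[OF M])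
    show "bij_betw (unit_map M) (carrier (coind (corner_module M))) (carrier M)"
      by (rule unit_map_bij[OF M])
    fix N :: "('a, 'u) module" and f assume "N \<in> lmods A" and f: "f \<in> lmod_hom A M N"
    then have N: "left_module A N" by (simp add: lmods_def)
    note Mf = corner_map_hom[OF M f]
    show "compose (carrier (coind (corner_module M))) f (unit_map M) =
        compose (carrier (coind (corner_module M))) (unit_map N)
          (coind_map (corner_module M) (corner_module N) (corner_map M N f))"
      unfolding compose_def
    proof (rule restrict_ext)
      fix x assume x: "x \<in> carrier (coind (corner_module M))"
      have "unit_map N (coind_map (corner_module M) (corner_module N) (corner_map M N f) x) = f (unit_map M x)"
      proof (rule unit_map_eqI[OF N coind_map_closed[OF Mf x]])
        show "f (unit_map M x) \<in> carrier N"
          using lmod_homD(1)[OF f] unit_map(1)[OF M x] by simp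
        fix z assume z: "z \<in> eA"
        have "decode (corner_module N) (coind_map (corner_module M) (corner_module N) (corner_map M N f) x) z
            = f (decode (corner_module M) x z)"
          using decode_coind_map[OF left_module_corner[OF N] Mf x z] homsD(1)[OF decode_in[OF x] z]
          by (simp add: corner_map_def)
        also have "\<dots> = z \<odot>\<^bsub>N\<^esub> f (unit_map M x)"
          using unit_map[OF M x] lmod_homD(3)[OF f] z by (simp add: eA_closed)
        finally show "decode (corner_module N)
            (coind_map (corner_module M) (corner_module N) (corner_map M N f) x) z = z \<odot>\<^bsub>N\<^esub> f (unit_map M x)" .
      qed
      then show "f (unit_map M x) =
          unit_map N (coind_map (corner_module M) (corner_module N) (corner_map M N f) x)" by simp
    qed
  qed
  moreover have "natural_iso_to_id B (\<lambda>M :: ('b, 'u) module. corner_module (coind M))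
      (\<lambda>M N f. corner_map (coind M) (coind N) (coind_map M N f)) counit_map"
    unfolding natural_iso_to_id_def
  proof (intro conjI ballI)
    fix M :: "('b, 'u) module" assume "M \<in> lmods B"
    then have M: "left_module B M" by (simp add: lmods_def)
    show "counit_map M \<in> lmod_hom B (corner_module (coind M)) M" by (rule counit_map_hom[OF M])
    show "bij_betw (counit_map M) (carrier (corner_module (coind M))) (carrier M)"
      by (rule counit_map_bij[OF M])
    fix N :: "('b, 'u) module" and f assume "N \<in> lmods B" and f: "f \<in> lmod_hom B M N"
    then have N: "left_module B N" by (simp add: lmods_def)
    have CM: "left_module A (coind M)" by (rule left_module_coind[OF M])
    note Cf = corner_map_hom[OF CM coind_map_hom[OF M N f]]
    show "compose (carrier (corner_module (coind M))) f (counit_map M) =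
        compose (carrier (corner_module (coind M))) (counit_map N)
          (corner_map (coind M) (coind N) (coind_map M N f))"
      unfolding compose_def
    proof (rule restrict_ext)
      fix x assume x: "x \<in> carrier (corner_module (coind M))"
      then have x': "x \<in> carrier (coind M)" by (simp add: corner_coind_carrier)
      show "f (counit_map M x) = counit_map N (corner_map (coind M) (coind N) (coind_map M N f) x)"
        using x lmod_homD(1)[OF Cf x] decode_coind_map[OF N f x' e_in]
        by (simp add: counit_map_def corner_map_def)
    qed
  qed
  ultimately show ?thesis
    unfolding morita_equivalent_def
    using corner_functor[where ?'u = 'u] coind_functor[where ?'u = 'u] A.ring_axioms B.ring_axioms
    by blast
qed

end

section \<open>Free algebras over localizations of the integers\<close>

lemma zloc_of_int [simp]: "prime p \<Longrightarrow> of_int a \<in> zloc p"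
  unfolding zloc_def using prime_gt_1_nat[of p] by (intro CollectI exI[of _ a] exI[of _ 1]) auto

lemma zloc_numeral [simp]: "prime p \<Longrightarrow> numeral k \<in> zloc p"
  using zloc_of_int[of p "numeral k"] by simp

lemma zloc_0 [simp]: "prime p \<Longrightarrow> 0 \<in> zloc p"
  using zloc_of_int[of p 0] by simp

lemma zloc_1 [simp]: "prime p \<Longrightarrow> 1 \<in> zloc p"
  using zloc_of_int[of p 1] by simp

lemma zloc_combine:
  assumes p: "prime p" and "x \<in> zloc p" "y \<in> zloc p"
  shows "x + y \<in> zloc p" "x * y \<in> zloc p"
proof -
  obtain a b c d :: int where x: "x = of_int a / of_int b" "\<not> int p dvd b"
    and y: "y = of_int c / of_int d" "\<not> int p dvd d"
    using assms by (auto simp: zloc_def)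
  have bd: "b \<noteq> 0" "d \<noteq> 0" "\<not> int p dvd b * d"
    using x y p prime_dvd_mult_iff[of "int p" b d] by auto
  show "x + y \<in> zloc p"
    unfolding zloc_def using x y bd
    by (intro CollectI exI[of _ "a * d + c * b"] exI[of _ "b * d"]) (simp add: field_simps)
  show "x * y \<in> zloc p"
    unfolding zloc_def using x y bd
    by (intro CollectI exI[of _ "a * c"] exI[of _ "b * d"]) simp
qed

lemmas zloc_add [intro, simp] = zloc_combine(1)
lemmas zloc_mult [intro, simp] = zloc_combine(2)

lemma zloc_minus [simp]: "\<lbrakk>prime p; x \<in> zloc p\<rbrakk> \<Longrightarrow> - x \<in> zloc p"
  using zloc_mult[of p "- 1" x] zloc_of_int[of p "- 1"] by simp

lemma zloc_diff [simp]: "\<lbrakk>prime p; x \<in> zloc p; y \<in> zloc p\<rbrakk> \<Longrightarrow> x - y \<in> zloc p"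
  using zloc_add[of p x "- y"] by simp

lemma zloc_sum: "\<lbrakk>prime p; \<And>i. i \<in> A \<Longrightarrow> f i \<in> zloc p\<rbrakk> \<Longrightarrow> sum f A \<in> zloc p"
  by (induction A rule: infinite_finite_induct) auto

lemma zloc_ring_sel [simp]:
  "carrier (zloc_ring p) = zloc p" "mult (zloc_ring p) = (*)" "\<one>\<^bsub>zloc_ring p\<^esub> = 1"
  "\<zero>\<^bsub>zloc_ring p\<^esub> = 0" "add (zloc_ring p) = (+)"
  by (simp_all add: zloc_ring_def)

lemma cring_zloc_ring:
  assumes "prime p" shows "cring (zloc_ring p)"
proof (rule cringI)
  show "abelian_group (zloc_ring p)"
    using assms by (intro abelian_groupI) (auto intro: bexI[of _ "- _"])
  show "comm_monoid (zloc_ring p)"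
    using assms by (intro comm_monoidI) auto
qed (auto simp: distrib_right)

lemma finsum_zloc_ring:
  assumes "prime p" "\<And>i. i \<in> A \<Longrightarrow> f i \<in> zloc p"
  shows "finsum (zloc_ring p) f A = sum f A"
proof -
  interpret cring "zloc_ring p" by (rule cring_zloc_ring[OF assms(1)])
  show ?thesis
    using assms(2) by (induction A rule: infinite_finite_induct) auto
qed

interpretation alg: Modules.module alg_scale
  by unfold_locales
    (simp_all add: alg_scale_def alg_eq_iff alg_ops vec_eq_iff qex_ops algebra_simps)

lemma alg_scale_mult:
  "alg_scale r x * y = alg_scale r (x * y)" "x * alg_scale r y = alg_scale r (x * y)"
  by (simp_all add: alg_scale_def alg_eq_iff alg_ops block_ops qex_ops numeral_qex sum_3 algebra_simps)

text \<open>Covers both the path algebra and the free module on biset classes. Associativity and the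
  unit laws are left to \<open>free_assoc_alg\<close>, which is instantiated for paths only; there
  they are needed because the generated ideal is compared with ideals of a ring.\<close>

locale free_alg =
  fixes p :: nat and S :: "'s set" and opr :: "'s \<Rightarrow> 's \<Rightarrow> 's option" and E :: "'s set"
  assumes prime_p: "prime p"
    and opr_closed: "\<lbrakk>a \<in> S; b \<in> S; opr a b = Some c\<rbrakk> \<Longrightarrow> c \<in> S"
    and E: "E \<subseteq> S" "finite E"
begin

abbreviation F :: "(rat, 's \<Rightarrow> rat) module" where "F \<equiv> free_algebra_on (zloc_ring p) S opr E"

abbreviation supp :: "('s \<Rightarrow> rat) \<Rightarrow> 's set" where "supp f \<equiv> {s. f s \<noteq> 0}"

lemma F_sel [simp]:
  "add F = (\<lambda>f g s. f s + g s)" "smult F = (\<lambda>r f s. r * f s)" "\<zero>\<^bsub>F\<^esub> = (\<lambda>s. 0)"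
  "\<one>\<^bsub>F\<^esub> = (\<lambda>s. if s \<in> E then 1 else 0)"
  by (simp_all add: free_algebra_on_def cong: if_cong)

lemma F_carrier: "f \<in> carrier F \<longleftrightarrow> (\<forall>s. f s \<in> zloc p) \<and> supp f \<subseteq> S \<and> finite (supp f)"
  using prime_p zloc_0[of p] by (auto simp: free_algebra_on_def subset_iff)

lemma F_closed:
  "\<lbrakk>f \<in> carrier F; g \<in> carrier F\<rbrakk> \<Longrightarrow> (\<lambda>s. f s + g s) \<in> carrier F"
  "\<lbrakk>r \<in> zloc p; f \<in> carrier F\<rbrakk> \<Longrightarrow> (\<lambda>s. r * f s) \<in> carrier F"
  "(\<lambda>s. 0) \<in> carrier F"
proof -
  assume fg: "f \<in> carrier F" "g \<in> carrier F"
  have sub: "supp (\<lambda>s. f s + g s) \<subseteq> supp f \<union> supp g" by auto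
  have "finite (supp (\<lambda>s. f s + g s))"
    using fg by (intro finite_subset[OF sub]) (simp add: F_carrier)
  moreover have "supp (\<lambda>s. f s + g s) \<subseteq> S"
    using fg by (intro order_trans[OF sub]) (simp add: F_carrier)
  ultimately show "(\<lambda>s. f s + g s) \<in> carrier F"
    using fg prime_p by (simp add: F_carrier)
next
  assume rf: "r \<in> zloc p" "f \<in> carrier F"
  have sub: "supp (\<lambda>s. r * f s) \<subseteq> supp f" by auto
  have "finite (supp (\<lambda>s. r * f s))"
    using rf by (intro finite_subset[OF sub]) (simp add: F_carrier)
  moreover have "supp (\<lambda>s. r * f s) \<subseteq> S"
    using rf by (intro order_trans[OF sub]) (simp add: F_carrier)
  ultimately show "(\<lambda>s. r * f s) \<in> carrier F"
    using rf prime_p by (simp add: F_carrier)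
next
  show "(\<lambda>s. 0) \<in> carrier F" using prime_p by (simp add: F_carrier)
qed

lemma F_one_closed: "\<one>\<^bsub>F\<^esub> \<in> carrier F"
  using prime_p E finite_subset[of _ E] by (auto simp: F_carrier)

lemma F_abelian_group: "abelian_group F"
proof (rule abelian_groupI)
  fix f assume "f \<in> carrier F"
  then show "\<exists>g\<in>carrier F. g \<oplus>\<^bsub>F\<^esub> f = \<zero>\<^bsub>F\<^esub>"
    using prime_p F_closed(2)[of "- 1" f]
    by (intro bexI[of _ "\<lambda>s. - 1 * f s"]) (simp_all del: zloc_of_int)
qed (auto intro: F_closed simp: add.assoc add.commute)

lemma F_module: "Module.module (zloc_ring p) F"
  by (intro moduleI cring_zloc_ring prime_p F_abelian_group)
    (auto intro: F_closed simp: algebra_simps)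

sublocale F: Module.module "zloc_ring p" F by (rule F_module)

lemma F_uminus: "f \<in> carrier F \<Longrightarrow> \<ominus>\<^bsub>F\<^esub> f = (\<lambda>s. - f s)"
  using F_closed(2)[of "- 1" f] zloc_of_int[of p "- 1"] prime_p
  by (intro F.minus_equality) auto

lemma F_minus: "\<lbrakk>f \<in> carrier F; g \<in> carrier F\<rbrakk> \<Longrightarrow> f \<ominus>\<^bsub>F\<^esub> g = (\<lambda>s. f s - g s)"
  by (simp add: F.minus_eq F_uminus)

lemma basis_elem_closed: "s \<in> S \<Longrightarrow> basis_elem (zloc_ring p) s \<in> carrier F"
  using prime_p finite_subset[of _ "{s}"] by (auto simp: F_carrier basis_elem_def)

text \<open>The defining sum runs over the pairs with a prescribed product, a set that varies with
  s. Rectangular index sets, allowed to be larger than the supports, make products with different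
  factors comparable term by term.\<close>

lemma F_mult_sum:
  assumes f: "f \<in> carrier F" and g: "g \<in> carrier F"
    and A: "finite A" "supp f \<subseteq> A" and B: "finite B" "supp g \<subseteq> B"
  shows "(f \<otimes>\<^bsub>F\<^esub> g) s = (\<Sum>a\<in>A. \<Sum>b\<in>B. if opr a b = Some s then f a * g b else 0)"
proof -
  let ?P = "{(a, b). f a \<noteq> 0 \<and> g b \<noteq> 0 \<and> opr a b = Some s}"
  have "(f \<otimes>\<^bsub>F\<^esub> g) s = finsum (zloc_ring p) (\<lambda>q. f (fst q) * g (snd q)) ?P"
    by (simp add: free_algebra_on_def)
  also have "\<dots> = (\<Sum>q\<in>?P. f (fst q) * g (snd q))"
    using f g prime_p by (intro finsum_zloc_ring) (auto simp: F_carrier)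
  also have "\<dots> = (\<Sum>q\<in>A \<times> B. if opr (fst q) (snd q) = Some s then f (fst q) * g (snd q) else 0)"
    using A B by (intro sum.mono_neutral_cong_left) (auto split: if_splits)
  also have "\<dots> = (\<Sum>a\<in>A. \<Sum>b\<in>B. if opr a b = Some s then f a * g b else 0)"
    by (simp add: sum.cartesian_product case_prod_beta)
  finally show ?thesis .
qed

lemma F_supp:
  assumes "f \<in> carrier F"
  shows "finite (supp f)" "supp f \<subseteq> S" "f s \<in> zloc p"
  using assms by (auto simp: F_carrier)

lemma F_supp_mult:
  assumes "f \<in> carrier F" "g \<in> carrier F"
  shows "supp (f \<otimes>\<^bsub>F\<^esub> g) \<subseteq> (\<lambda>(a, b). the (opr a b)) ` {(a, b) \<in> supp f \<times> supp g. opr a b \<noteq> None}"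
    (is "_ \<subseteq> ?X")
proof
  fix s assume "s \<in> supp (f \<otimes>\<^bsub>F\<^esub> g)"
  then have "(\<Sum>a\<in>supp f. \<Sum>b\<in>supp g. if opr a b = Some s then f a * g b else 0) \<noteq> 0"
    using F_mult_sum[OF assms, of "supp f" "supp g" s] F_supp assms by simp
  then obtain a where a: "a \<in> supp f" "(\<Sum>b\<in>supp g. if opr a b = Some s then f a * g b else 0) \<noteq> 0"
    by (auto elim: sum.not_neutral_contains_not_neutral)
  then obtain b where "b \<in> supp g" "(if opr a b = Some s then f a * g b else 0) \<noteq> 0"
    by (auto elim: sum.not_neutral_contains_not_neutral)
  then show "s \<in> ?X" using a by (force split: if_splits)
qed

lemma F_supp_mult_finite:
  assumes "f \<in> carrier F" "g \<in> carrier F"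
  shows "finite ((\<lambda>(a, b). the (opr a b)) ` {(a, b) \<in> supp f \<times> supp g. opr a b \<noteq> None})"
  using F_supp(1)[OF assms(1)] F_supp(1)[OF assms(2)]
  by (intro finite_imageI) (auto intro: finite_subset[of _ "supp f \<times> supp g"])

lemma F_mult_closed:
  assumes "f \<in> carrier F" "g \<in> carrier F"
  shows "f \<otimes>\<^bsub>F\<^esub> g \<in> carrier F"
proof -
  have "finite (supp (f \<otimes>\<^bsub>F\<^esub> g))"
    using F_supp_mult[OF assms] F_supp_mult_finite[OF assms] by (rule finite_subset)
  moreover have "supp (f \<otimes>\<^bsub>F\<^esub> g) \<subseteq> S"
  proof
    fix s assume "s \<in> supp (f \<otimes>\<^bsub>F\<^esub> g)"
    from subsetD[OF F_supp_mult[OF assms] this]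
    obtain a b where ab: "a \<in> supp f" "b \<in> supp g" "opr a b = Some s" by auto
    have "a \<in> S" "b \<in> S"
      using ab(1,2) F_supp(2)[OF assms(1)] F_supp(2)[OF assms(2)] by blast+
    then show "s \<in> S" using opr_closed ab(3) by blast
  qed
  moreover have "(f \<otimes>\<^bsub>F\<^esub> g) s \<in> zloc p" for s
    using F_mult_sum[OF assms, of "supp f" "supp g" s] F_supp assms prime_p
    by (auto intro!: zloc_sum)
  ultimately show ?thesis by (simp add: F_carrier)
qed

lemma F_scale_mult:
  assumes r: "r \<in> zloc p" and f: "f \<in> carrier F" and g: "g \<in> carrier F"
  shows "(\<lambda>s. r * f s) \<otimes>\<^bsub>F\<^esub> g = (\<lambda>s. r * (f \<otimes>\<^bsub>F\<^esub> g) s)"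
proof
  fix s
  note fin = F_supp(1)[OF f] F_supp(1)[OF g]
  have "supp (\<lambda>s. r * f s) \<subseteq> supp f" by auto
  from F_mult_sum[OF F_closed(2)[OF r f] g fin(1) this fin(2) order_refl, of s]
  show "((\<lambda>s. r * f s) \<otimes>\<^bsub>F\<^esub> g) s = r * (f \<otimes>\<^bsub>F\<^esub> g) s"
    unfolding F_mult_sum[OF f g fin(1) order_refl fin(2) order_refl]
    by (simp add: sum_distrib_left mult.assoc if_distrib cong: if_cong)
qed

definition ev :: "('s \<Rightarrow> alg) \<Rightarrow> ('s \<Rightarrow> rat) \<Rightarrow> alg" where
  "ev \<omega> f = (\<Sum>s\<in>supp f. alg_scale (f s) (\<omega> s))"

lemma ev_superset: "\<lbrakk>finite A; supp f \<subseteq> A\<rbrakk> \<Longrightarrow> ev \<omega> f = (\<Sum>s\<in>A. alg_scale (f s) (\<omega> s))"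
  unfolding ev_def by (rule sum.mono_neutral_left) auto

lemma ev_add:
  assumes "f \<in> carrier F" "g \<in> carrier F"
  shows "ev \<omega> (\<lambda>s. f s + g s) = ev \<omega> f + ev \<omega> g"
proof -
  have "finite (supp f \<union> supp g)" "supp (\<lambda>s. f s + g s) \<subseteq> supp f \<union> supp g"
    using assms by (auto simp: F_carrier)
  then show ?thesis
    by (simp add: ev_superset[of "supp f \<union> supp g"] alg.scale_left_distrib sum.distrib)
qed

lemma ev_scale:
  assumes "f \<in> carrier F"
  shows "ev \<omega> (\<lambda>s. r * f s) = alg_scale r (ev \<omega> f)"
proof -
  have "finite (supp f)" "supp (\<lambda>s. r * f s) \<subseteq> supp f"
    using assms by (auto simp: F_carrier)
  then show ?thesis
    by (simp add: ev_superset[of "supp f"] alg.scale_sum_right)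
qed

lemma ev_basis_elem: "ev \<omega> (basis_elem (zloc_ring p) s) = \<omega> s"
  by (subst ev_superset[of "{s}"]) (auto simp: basis_elem_def)

lemma ev_one: "ev \<omega> \<one>\<^bsub>F\<^esub> = (\<Sum>s\<in>E. \<omega> s)"
  using E by (subst ev_superset[of E]) auto

lemma ev_mult:
  assumes f: "f \<in> carrier F" and g: "g \<in> carrier F"
    and \<omega>: "\<And>a b. \<lbrakk>a \<in> S; b \<in> S\<rbrakk> \<Longrightarrow>
      \<omega> a * \<omega> b = (case opr a b of None \<Rightarrow> 0 | Some c \<Rightarrow> \<omega> c)"
  shows "ev \<omega> (f \<otimes>\<^bsub>F\<^esub> g) = ev \<omega> f * ev \<omega> g"
proof -
  let ?A = "supp f" and ?B = "supp g"
  \<comment> \<open>X contains every basis element that can occur in the product, so the evaluation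
    can be summed over X before the product is expanded.\<close>
  define X where "X = (\<lambda>(a, b). the (opr a b)) ` {(a, b) \<in> ?A \<times> ?B. opr a b \<noteq> None}"
  have X: "finite X" "supp (f \<otimes>\<^bsub>F\<^esub> g) \<subseteq> X"
    unfolding X_def using F_supp_mult[OF f g] F_supp_mult_finite[OF f g] by auto
  note fin = F_supp(1)[OF f] F_supp(1)[OF g]
  have term_eq: "(\<Sum>s\<in>X. alg_scale (if opr a b = Some s then f a * g b else 0) (\<omega> s)) =
      alg_scale (f a) (\<omega> a) * alg_scale (g b) (\<omega> b)" if ab: "a \<in> ?A" "b \<in> ?B" for a b
  proof -
    have S: "a \<in> S" "b \<in> S" using ab F_supp(2)[OF f] F_supp(2)[OF g] by auto
    show ?thesis
    proof (cases "opr a b")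
      case None
      then show ?thesis using \<omega>[OF S] by (simp add: alg_scale_mult)
    next
      case (Some c)
      have "c \<in> X" using ab Some by (force simp: X_def)
      have "(\<Sum>s\<in>X. alg_scale (if opr a b = Some s then f a * g b else 0) (\<omega> s)) =
          (\<Sum>s\<in>X. if c = s then alg_scale (f a * g b) (\<omega> s) else 0)"
        using Some by (intro sum.cong) auto
      also have "\<dots> = alg_scale (f a * g b) (\<omega> c)"
        using X(1) \<open>c \<in> X\<close> by (simp add: sum.delta)
      finally show ?thesis using \<omega>[OF S] Some by (simp add: alg_scale_mult mult.commute)
    qed
  qed
  have "ev \<omega> (f \<otimes>\<^bsub>F\<^esub> g) = (\<Sum>s\<in>X. alg_scale ((f \<otimes>\<^bsub>F\<^esub> g) s) (\<omega> s))"
    using X by (rule ev_superset)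
  also have "\<dots> = (\<Sum>s\<in>X. \<Sum>a\<in>?A. \<Sum>b\<in>?B. alg_scale (if opr a b = Some s then f a * g b else 0) (\<omega> s))"
    by (simp add: F_mult_sum[OF f g fin(1) order_refl fin(2) order_refl] alg.scale_sum_left)
  also have "\<dots> = (\<Sum>a\<in>?A. \<Sum>b\<in>?B. \<Sum>s\<in>X. alg_scale (if opr a b = Some s then f a * g b else 0) (\<omega> s))"
    by (subst sum.swap, rule sum.cong[OF refl], subst sum.swap, rule refl)
  also have "\<dots> = (\<Sum>a\<in>?A. \<Sum>b\<in>?B. alg_scale (f a) (\<omega> a) * alg_scale (g b) (\<omega> b))"
    using term_eq by (intro sum.cong refl) auto
  also have "\<dots> = ev \<omega> f * ev \<omega> g"
    by (simp add: ev_def sum_product)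
  finally show ?thesis .
qed

text \<open>Only basis elements in the support of f are added. Keeping f s nonzero among the
  hypotheses lets a vanishing condition on f restrict which s can occur.\<close>

lemma F_decompose_induct [consumes 1, case_names zero add]:
  assumes "f \<in> carrier F" and "P (\<lambda>s. 0)"
    and "\<And>r s g. \<lbrakk>r \<in> zloc p; s \<in> S; f s \<noteq> 0; g \<in> carrier F; P g\<rbrakk> \<Longrightarrow>
      P (\<lambda>t. r * basis_elem (zloc_ring p) s t + g t)"
  shows "P f"
proof -
  have "P (\<lambda>t. if t \<in> A then f t else 0)" if "A \<subseteq> supp f" for A
    using finite_subset[OF that F_supp(1)[OF assms(1)]] that
  proof (induction A rule: finite_induct)
    case empty
    then show ?case using assms(2) by simp
  next
    case (insert s A)
    let ?g = "\<lambda>t. if t \<in> A then f t else 0"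
    have "?g \<in> carrier F"
      using insert F_supp[OF assms(1)] prime_p finite_subset[of _ A] by (auto simp: F_carrier)
    then have "P (\<lambda>t. f s * basis_elem (zloc_ring p) s t + ?g t)"
      using insert F_supp(2,3)[OF assms(1)] by (intro assms(3)) auto
    also have "(\<lambda>t. f s * basis_elem (zloc_ring p) s t + ?g t) = (\<lambda>t. if t \<in> insert s A then f t else 0)"
      using insert by (auto simp: basis_elem_def)
    finally show ?case .
  qed
  moreover have "(\<lambda>t. if t \<in> supp f then f t else 0) = f" by auto
  ultimately show ?thesis using order_refl by metis
qed

end

text \<open>As for the arrows of a category: on each side exactly one identity composes with a given
  element, so the sum over E acts as a unit.\<close>

locale free_assoc_alg = free_alg +
  assumes opr_assoc: "\<lbrakk>a \<in> S; b \<in> S; c \<in> S\<rbrakk> \<Longrightarrow>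
      Option.bind (opr a b) (\<lambda>x. opr x c) = Option.bind (opr b c) (opr a)"
    and opr_one_left: "a \<in> S \<Longrightarrow> \<exists>!x. x \<in> E \<and> opr x a \<noteq> None"
      "\<lbrakk>a \<in> S; x \<in> E; opr x a \<noteq> None\<rbrakk> \<Longrightarrow> opr x a = Some a"
    and opr_one_right: "a \<in> S \<Longrightarrow> \<exists>!x. x \<in> E \<and> opr a x \<noteq> None"
      "\<lbrakk>a \<in> S; x \<in> E; opr a x \<noteq> None\<rbrakk> \<Longrightarrow> opr a x = Some a"
begin

lemma F_mult_one:
  assumes f: "f \<in> carrier F"
  shows "\<one>\<^bsub>F\<^esub> \<otimes>\<^bsub>F\<^esub> f = f" "f \<otimes>\<^bsub>F\<^esub> \<one>\<^bsub>F\<^esub> = f"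
proof -
  note fin = F_supp(1)[OF f]
  show "\<one>\<^bsub>F\<^esub> \<otimes>\<^bsub>F\<^esub> f = f"
  proof
    fix s
    have "(\<Sum>x\<in>E. if opr x b = Some s then f b else 0) = (if b = s then f b else 0)"
      if b: "b \<in> supp f" for b
    proof -
      have bS: "b \<in> S" using b F_supp(2)[OF f] by auto
      obtain x where x: "x \<in> E" "opr x b = Some b" "\<And>y. \<lbrakk>y \<in> E; y \<noteq> x\<rbrakk> \<Longrightarrow> opr y b = None"
        using opr_one_left[OF bS] by metis
      have "(\<Sum>y\<in>E. if opr y b = Some s then f b else 0) =
          (\<Sum>y\<in>E. if x = y then (if b = s then f b else 0) else 0)"
        using x by (intro sum.cong refl) (metis option.inject option.distinct(1))
      then show ?thesis using x(1) E(2) by (simp add: sum.delta)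
    qed
    then have "(\<Sum>b\<in>supp f. \<Sum>x\<in>E. if opr x b = Some s then f b else 0) = (\<Sum>b\<in>supp f. if b = s then f b else 0)"
      by (intro sum.cong) auto
    also have "\<dots> = f s" using fin by (simp add: sum.delta')
    finally show "(\<one>\<^bsub>F\<^esub> \<otimes>\<^bsub>F\<^esub> f) s = f s"
      using F_mult_sum[OF F_one_closed f E(2) _ fin order_refl, of s] 
      by (subst (asm) sum.swap) (auto cong: if_cong sum.cong)
  qed
  show "f \<otimes>\<^bsub>F\<^esub> \<one>\<^bsub>F\<^esub> = f"
  proof
    fix s
    have "(\<Sum>x\<in>E. if opr b x = Some s then f b else 0) = (if b = s then f b else 0)"
      if b: "b \<in> supp f" for b
    proof -
      have bS: "b \<in> S" using b F_supp(2)[OF f] by auto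
      obtain x where x: "x \<in> E" "opr b x = Some b" "\<And>y. \<lbrakk>y \<in> E; y \<noteq> x\<rbrakk> \<Longrightarrow> opr b y = None"
        using opr_one_right[OF bS] by metis
      have "(\<Sum>y\<in>E. if opr b y = Some s then f b else 0) =
          (\<Sum>y\<in>E. if x = y then (if b = s then f b else 0) else 0)"
        using x by (intro sum.cong refl) (metis option.inject option.distinct(1))
      then show ?thesis using x(1) E(2) by (simp add: sum.delta)
    qed
    then have "(\<Sum>b\<in>supp f. \<Sum>x\<in>E. if opr b x = Some s then f b else 0) = (\<Sum>b\<in>supp f. if b = s then f b else 0)"
      by (intro sum.cong) auto
    also have "\<dots> = f s" using fin by (simp add: sum.delta')
    finally show "(f \<otimes>\<^bsub>F\<^esub> \<one>\<^bsub>F\<^esub>) s = f s"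
      using F_mult_sum[OF f F_one_closed fin order_refl E(2), of s] by (auto cong: if_cong sum.cong)
  qed
qed

lemma F_mult_assoc:
  assumes f: "f \<in> carrier F" and g: "g \<in> carrier F" and h: "h \<in> carrier F"
  shows "f \<otimes>\<^bsub>F\<^esub> g \<otimes>\<^bsub>F\<^esub> h = f \<otimes>\<^bsub>F\<^esub> (g \<otimes>\<^bsub>F\<^esub> h)"
proof
  fix s
  let ?A = "supp f" and ?B = "supp g" and ?C = "supp h"
  note fin = F_supp(1)[OF f] F_supp(1)[OF g] F_supp(1)[OF h]
  \<comment> \<open>X and Y collect the intermediate products. Once they are summed out, each
    bracketing becomes a sum over triples (a, b, c), and associativity of the partial operation
    identifies the two.\<close>
  define X where "X = (\<lambda>(a, b). the (opr a b)) ` {(a, b) \<in> ?A \<times> ?B. opr a b \<noteq> None}"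
  define Y where "Y = (\<lambda>(a, b). the (opr a b)) ` {(a, b) \<in> ?B \<times> ?C. opr a b \<noteq> None}"
  have X: "finite X" "supp (f \<otimes>\<^bsub>F\<^esub> g) \<subseteq> X"
    unfolding X_def using F_supp_mult[OF f g] F_supp_mult_finite[OF f g] by auto
  have Y: "finite Y" "supp (g \<otimes>\<^bsub>F\<^esub> h) \<subseteq> Y"
    unfolding Y_def using F_supp_mult[OF g h] F_supp_mult_finite[OF g h] by auto
  have sumX: "(\<Sum>x\<in>X. if opr x c = Some s then (if opr a b = Some x then r else 0) * h c else 0) =
      (if Option.bind (opr a b) (\<lambda>x. opr x c) = Some s then r * h c else 0)"
    if "a \<in> ?A" "b \<in> ?B" for a b c and r :: rat
  proof (cases "opr a b")
    case (Some y)
    then have "y \<in> X" using that by (force simp: X_def)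
    moreover have "(if opr x c = Some s then (if opr a b = Some x then r else 0) * h c else 0) =
        (if y = x then (if opr y c = Some s then r * h c else 0) else 0)" for x
      using Some by auto
    ultimately show ?thesis
      using X(1) Some by (simp add: sum.delta)
  qed (auto intro!: sum.neutral)
  have sumY: "(\<Sum>x\<in>Y. if opr a x = Some s then f a * (if opr b c = Some x then r else 0) else 0) =
      (if Option.bind (opr b c) (opr a) = Some s then f a * r else 0)"
    if "b \<in> ?B" "c \<in> ?C" for a b c and r :: rat
  proof (cases "opr b c")
    case (Some y)
    then have "y \<in> Y" using that by (force simp: Y_def)
    moreover have "(if opr a x = Some s then f a * (if opr b c = Some x then r else 0) else 0) =
        (if y = x then (if opr a y = Some s then f a * r else 0) else 0)" for x
      using Some by auto
    ultimately show ?thesis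
      using Y(1) Some by (simp add: sum.delta)
  qed (auto intro!: sum.neutral)
  have if_sum: "(if Q then (\<Sum>i\<in>I. u i) * k else 0) = (\<Sum>i\<in>I. if Q then u i * k else 0)"
    "(if Q then k * (\<Sum>i\<in>I. u i) else 0) = (\<Sum>i\<in>I. if Q then k * u i else 0)"
    for Q and u :: "'b \<Rightarrow> rat" and k I by (simp_all add: sum_distrib_right sum_distrib_left)
  have "(f \<otimes>\<^bsub>F\<^esub> g \<otimes>\<^bsub>F\<^esub> h) s =
      (\<Sum>x\<in>X. \<Sum>c\<in>?C. if opr x c = Some s then (f \<otimes>\<^bsub>F\<^esub> g) x * h c else 0)"
    by (rule F_mult_sum[OF F_mult_closed[OF f g] h X fin(3) order_refl])
  also have "\<dots> = (\<Sum>x\<in>X. \<Sum>c\<in>?C. \<Sum>a\<in>?A. \<Sum>b\<in>?B.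
      if opr x c = Some s then (if opr a b = Some x then f a * g b else 0) * h c else 0)"
    by (simp only: F_mult_sum[OF f g fin(1) order_refl fin(2) order_refl] if_sum)
  also have "\<dots> = (\<Sum>a\<in>?A. \<Sum>b\<in>?B. \<Sum>c\<in>?C. \<Sum>x\<in>X.
      if opr x c = Some s then (if opr a b = Some x then f a * g b else 0) * h c else 0)"
    by (simp only: sum.swap[of _ _ X] sum.swap[of _ ?B ?C] sum.swap[of _ ?A ?C])
  also have "\<dots> = (\<Sum>a\<in>?A. \<Sum>b\<in>?B. \<Sum>c\<in>?C.
      if Option.bind (opr a b) (\<lambda>x. opr x c) = Some s then f a * g b * h c else 0)"
    by (intro sum.cong refl sumX)
  also have "\<dots> = (\<Sum>a\<in>?A. \<Sum>b\<in>?B. \<Sum>c\<in>?C.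
      if Option.bind (opr b c) (opr a) = Some s then f a * (g b * h c) else 0)"
    using F_supp(2)[OF f] F_supp(2)[OF g] F_supp(2)[OF h] opr_assoc
    by (intro sum.cong refl) (auto simp: subset_iff)
  also have "\<dots> = (\<Sum>a\<in>?A. \<Sum>b\<in>?B. \<Sum>c\<in>?C. \<Sum>x\<in>Y.
      if opr a x = Some s then f a * (if opr b c = Some x then g b * h c else 0) else 0)"
    by (intro sum.cong refl sumY[symmetric])
  also have "\<dots> = (\<Sum>a\<in>?A. \<Sum>x\<in>Y. \<Sum>b\<in>?B. \<Sum>c\<in>?C.
      if opr a x = Some s then f a * (if opr b c = Some x then g b * h c else 0) else 0)"
    by (simp only: sum.swap[of _ ?C Y] sum.swap[of _ ?B Y])
  also have "\<dots> = (\<Sum>a\<in>?A. \<Sum>x\<in>Y. if opr a x = Some s then f a * (g \<otimes>\<^bsub>F\<^esub> h) x else 0)"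
    by (simp only: F_mult_sum[OF g h fin(2) order_refl fin(3) order_refl] if_sum)
  also have "\<dots> = (f \<otimes>\<^bsub>F\<^esub> (g \<otimes>\<^bsub>F\<^esub> h)) s"
    by (rule F_mult_sum[OF f F_mult_closed[OF g h] fin(1) order_refl Y, symmetric])
  finally show "(f \<otimes>\<^bsub>F\<^esub> g \<otimes>\<^bsub>F\<^esub> h) s = (f \<otimes>\<^bsub>F\<^esub> (g \<otimes>\<^bsub>F\<^esub> h)) s" .
qed

lemma F_ring: "Ring.ring F"
proof (rule ringI)
  show "abelian_group F" by (rule F_abelian_group)
  show "Group.monoid F"
    by (intro monoidI) (use F_mult_closed F_one_closed F_mult_one F_mult_assoc in \<open>auto simp del: F_sel\<close>)
  fix f g h assume fgh: "f \<in> carrier F" "g \<in> carrier F" "h \<in> carrier F"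
  define A where "A = supp f \<union> supp g \<union> supp h"
  have A: "finite A" "supp f \<subseteq> A" "supp g \<subseteq> A" "supp h \<subseteq> A" "supp (\<lambda>s. f s + g s) \<subseteq> A"
    using fgh by (auto simp: A_def F_carrier)
  note cl = F_closed(1)[OF fgh(1,2)]
  show "(f \<oplus>\<^bsub>F\<^esub> g) \<otimes>\<^bsub>F\<^esub> h = f \<otimes>\<^bsub>F\<^esub> h \<oplus>\<^bsub>F\<^esub> g \<otimes>\<^bsub>F\<^esub> h"
    using F_mult_sum[OF cl fgh(3) A(1,5,1,4)] F_mult_sum[OF fgh(1,3) A(1,2,1,4)]
      F_mult_sum[OF fgh(2,3) A(1,3,1,4)]
    by (auto simp: fun_eq_iff distrib_right simp flip: sum.distrib intro!: sum.cong)
  show "h \<otimes>\<^bsub>F\<^esub> (f \<oplus>\<^bsub>F\<^esub> g) = h \<otimes>\<^bsub>F\<^esub> f \<oplus>\<^bsub>F\<^esub> h \<otimes>\<^bsub>F\<^esub> g"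
    using F_mult_sum[OF fgh(3) cl A(1,4,1,5)] F_mult_sum[OF fgh(3,1) A(1,4,1,2)]
      F_mult_sum[OF fgh(3,2) A(1,4,1,3)]
    by (auto simp: fun_eq_iff distrib_left simp flip: sum.distrib intro!: sum.cong)
qed

end

section \<open>The order and its corner\<close>

lemma prime_3_nat: "prime (3::nat)" by simp

definition threes :: "rat set" where "threes = (*) 3 ` zloc 3"

lemma threes_closed [simp]:
  "0 \<in> threes" "\<lbrakk>x \<in> threes; y \<in> threes\<rbrakk> \<Longrightarrow> x + y \<in> threes" "x \<in> threes \<Longrightarrow> - x \<in> threes"
  "\<lbrakk>x \<in> threes; y \<in> threes\<rbrakk> \<Longrightarrow> x - y \<in> threes"
  "\<lbrakk>x \<in> threes; r \<in> zloc 3\<rbrakk> \<Longrightarrow> x * r \<in> threes" "\<lbrakk>x \<in> threes; r \<in> zloc 3\<rbrakk> \<Longrightarrow> r * x \<in> threes"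
  "r \<in> zloc 3 \<Longrightarrow> 3 * r \<in> threes"
proof -
  have iff: "x \<in> threes \<longleftrightarrow> x / 3 \<in> zloc 3" for x
    unfolding threes_def by (auto intro: image_eqI[of _ _ "x / 3"])
  show "0 \<in> threes" "\<lbrakk>x \<in> threes; y \<in> threes\<rbrakk> \<Longrightarrow> x + y \<in> threes" "x \<in> threes \<Longrightarrow> - x \<in> threes"
    "\<lbrakk>x \<in> threes; y \<in> threes\<rbrakk> \<Longrightarrow> x - y \<in> threes" "r \<in> zloc 3 \<Longrightarrow> 3 * r \<in> threes"
    by (simp_all add: iff add_divide_distrib diff_divide_distrib)
  assume "x \<in> threes" "r \<in> zloc 3"
  then have "x / 3 * r \<in> zloc 3" by (intro zloc_mult) (simp_all add: iff)
  then show "x * r \<in> threes" "r * x \<in> threes" by (simp_all add: iff mult.commute)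
qed

lemma threes_zloc [simp]: "x \<in> threes \<Longrightarrow> x \<in> zloc 3"
  unfolding threes_def by auto

lemma Lam3_iff: "x \<in> Lam3 \<longleftrightarrow>
     (\<forall>i j. b11 x $ i $ j \<in> zloc 3) \<and> (\<forall>i. b14 x $ i \<in> zloc 3) \<and>
     b22 x \<in> zloc 3 \<and> b24 x \<in> zloc 3 \<and> b33 x \<in> zloc 3 \<and>
     (\<forall>i. b41 x $ i \<in> threes) \<and> b42 x \<in> zloc 3 \<and>
     cst (b44 x) \<in> zloc 3 \<and> eta_part (b44 x) \<in> threes \<and> xi_part (b44 x) \<in> zloc 3"
  by (simp add: Lam3_def threes_def)

text \<open>Takes care of the coefficient -12 of eta in alpha_{4,2,4}: the congruence on the
  eta-part survives multiplication and also holds for the value of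
  \<open>tau3 * tau4\<close>.\<close>

lemma threes_12: "r \<in> zloc 3 \<Longrightarrow> r * 12 \<in> threes"
  using threes_closed(7)[of "4 * r"] by (simp add: mult.commute)

lemma Lam3_closed:
  "0 \<in> Lam3" "1 \<in> Lam3" "\<lbrakk>x \<in> Lam3; y \<in> Lam3\<rbrakk> \<Longrightarrow> x + y \<in> Lam3"
  "x \<in> Lam3 \<Longrightarrow> - x \<in> Lam3" "\<lbrakk>x \<in> Lam3; y \<in> Lam3\<rbrakk> \<Longrightarrow> x * y \<in> Lam3"
  "\<lbrakk>r \<in> zloc 3; x \<in> Lam3\<rbrakk> \<Longrightarrow> alg_scale r x \<in> Lam3"
proof -
  show "x * y \<in> Lam3" if "x \<in> Lam3" "y \<in> Lam3"
    using that by (simp add: Lam3_iff alg_ops block_ops qex_ops numeral_qex sum_3 threes_12)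
qed (simp_all add: Lam3_iff alg_ops alg_scale_def qex_ops mat_def)

text \<open>Serves for the order, with unit 1, and for its corner, whose unit is
  \<open>e_corner\<close>.\<close>

definition sub_alg :: "alg set \<Rightarrow> alg \<Rightarrow> (rat, alg) module" where
  "sub_alg L e = \<lparr>carrier = L, mult = (*), one = e, zero = 0, add = (+), smult = alg_scale\<rparr>"

lemma sub_alg_sel [simp]:
  "carrier (sub_alg L e) = L" "mult (sub_alg L e) = (*)" "one (sub_alg L e) = e"
  "zero (sub_alg L e) = 0" "add (sub_alg L e) = (+)" "smult (sub_alg L e) = alg_scale"
  by (simp_all add: sub_alg_def)

lemma r_algebra_sub_alg:
  assumes "0 \<in> L" "e \<in> L" "\<And>x y. \<lbrakk>x \<in> L; y \<in> L\<rbrakk> \<Longrightarrow> x + y \<in> L" "\<And>x. x \<in> L \<Longrightarrow> - x \<in> L"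
    "\<And>x y. \<lbrakk>x \<in> L; y \<in> L\<rbrakk> \<Longrightarrow> x * y \<in> L" "\<And>r x. \<lbrakk>r \<in> zloc 3; x \<in> L\<rbrakk> \<Longrightarrow> alg_scale r x \<in> L"
    "\<And>x. x \<in> L \<Longrightarrow> e * x = x \<and> x * e = x"
  shows "r_algebra (zloc_ring 3) (sub_alg L e)"
proof -
  have ab: "abelian_group (sub_alg L e)"
    using assms by (intro abelian_groupI) (auto simp: add.assoc add.commute intro: bexI[of _ "- _"])
  have "Module.module (zloc_ring 3) (sub_alg L e)"
    using assms ab by (intro moduleI cring_zloc_ring prime_3_nat)
      (auto simp: alg.scale_left_distrib alg.scale_right_distrib)
  moreover have "Ring.ring (sub_alg L e)"
    using assms ab by (intro ringI monoidI) (auto simp: mult.assoc distrib_left distrib_right)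
  ultimately show ?thesis
    by (simp add: r_algebra_def alg_scale_mult)
qed

lemma r_algebra_ring: "r_algebra R A \<Longrightarrow> Ring.ring A"
  by (simp add: r_algebra_def)

lemma Lam3_algebra: "r_algebra (zloc_ring 3) (sub_alg Lam3 1)"
  by (rule r_algebra_sub_alg) (simp_all add: Lam3_closed)

definition e_corner :: alg where "e_corner = e3 + e4 + e5 + e6"

lemmas alg_calc = alg_eq_iff alg_ops block_ops qex_ops numeral_qex sum_3 forall_3 axis_def

lemmas elem_defs = e3_def e4_def e5_def e6_def tau1_def tau2_def tau3_def tau4_def

lemma e_corner_idem: "e_corner * e_corner = e_corner"
  by (simp add: e_corner_def elem_defs alg_calc)

lemma elems_Lam3: "e3 \<in> Lam3" "e4 \<in> Lam3" "e5 \<in> Lam3" "e6 \<in> Lam3"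
  "tau1 \<in> Lam3" "tau2 \<in> Lam3" "tau3 \<in> Lam3" "tau4 \<in> Lam3"
  using threes_closed(7)[of 1] by (simp_all add: Lam3_iff elem_defs axis_def qex_ops)

lemma e_corner_Lam3: "e_corner \<in> Lam3"
  by (simp add: e_corner_def Lam3_closed elems_Lam3)

lemma Lam3'_eq: "Lam3' = sub_alg {x \<in> Lam3. e_corner * x = x \<and> x * e_corner = x} e_corner"
proof -
  have "(\<lambda>x. e_corner * x * e_corner) ` Lam3 = {x \<in> Lam3. e_corner * x = x \<and> x * e_corner = x}"
  proof safe
    fix x assume "x \<in> Lam3" "e_corner * x = x" "x * e_corner = x"
    then show "x \<in> (\<lambda>x. e_corner * x * e_corner) ` Lam3"
      by (intro image_eqI[of _ _ x]) simp_all
  next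
    fix x
    show "e_corner * (e_corner * x * e_corner) = e_corner * x * e_corner"
      by (simp only: mult.assoc[symmetric] e_corner_idem)
    show "e_corner * x * e_corner * e_corner = e_corner * x * e_corner"
      by (simp only: mult.assoc e_corner_idem)
  qed (simp add: Lam3_closed e_corner_Lam3)
  then show ?thesis
    by (simp add: Lam3'_def sub_alg_def Let_def e_corner_def)
qed

lemma Lam3'_algebra: "r_algebra (zloc_ring 3) Lam3'"
  unfolding Lam3'_eq
  by (rule r_algebra_sub_alg)
    (auto simp: Lam3_closed e_corner_Lam3 e_corner_idem distrib_left distrib_right alg_scale_mult
      simp flip: mult.assoc, simp_all add: mult.assoc)

lemma Lam3'_sel [simp]: "mult Lam3' = (*)" "one Lam3' = e_corner" "zero Lam3' = 0" "add Lam3' = (+)"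
  "smult Lam3' = alg_scale"
  by (simp_all add: Lam3'_eq)

lemma Lam3'_carrier: "x \<in> carrier Lam3' \<longleftrightarrow> x \<in> Lam3 \<and> e_corner * x = x \<and> x * e_corner = x"
  by (simp add: Lam3'_eq)

text \<open>Multiplication by \<open>e_corner\<close> from both sides kills the first two rows and
  columns of the array and nothing else.\<close>

lemma Lam3'_mem: "x \<in> carrier Lam3' \<longleftrightarrow> x \<in> Lam3 \<and>
  (\<forall>i j. (i \<noteq> 3 \<or> j \<noteq> 3) \<longrightarrow> b11 x $ i $ j = 0) \<and> (\<forall>i. i \<noteq> 3 \<longrightarrow> b14 x $ i = 0) \<and> (\<forall>i. i \<noteq> 3 \<longrightarrow> b41 x $ i = 0)"
  unfolding Lam3'_carrier
  by (auto simp add: e_corner_def elem_defs alg_calc)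

section \<open>The path algebra\<close>

abbreviation cas :: "psi_vertex \<Rightarrow> psi_arrow list \<Rightarrow> psi_vertex \<Rightarrow> bool" where
  "cas \<equiv> pre_digraph.cas Psi"

lemmas cas_simps [simp] = pre_digraph.cas.simps[of Psi]

lemma Psi_sel [simp]:
  "tail Psi T1 = V6" "tail Psi T2 = V3" "tail Psi T3 = V6" "tail Psi T4 = V4"
  "head Psi T1 = V3" "head Psi T2 = V6" "head Psi T3 = V4" "head Psi T4 = V6"
  by (simp_all add: Psi_def)

lemma paths_Psi: "(u, q, v) \<in> paths Psi \<longleftrightarrow> cas u q v"
  by (simp add: paths_def pre_digraph.awalk_def Psi_def)

lemma cas_append: "cas u q v \<Longrightarrow> cas v r w \<Longrightarrow> cas u (q @ r) w"
  by (induction q arbitrary: u) auto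

lemma cas_append_iff: "cas u (q @ r) w \<longleftrightarrow> (\<exists>v. cas u q v \<and> cas v r w)"
  by (induction q arbitrary: u) auto

lemma path_comp_Some:
  "path_comp a b = Some c \<longleftrightarrow> snd (snd a) = fst b \<and> c = (fst a, fst (snd a) @ fst (snd b), snd (snd b))"
  by (cases a; cases b; auto)

lemma path_comp_None: "path_comp a b = None \<longleftrightarrow> snd (snd a) \<noteq> fst b"
  by (cases a; cases b; auto)

interpretation path: free_assoc_alg 3 "paths Psi" path_comp "range (\<lambda>v. (v, [], v))"
proof unfold_locales
  show "prime (3::nat)" by simp
  show "c \<in> paths Psi" if "a \<in> paths Psi" "b \<in> paths Psi" "path_comp a b = Some c" for a b c
    using that by (cases a; cases b; cases c; auto simp: paths_Psi cas_append split: if_splits)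
  show "range (\<lambda>v. (v, [], v)) \<subseteq> paths Psi" by (auto simp: paths_Psi)
  have "UNIV = {V3, V4, V5, V6}" using psi_vertex.exhaust by auto
  then show "finite (range (\<lambda>v :: psi_vertex. (v, [], v)))" by (metis finite.emptyI finite.insertI finite_imageI)
  show "Option.bind (path_comp a b) (\<lambda>x. path_comp x c) = Option.bind (path_comp b c) (path_comp a)" for a b c
    by (cases a; cases b; cases c) auto
  show "\<exists>!x. x \<in> range (\<lambda>v. (v, [], v)) \<and> path_comp x a \<noteq> None" for a
    by (auto simp: path_comp_None)
  show "\<exists>!x. x \<in> range (\<lambda>v. (v, [], v)) \<and> path_comp a x \<noteq> None" for a
    by (auto simp: path_comp_None)
qed (auto simp: path_comp_None path_comp_Some prod_eq_iff split: if_splits)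

abbreviation PA :: "(rat, psi_vertex \<times> psi_arrow list \<times> psi_vertex \<Rightarrow> rat) module" where
  "PA \<equiv> path_algebra (zloc_ring 3) Psi"

lemma PA_eq: "PA = path.F"
  by (simp add: path_algebra_def Psi_def)

fun vertex_val :: "psi_vertex \<Rightarrow> alg" where
  "vertex_val V3 = e3" | "vertex_val V4 = e4" | "vertex_val V5 = e5" | "vertex_val V6 = e6"

fun arrow_val :: "psi_arrow \<Rightarrow> alg" where
  "arrow_val T1 = tau1" | "arrow_val T2 = tau2" | "arrow_val T3 = tau3" | "arrow_val T4 = tau4"

text \<open>The factor for the start vertex gives the trivial paths their value; on longer paths it
  is absorbed by the first arrow.\<close>

fun path_val :: "psi_vertex \<times> psi_arrow list \<times> psi_vertex \<Rightarrow> alg" where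
  "path_val (u, q, v) = vertex_val u * prod_list (map arrow_val q)"

lemma vertex_val_mult: "vertex_val u * vertex_val v = (if u = v then vertex_val u else 0)"
  by (cases u; cases v; simp add: elem_defs alg_calc)

lemma arrow_val_ends:
  "vertex_val (tail Psi a) * arrow_val a = arrow_val a" "arrow_val a * vertex_val (head Psi a) = arrow_val a"
  by (cases a; simp add: Psi_def elem_defs alg_calc)+

lemma path_val_end: "cas u q v \<Longrightarrow> path_val (u, q, v) * vertex_val v = path_val (u, q, v)"
proof (induction q arbitrary: u)
  case Nil
  then show ?case by (simp add: vertex_val_mult)
next
  case (Cons a q)
  then have "path_val (head Psi a, q, v) * vertex_val v = path_val (head Psi a, q, v)" by simp
  moreover have "path_val (u, a # q, v) = arrow_val a * path_val (head Psi a, q, v)"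
    using Cons by (auto simp: arrow_val_ends simp flip: mult.assoc)
  ultimately show ?case by (simp only: mult.assoc)
qed

text \<open>The value of a may be multiplied by the idempotent of its end vertex. It then meets the
  idempotent at the start of b, and vertex idempotents are orthogonal.\<close>

lemma path_val_mult:
  assumes "a \<in> paths Psi" "b \<in> paths Psi"
  shows "path_val a * path_val b = (case path_comp a b of None \<Rightarrow> 0 | Some c \<Rightarrow> path_val c)"
proof -
  obtain u q v where a: "a = (u, q, v)" by (cases a)
  obtain v' r w where b: "b = (v', r, w)" by (cases b)
  have av: "path_val a * vertex_val v = path_val a"
    using path_val_end[of u q v] assms(1) by (simp only: a paths_Psi)
  have "path_val a * path_val b = path_val a * vertex_val v * (vertex_val v' * prod_list (map arrow_val r))"
    unfolding av by (simp add: b)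
  also have "\<dots> = path_val a * (vertex_val v * vertex_val v') * prod_list (map arrow_val r)"
    by (simp only: mult.assoc)
  finally have *: "path_val a * path_val b =
    path_val a * (vertex_val v * vertex_val v') * prod_list (map arrow_val r)" .
  show ?thesis
  proof (cases "v = v'")
    case True
    then have "path_val a * path_val b = path_val a * prod_list (map arrow_val r)"
      using av unfolding * by (simp add: vertex_val_mult)
    then show ?thesis using True by (simp add: a b mult.assoc)
  next
    case False
    then show ?thesis unfolding * by (simp add: vertex_val_mult a b)
  qed
qed

definition good_paths :: "(psi_vertex \<times> psi_arrow list \<times> psi_vertex) set" where
  "good_paths = {(V3, [], V3), (V4, [], V4), (V5, [], V5), (V6, [], V6), (V6, [T1], V3), (V3, [T2], V6),
     (V6, [T3], V4), (V4, [T4], V6), (V6, [T1, T2], V6), (V6, [T3, T4], V6)}"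

definition zero_pairs :: "(psi_arrow \<times> psi_arrow) set" where
  "zero_pairs = {(T4, T3), (T2, T1), (T4, T1), (T2, T3)}"

text \<open>T2 and T4 end at V6, where only T1 and T3 start, and all four of these compositions are
  generators of I. A walk with three arrows must pass through such a composition, so walks that
  avoid them have length at most two.\<close>

lemma path_cases:
  assumes "cas u q v"
  obtains "(u, q, v) \<in> good_paths"
  | q1 a b q2 where "q = q1 @ [a, b] @ q2" "(a, b) \<in> zero_pairs"
proof (cases q)
  case Nil
  then show ?thesis using assms that(1) by (cases u) (auto simp: good_paths_def)
next
  case q: (Cons a q')
  show ?thesis
  proof (cases q')
    case Nil
    then show ?thesis
      using assms that(1) q by (cases a) (auto simp: good_paths_def)
  next
    case q': (Cons b q'')
    show ?thesis
    proof (cases "(a, b) \<in> zero_pairs")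
      case True
      then show ?thesis using that(2)[of "[]" a b q''] q q' by simp
    next
      case False
      then have ab: "(a, b) = (T1, T2) \<or> (a, b) = (T3, T4)"
        using assms q q' by (cases a; cases b) (auto simp: zero_pairs_def)
      show ?thesis
      proof (cases q'')
        case Nil
        then show ?thesis using assms that(1) q q' ab by (auto simp: good_paths_def)
      next
        case q'': (Cons c q''')
        then have "(b, c) \<in> zero_pairs"
          using assms q q' ab by (cases c) (auto simp: zero_pairs_def)
        then show ?thesis using that(2)[of "[a]" b c q'''] q q' q'' by simp
      qed
    qed
  qed
qed

lemma good_paths_sub: "good_paths \<subseteq> paths Psi"
  by (auto simp: good_paths_def paths_Psi)

lemma zero_pairs_val: "(a, b) \<in> zero_pairs \<Longrightarrow> arrow_val a * arrow_val b = 0"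
  by (auto simp: zero_pairs_def elem_defs alg_calc)

lemma path_val_bad:
  assumes "s \<in> paths Psi" "s \<notin> good_paths" shows "path_val s = 0"
proof -
  obtain u q v where s: "s = (u, q, v)" by (cases s)
  then have "cas u q v" using assms paths_Psi by simp
  then show ?thesis
  proof (cases rule: path_cases)
    case (2 q1 a b q2)
    have "path_val s = vertex_val u * prod_list (map arrow_val q1) *
        (arrow_val a * arrow_val b) * prod_list (map arrow_val q2)"
      by (simp add: s 2(1) mult.assoc)
    then show ?thesis by (simp add: zero_pairs_val[OF 2(2)])
  qed (use assms s in auto)
qed

abbreviation pev :: "(psi_vertex \<times> psi_arrow list \<times> psi_vertex \<Rightarrow> rat) \<Rightarrow> alg" where
  "pev \<equiv> path.ev path_val"

lemma tau12: "tau1 * tau2 = Alg 0 0 0 0 0 0 0 (QEX 0 3 0)"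
  by (simp add: elem_defs alg_calc)

lemma tau34: "tau3 * tau4 = Alg 0 0 0 0 0 0 0 (QEX 0 (- 12) 1)"
  by (simp add: elem_defs alg_calc)

text \<open>Only the ten good paths contribute. The entries display the independence of their
  values: the eta-part is the only one that mixes two coefficients, and one of these is also the
  xi-part.\<close>

lemma pev_eq:
  assumes "f \<in> carrier path.F"
  shows "pev f = Alg
     (\<chi> i j. if i = 3 \<and> j = 3 then f (V3, [], V3) else 0) (axis 3 (f (V3, [T2], V6)))
     (f (V4, [], V4)) (f (V4, [T4], V6)) (f (V5, [], V5)) (axis 3 (3 * f (V6, [T1], V3)))
     (f (V6, [T3], V4))
     (QEX (f (V6, [], V6)) (3 * f (V6, [T1, T2], V6) - 12 * f (V6, [T3, T4], V6)) (f (V6, [T3, T4], V6)))"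
proof -
  have fin: "finite (path.supp f \<union> good_paths)"
    using path.F_supp(1)[OF assms] by (simp add: good_paths_def)
  have "alg_scale (f s) (path_val s) = 0" if "s \<in> path.supp f \<union> good_paths - good_paths" for s
  proof -
    have "s \<in> paths Psi" using that path.F_supp(2)[OF assms] by blast
    then show ?thesis using that path_val_bad[of s] by simp
  qed
  then have "pev f = (\<Sum>s\<in>good_paths. alg_scale (f s) (path_val s))"
    by (subst path.ev_superset[OF fin Un_upper1], intro sum.mono_neutral_right[OF fin Un_upper2] ballI)
  also have "\<dots> = Alg
     (\<chi> i j. if i = 3 \<and> j = 3 then f (V3, [], V3) else 0) (axis 3 (f (V3, [T2], V6)))
     (f (V4, [], V4)) (f (V4, [T4], V6)) (f (V5, [], V5)) (axis 3 (3 * f (V6, [T1], V3)))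
     (f (V6, [T3], V4))
     (QEX (f (V6, [], V6)) (3 * f (V6, [T1, T2], V6) - 12 * f (V6, [T3, T4], V6)) (f (V6, [T3, T4], V6)))"
    unfolding good_paths_def
    by (simp add: tau12 tau34 alg_scale_def elem_defs alg_calc)
  finally show ?thesis .
qed

lemma pev_zero:
  assumes "f \<in> carrier path.F" "pev f = 0" "s \<in> good_paths"
  shows "f s = 0"
  using assms(2,3) unfolding pev_eq[OF assms(1)]
  by (auto simp: good_paths_def alg_calc)

lemma pev_image: "pev ` carrier path.F = carrier Lam3'"
proof
  show "pev ` carrier path.F \<subseteq> carrier Lam3'"
  proof clarify
    fix f assume f: "f \<in> carrier path.F"
    then have "f s \<in> zloc 3" for s by (rule path.F_supp(3))
    then show "pev f \<in> carrier Lam3'"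
      using threes_12[of "f (V6, [T3, T4], V6)"]
      by (simp add: Lam3'_mem pev_eq[OF f] Lam3_iff axis_def mult.commute)
  qed
  show "carrier Lam3' \<subseteq> pev ` carrier path.F"
  proof
    fix x assume "x \<in> carrier Lam3'"
    then have x: "x \<in> Lam3" "\<And>i j. (i \<noteq> 3 \<or> j \<noteq> 3) \<Longrightarrow> b11 x $ i $ j = 0"
      "\<And>i. i \<noteq> 3 \<Longrightarrow> b14 x $ i = 0" "\<And>i. i \<noteq> 3 \<Longrightarrow> b41 x $ i = 0"
      by (simp_all add: Lam3'_mem)
    have "b41 x $ 3 \<in> (*) 3 ` zloc 3" "eta_part (b44 x) \<in> (*) 3 ` zloc 3"
      using x(1) by (simp_all add: Lam3_def)
    then obtain x3 z2 where x3: "x3 \<in> zloc 3" "b41 x $ 3 = 3 * x3"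
      and z2: "z2 \<in> zloc 3" "eta_part (b44 x) = 3 * z2" by blast
    \<comment> \<open>\<open>T1 T2\<close> has the value 3 eta and \<open>T3 T4\<close> the value xi
      - 12 eta. The summand \<open>4 * xi_part\<close> in the coefficient of \<open>T1 T2\<close>
      compensates the -12.\<close>
    define f :: "psi_vertex \<times> psi_arrow list \<times> psi_vertex \<Rightarrow> rat" where "f = (\<lambda>_. 0)
      ((V3, [], V3) := b11 x $ 3 $ 3, (V4, [], V4) := b22 x, (V5, [], V5) := b33 x,
       (V6, [], V6) := cst (b44 x), (V6, [T1], V3) := x3, (V3, [T2], V6) := b14 x $ 3,
       (V6, [T3], V4) := b42 x, (V4, [T4], V6) := b24 x,
       (V6, [T1, T2], V6) := z2 + 4 * xi_part (b44 x), (V6, [T3, T4], V6) := xi_part (b44 x))"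
    have "path.supp f \<subseteq> good_paths"
      by (auto simp: f_def good_paths_def split: if_splits)
    moreover have "finite good_paths" by (simp add: good_paths_def)
    moreover have "f s \<in> zloc 3" for s
      using x(1) x3(1) z2(1) by (auto simp: f_def Lam3_iff)
    ultimately have f: "f \<in> carrier path.F"
      using good_paths_sub finite_subset by (auto simp: path.F_carrier)
    have "pev f = x"
      unfolding pev_eq[OF f]
      using x x3 z2 by (auto simp: f_def alg_calc)
    then show "x \<in> pev ` carrier path.F" using f by blast
  qed
qed

interpretation pres: ring_presentation path.F Lam3' pev
proof (intro ring_presentation.intro ring_presentation_axioms.intro)
  show "abelian_group path.F" by (rule path.F_abelian_group)
  show "Ring.ring Lam3'" by (rule r_algebra_ring[OF Lam3'_algebra])
  show "pev ` carrier path.F = carrier Lam3'" by (rule pev_image)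
  have "range (\<lambda>v. (v, [], v)) = {(V3, [] :: psi_arrow list, V3), (V4, [], V4), (V5, [], V5), (V6, [], V6)}"
    using psi_vertex.exhaust by auto
  then show "pev \<one>\<^bsub>path.F\<^esub> = \<one>\<^bsub>Lam3'\<^esub>"
    unfolding path.ev_one by (simp add: e_corner_def add.assoc)
qed (simp_all add: path.ev_add path.F_mult_closed path.ev_mult path_val_mult path.F_one_closed del: path.F_sel(4))

lemma basis_elem_mult:
  assumes "a \<in> paths Psi" "b \<in> paths Psi" "path_comp a b = Some c"
  shows "basis_elem (zloc_ring 3) a \<otimes>\<^bsub>path.F\<^esub> basis_elem (zloc_ring 3) b = basis_elem (zloc_ring 3) c"
proof
  fix s
  have "(basis_elem (zloc_ring 3) a \<otimes>\<^bsub>path.F\<^esub> basis_elem (zloc_ring 3) b) s =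
      (\<Sum>x\<in>{a}. \<Sum>y\<in>{b}. if path_comp x y = Some s
        then basis_elem (zloc_ring 3) a x * basis_elem (zloc_ring 3) b y else 0)"
    by (intro path.F_mult_sum path.basis_elem_closed assms) (auto simp: basis_elem_def)
  then show "(basis_elem (zloc_ring 3) a \<otimes>\<^bsub>path.F\<^esub> basis_elem (zloc_ring 3) b) s = basis_elem (zloc_ring 3) c s"
    using assms(3) by (auto simp: basis_elem_def)
qed

text \<open>For the harder inclusion: an element of the kernel vanishes on the good paths, so its
  support consists of paths containing a zero pair, and each of these lies in every ideal that
  contains the generators.\<close>

lemma Psi_ideal_eq: "Psi_ideal (zloc_ring 3) = pres.Ker"
proof -
  let ?t = "arrow_elem (zloc_ring 3) Psi"
  let ?G = "{?t T4 \<otimes>\<^bsub>path.F\<^esub> ?t T3, ?t T2 \<otimes>\<^bsub>path.F\<^esub> ?t T1, ?t T4 \<otimes>\<^bsub>path.F\<^esub> ?t T1, ?t T2 \<otimes>\<^bsub>path.F\<^esub> ?t T3}"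
  have t_prod: "?t a \<otimes>\<^bsub>path.F\<^esub> ?t b = basis_elem (zloc_ring 3) (tail Psi a, [a, b], head Psi b)"
    if "(a, b) \<in> zero_pairs" for a b
    unfolding arrow_elem_def
    using that by (intro basis_elem_mult) (auto simp: paths_Psi zero_pairs_def)
  have G: "?G = (\<lambda>(a, b). basis_elem (zloc_ring 3) (tail Psi a, [a, b], head Psi b)) ` zero_pairs"
    using t_prod by (simp add: zero_pairs_def)
  have hom: "pev \<in> ring_hom path.F Lam3'"
    by (intro ring_hom_memI) (use pres.h_closed pres.h_mult pres.h_add pres.h_one in auto)
  have "ideal pres.Ker path.F"
    using ring_hom_ring.kernel_is_ideal[OF ring_hom_ringI2[OF path.F_ring r_algebra_ring[OF Lam3'_algebra] hom]]
    by (simp add: a_kernel_def' pres.fib_def)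
  moreover have "?G \<subseteq> pres.Ker"
  proof -
    have "basis_elem (zloc_ring 3) (tail Psi a, [a, b], head Psi b) \<in> pres.Ker" if "(a, b) \<in> zero_pairs" for a b
    proof -
      have "(tail Psi a, [a, b], head Psi b) \<in> paths Psi"
        using that by (auto simp: paths_Psi zero_pairs_def)
      then show ?thesis
        using zero_pairs_val[OF that] by (simp add: pres.fib_def path.basis_elem_closed path.ev_basis_elem)
    qed
    then show ?thesis unfolding G by auto
  qed
  moreover have "pres.Ker \<subseteq> J" if J: "ideal J path.F" and GJ: "?G \<subseteq> J" for J
  proof
    interpret J: ideal J path.F by (rule J)
    fix f assume "f \<in> pres.Ker"
    then have f: "f \<in> carrier path.F" "pev f = 0" by (auto simp: pres.fib_def)
    \<comment> \<open>Such a path is a product of three paths, the middle one being a generator of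
      the ideal.\<close>
    have bad: "basis_elem (zloc_ring 3) s \<in> J" if s: "s \<in> paths Psi" "s \<notin> good_paths" for s
    proof -
      obtain u q v where uqv: "s = (u, q, v)" by (cases s)
      then have "cas u q v" using s paths_Psi by simp
      then show ?thesis
      proof (cases rule: path_cases)
        case (2 q1 a b q2)
        let ?b = "basis_elem (zloc_ring 3)"
        have cas: "cas u q1 (tail Psi a)" "cas (head Psi b) q2 v" "cas (tail Psi a) [a, b] (head Psi b)"
          using \<open>cas u q v\<close> 2(1) by (auto simp: cas_append_iff)
        have ab: "?b (tail Psi a, [a, b], head Psi b) \<in> J"
          using GJ 2(2) unfolding G by (auto simp: image_subset_iff)
        have "?b (u, q1 @ [a, b], head Psi b) =
            ?b (u, q1, tail Psi a) \<otimes>\<^bsub>path.F\<^esub> ?b (tail Psi a, [a, b], head Psi b)"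
          using cas by (intro basis_elem_mult[symmetric]) (auto simp: paths_Psi)
        also have "\<dots> \<in> J"
          using cas(1) by (intro J.I_l_closed ab path.basis_elem_closed) (simp add: paths_Psi)
        finally have "?b (u, q1 @ [a, b], head Psi b) \<in> J" .
        moreover have "?b s = ?b (u, q1 @ [a, b], head Psi b) \<otimes>\<^bsub>path.F\<^esub> ?b (head Psi b, q2, v)"
          unfolding uqv 2(1)
          using cas by (intro basis_elem_mult[symmetric]) (auto simp: paths_Psi cas_append_iff)
        ultimately show ?thesis
          using cas(2) by (simp add: J.I_r_closed path.basis_elem_closed paths_Psi)
      qed (use s uqv in auto)
    qed
    have good: "f s = 0" if "s \<in> good_paths" for s by (rule pev_zero[OF f that])
    from f(1) show "f \<in> J"
    proof (induction rule: path.F_decompose_induct)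
      case zero
      show ?case using J.zero_closed by simp
    next
      case (add r s g)
      \<comment> \<open>A ring ideal absorbs ring elements, not scalars, so the scalar r is
        represented by r times the unit.\<close>
      have one: "(\<lambda>t. r * \<one>\<^bsub>path.F\<^esub> t) \<in> carrier path.F"
        using add(1) by (intro path.F_closed path.F_one_closed)
      have "s \<notin> good_paths" using add(3) good[of s] by blast
      then have bs: "basis_elem (zloc_ring 3) s \<in> J" using bad add(2) by simp
      have bc: "basis_elem (zloc_ring 3) s \<in> carrier path.F" by (rule path.basis_elem_closed[OF add(2)])
      have "(\<lambda>t. r * \<one>\<^bsub>path.F\<^esub> t) \<otimes>\<^bsub>path.F\<^esub> basis_elem (zloc_ring 3) s \<in> J"
        by (rule J.I_l_closed[OF bs one])
      then have "(\<lambda>t. r * basis_elem (zloc_ring 3) s t) \<in> J"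
        unfolding path.F_scale_mult[OF add(1) path.F_one_closed bc] path.F_mult_one(1)[OF bc] .
      from J.a_closed[OF this add(5)] show ?case by simp
    qed
  qed
  ultimately have "genideal path.F ?G = pres.Ker"
    unfolding genideal_def by blast
  then show ?thesis
    by (simp add: Psi_ideal_def Let_def PA_eq)
qed

text \<open>The map is onto, so each axiom for Q is the image of the same axiom for T.\<close>

lemma r_algebra_iso_transfer:
  assumes T: "r_algebra R T" and Q: "Ring.ring Q" and \<phi>: "\<phi> \<in> ring_iso T Q"
    and smult: "\<And>r x. \<lbrakk>r \<in> carrier R; x \<in> carrier T\<rbrakk> \<Longrightarrow> \<phi> (r \<odot>\<^bsub>T\<^esub> x) = r \<odot>\<^bsub>Q\<^esub> \<phi> x"
  shows "\<phi> \<in> r_algebra_iso R T Q"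
proof -
  interpret T: Module.module R T using T by (simp add: r_algebra_def)
  interpret Tr: Ring.ring T using T by (simp add: r_algebra_def)
  interpret Q: Ring.ring Q by (rule Q)
  note hom = ring_iso_memE[OF \<phi>]
  have onto: "\<exists>x\<in>carrier T. y = \<phi> x" if "y \<in> carrier Q" for y
    using hom(5) that by (auto simp: bij_betw_def)
  have "Module.module R Q"
  proof (intro moduleI)
    show "cring R" using T by (auto simp: r_algebra_def dest: Module.module.axioms(1))
    show "abelian_group Q" by (rule Q.abelian_group_axioms)
  next
    fix a x assume a: "a \<in> carrier R" and "x \<in> carrier Q"
    then obtain x' where x: "x' \<in> carrier T" "x = \<phi> x'" using onto by blast
    show "a \<odot>\<^bsub>Q\<^esub> x \<in> carrier Q" using a x hom(1) by (simp flip: smult)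
  next
    fix a b x assume ab: "a \<in> carrier R" "b \<in> carrier R" and "x \<in> carrier Q"
    then obtain x' where x: "x' \<in> carrier T" "x = \<phi> x'" using onto by blast
    show "(a \<oplus>\<^bsub>R\<^esub> b) \<odot>\<^bsub>Q\<^esub> x = a \<odot>\<^bsub>Q\<^esub> x \<oplus>\<^bsub>Q\<^esub> b \<odot>\<^bsub>Q\<^esub> x"
      and "(a \<otimes>\<^bsub>R\<^esub> b) \<odot>\<^bsub>Q\<^esub> x = a \<odot>\<^bsub>Q\<^esub> (b \<odot>\<^bsub>Q\<^esub> x)"
      using ab x by (simp_all add: T.smult_l_distr T.smult_assoc1 flip: smult hom(3))
  next
    fix a x y assume a: "a \<in> carrier R" and "x \<in> carrier Q" "y \<in> carrier Q"
    then obtain x' y' where x: "x' \<in> carrier T" "x = \<phi> x'" and y: "y' \<in> carrier T" "y = \<phi> y'"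
      using onto by blast
    show "a \<odot>\<^bsub>Q\<^esub> (x \<oplus>\<^bsub>Q\<^esub> y) = a \<odot>\<^bsub>Q\<^esub> x \<oplus>\<^bsub>Q\<^esub> a \<odot>\<^bsub>Q\<^esub> y"
      using a x y by (simp add: T.smult_r_distr flip: smult hom(3))
  next
    fix x assume "x \<in> carrier Q"
    then obtain x' where x: "x' \<in> carrier T" "x = \<phi> x'" using onto by blast
    show "\<one>\<^bsub>R\<^esub> \<odot>\<^bsub>Q\<^esub> x = x" using x by (simp flip: smult)
  qed
  moreover have "(r \<odot>\<^bsub>Q\<^esub> x) \<otimes>\<^bsub>Q\<^esub> y = r \<odot>\<^bsub>Q\<^esub> (x \<otimes>\<^bsub>Q\<^esub> y) \<and> x \<otimes>\<^bsub>Q\<^esub> (r \<odot>\<^bsub>Q\<^esub> y) = r \<odot>\<^bsub>Q\<^esub> (x \<otimes>\<^bsub>Q\<^esub> y)"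
    if r: "r \<in> carrier R" and xQ: "x \<in> carrier Q" and yQ: "y \<in> carrier Q" for r x y
  proof -
    obtain x' y' where x: "x' \<in> carrier T" "x = \<phi> x'" and y: "y' \<in> carrier T" "y = \<phi> y'"
      using onto[OF xQ] onto[OF yQ] by blast
    have "(r \<odot>\<^bsub>T\<^esub> x') \<otimes>\<^bsub>T\<^esub> y' = r \<odot>\<^bsub>T\<^esub> (x' \<otimes>\<^bsub>T\<^esub> y')" "x' \<otimes>\<^bsub>T\<^esub> (r \<odot>\<^bsub>T\<^esub> y') = r \<odot>\<^bsub>T\<^esub> (x' \<otimes>\<^bsub>T\<^esub> y')"
      using r x(1) y(1) T by (simp_all add: r_algebra_def)
    moreover have "(r \<odot>\<^bsub>Q\<^esub> x) \<otimes>\<^bsub>Q\<^esub> y = \<phi> ((r \<odot>\<^bsub>T\<^esub> x') \<otimes>\<^bsub>T\<^esub> y')" "x \<otimes>\<^bsub>Q\<^esub> (r \<odot>\<^bsub>Q\<^esub> y) = \<phi> (x' \<otimes>\<^bsub>T\<^esub> (r \<odot>\<^bsub>T\<^esub> y'))"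
      "r \<odot>\<^bsub>Q\<^esub> (x \<otimes>\<^bsub>Q\<^esub> y) = \<phi> (r \<odot>\<^bsub>T\<^esub> (x' \<otimes>\<^bsub>T\<^esub> y'))"
      using r x(1) y(1) by (simp_all only: x(2) y(2) smult hom(2) T.smult_closed Tr.m_closed)
    ultimately show ?thesis by simp
  qed
  ultimately have "r_algebra R Q" using Q by (simp add: r_algebra_def)
  then show ?thesis using T \<phi> smult by (simp add: r_algebra_iso_def)
qed

lemma Lam3'_iso_path_algebra:
  fixes I defines "I \<equiv> Psi_ideal (zloc_ring 3)"
  shows "\<exists>\<phi> \<in> r_algebra_iso (zloc_ring 3) Lam3' (quot_algebra PA I).
            \<phi> e3 = I +>\<^bsub>PA\<^esub> vertex_elem (zloc_ring 3) V3 \<and>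
            \<phi> e4 = I +>\<^bsub>PA\<^esub> vertex_elem (zloc_ring 3) V4 \<and>
            \<phi> e5 = I +>\<^bsub>PA\<^esub> vertex_elem (zloc_ring 3) V5 \<and>
            \<phi> e6 = I +>\<^bsub>PA\<^esub> vertex_elem (zloc_ring 3) V6 \<and>
            \<phi> tau1 = I +>\<^bsub>PA\<^esub> arrow_elem (zloc_ring 3) Psi T1 \<and>
            \<phi> tau2 = I +>\<^bsub>PA\<^esub> arrow_elem (zloc_ring 3) Psi T2 \<and>
            \<phi> tau3 = I +>\<^bsub>PA\<^esub> arrow_elem (zloc_ring 3) Psi T3 \<and>
            \<phi> tau4 = I +>\<^bsub>PA\<^esub> arrow_elem (zloc_ring 3) Psi T4"
proof (rule bexI[of _ pres.fib])
  have coset: "pres.fib (path_val s) = I +>\<^bsub>PA\<^esub> basis_elem (zloc_ring 3) s" if "s \<in> paths Psi" for s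
    using pres.coset_eq_fib[OF path.basis_elem_closed[OF that]]
    by (simp add: I_def Psi_ideal_eq PA_eq path.ev_basis_elem)
  have vertex: "pres.fib (vertex_val v) = I +>\<^bsub>PA\<^esub> vertex_elem (zloc_ring 3) v" for v
    using coset[of "(v, [], v)"] by (simp add: vertex_elem_def paths_Psi)
  have arrow: "pres.fib (arrow_val a) = I +>\<^bsub>PA\<^esub> arrow_elem (zloc_ring 3) Psi a" for a
    using coset[of "(tail Psi a, [a], head Psi a)"]
    by (simp add: arrow_elem_def paths_Psi arrow_val_ends(1))
  show "pres.fib e3 = I +>\<^bsub>PA\<^esub> vertex_elem (zloc_ring 3) V3 \<and>
            pres.fib e4 = I +>\<^bsub>PA\<^esub> vertex_elem (zloc_ring 3) V4 \<and>
            pres.fib e5 = I +>\<^bsub>PA\<^esub> vertex_elem (zloc_ring 3) V5 \<and>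
            pres.fib e6 = I +>\<^bsub>PA\<^esub> vertex_elem (zloc_ring 3) V6 \<and>
            pres.fib tau1 = I +>\<^bsub>PA\<^esub> arrow_elem (zloc_ring 3) Psi T1 \<and>
            pres.fib tau2 = I +>\<^bsub>PA\<^esub> arrow_elem (zloc_ring 3) Psi T2 \<and>
            pres.fib tau3 = I +>\<^bsub>PA\<^esub> arrow_elem (zloc_ring 3) Psi T3 \<and>
            pres.fib tau4 = I +>\<^bsub>PA\<^esub> arrow_elem (zloc_ring 3) Psi T4"
    using vertex[of V3] vertex[of V4] vertex[of V5] vertex[of V6] arrow[of T1] arrow[of T2] arrow[of T3] arrow[of T4]
    by simp
  have "pres.fib \<in> r_algebra_iso (zloc_ring 3) Lam3' (quot_algebra path.F pres.Ker)"
  proof (rule r_algebra_iso_transfer[OF Lam3'_algebra pres.quot_is_ring pres.fib_iso])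
    fix r x assume "r \<in> carrier (zloc_ring 3)" "x \<in> carrier Lam3'"
    then show "pres.fib (r \<odot>\<^bsub>Lam3'\<^esub> x) = r \<odot>\<^bsub>quot_algebra path.F pres.Ker\<^esub> pres.fib x"
      using pres.fib_smult[of r "alg_scale r" x] by (simp add: path.F_closed path.ev_scale)
  qed
  then show "pres.fib \<in> r_algebra_iso (zloc_ring 3) Lam3' (quot_algebra PA I)"
    by (simp add: I_def Psi_ideal_eq PA_eq)
qed

section \<open>Bisets and stabilizers\<close>

definition stab :: "('g, 'k) monoid_scheme \<Rightarrow> ('g, 'm) biset \<Rightarrow> 'm \<Rightarrow> ('g \<times> 'g) set" where
  "stab G M m = {(g, h). g \<in> carrier G \<and> h \<in> carrier G \<and> lact M g m = ract M m h}"

text \<open>The stabilizer of p m q when L is that of m: the first coordinate is conjugated by p,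
  the second by the inverse of q.\<close>

definition conj_rel :: "('g, 'k) monoid_scheme \<Rightarrow> 'g \<Rightarrow> 'g \<Rightarrow> ('g \<times> 'g) set \<Rightarrow> ('g \<times> 'g) set" where
  "conj_rel G p q L = {(x, y). x \<in> carrier G \<and> y \<in> carrier G \<and>
     (inv\<^bsub>G\<^esub> p \<otimes>\<^bsub>G\<^esub> x \<otimes>\<^bsub>G\<^esub> p, q \<otimes>\<^bsub>G\<^esub> y \<otimes>\<^bsub>G\<^esub> inv\<^bsub>G\<^esub> q) \<in> L}"

text \<open>For finite G a submonoid of G x G is a subgroup, so closure under products
  suffices.\<close>

definition subgroup_rel :: "('g, 'k) monoid_scheme \<Rightarrow> ('g \<times> 'g) set \<Rightarrow> bool" where
  "subgroup_rel G L \<longleftrightarrow> L \<subseteq> carrier G \<times> carrier G \<and> (\<one>\<^bsub>G\<^esub>, \<one>\<^bsub>G\<^esub>) \<in> L \<and>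
     (\<forall>a b c d. (a, b) \<in> L \<longrightarrow> (c, d) \<in> L \<longrightarrow> (a \<otimes>\<^bsub>G\<^esub> c, b \<otimes>\<^bsub>G\<^esub> d) \<in> L)"

text \<open>For L = stab m and L' = stab n this is the stabilizer of (m, n) under the action g(m, n)
  = (m g^{-1}, g n) whose orbits form the tensor product.\<close>

definition middle :: "('g, 'k) monoid_scheme \<Rightarrow> ('g \<times> 'g) set \<Rightarrow> ('g \<times> 'g) set \<Rightarrow> 'g set" where
  "middle G L L' = {h. (\<one>\<^bsub>G\<^esub>, h) \<in> L \<and> (h, \<one>\<^bsub>G\<^esub>) \<in> L'}"

definition mark_sum :: "('g, 'k) monoid_scheme \<Rightarrow> (('g \<times> 'g) set \<Rightarrow> alg) \<Rightarrow> ('g, 'm) biset \<Rightarrow> alg" where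
  "mark_sum G w M = (\<Sum>m\<in>bset M. w (stab G M m))"

definition two_orbit :: "('g, 'k) monoid_scheme \<Rightarrow> ('g, 'm) biset \<Rightarrow> 'm \<Rightarrow> 'm set" where
  "two_orbit G M m = (\<lambda>(a, b). ract M (lact M a m) b) ` (carrier G \<times> carrier G)"

locale finite_group = Group.group G for G (structure) +
  assumes finite_carrier: "finite (carrier G)"
begin

lemma finite_bisetD:
  assumes "finite_biset G M"
  shows "finite (bset M)"
    and "m \<in> bset M \<Longrightarrow> lact M \<one> m = m" "m \<in> bset M \<Longrightarrow> ract M m \<one> = m"
    and "\<lbrakk>g \<in> carrier G; m \<in> bset M\<rbrakk> \<Longrightarrow> lact M g m \<in> bset M"
    and "\<lbrakk>g \<in> carrier G; m \<in> bset M\<rbrakk> \<Longrightarrow> ract M m g \<in> bset M"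
    and "\<lbrakk>g \<in> carrier G; h \<in> carrier G; m \<in> bset M\<rbrakk> \<Longrightarrow> lact M g (lact M h m) = lact M (g \<otimes> h) m"
    and "\<lbrakk>g \<in> carrier G; h \<in> carrier G; m \<in> bset M\<rbrakk> \<Longrightarrow> ract M (ract M m g) h = ract M m (g \<otimes> h)"
    and "\<lbrakk>g \<in> carrier G; h \<in> carrier G; m \<in> bset M\<rbrakk> \<Longrightarrow> ract M (lact M g m) h = lact M g (ract M m h)"
  using assms unfolding finite_biset_def by auto

lemma lact_cancel:
  assumes M: "finite_biset G M" and "g \<in> carrier G" "m \<in> bset M" "m' \<in> bset M"
  shows "lact M g m = lact M g m' \<longleftrightarrow> m = m'"
  using assms(2-) finite_bisetD[OF M] by (metis inv_closed l_inv)

lemma ract_cancel: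
  assumes M: "finite_biset G M" and "g \<in> carrier G" "m \<in> bset M" "m' \<in> bset M"
  shows "ract M m g = ract M m' g \<longleftrightarrow> m = m'"
  using assms(2-) finite_bisetD[OF M] by (metis inv_closed r_inv)

lemma two_sided_cancel:
  assumes M: "finite_biset G M" and "p \<in> carrier G" "q \<in> carrier G" "u \<in> bset M" "v \<in> bset M"
  shows "ract M (lact M p u) q = ract M (lact M p v) q \<longleftrightarrow> u = v"
  using assms finite_bisetD(4)[OF M] by (simp add: lact_cancel ract_cancel)

lemma subgroup_rel_stab:
  assumes M: "finite_biset G M" and m: "m \<in> bset M"
  shows "subgroup_rel G (stab G M m)"
proof -
  note D = finite_bisetD[OF M]
  have "lact M (a \<otimes> c) m = ract M m (b \<otimes> d)"
    if "a \<in> carrier G" "b \<in> carrier G" "c \<in> carrier G" "d \<in> carrier G"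
      "lact M a m = ract M m b" "lact M c m = ract M m d" for a b c d
    using that m D by (metis (no_types, lifting))
  then show ?thesis
    using m D(2,3) by (auto simp: subgroup_rel_def stab_def)
qed

lemma stab_two_sided:
  assumes M: "finite_biset G M" and m: "m \<in> bset M" and p: "p \<in> carrier G" and q: "q \<in> carrier G"
  shows "stab G M (ract M (lact M p m) q) = conj_rel G p q (stab G M m)"
proof -
  note D = finite_bisetD[OF M]
  have "lact M x (ract M (lact M p m) q) = ract M (ract M (lact M p m) q) y \<longleftrightarrow>
      lact M (inv p \<otimes> x \<otimes> p) m = ract M m (q \<otimes> y \<otimes> inv q)"
    if x: "x \<in> carrier G" and y: "y \<in> carrier G" for x y
  proof -
    have "lact M x (ract M (lact M p m) q) = ract M (lact M p (lact M (inv p \<otimes> x \<otimes> p) m)) q"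
      using m p q x D by (simp add: m_assoc[symmetric] r_inv)
    moreover have "ract M (ract M (lact M p m) q) y = ract M (lact M p (ract M m (q \<otimes> y \<otimes> inv q))) q"
      using m p q y D by (simp add: m_assoc l_inv)
    moreover have "lact M (inv p \<otimes> x \<otimes> p) m \<in> bset M" "ract M m (q \<otimes> y \<otimes> inv q) \<in> bset M"
      using m p q x y D(4,5) by simp_all
    ultimately show ?thesis
      by (simp only: two_sided_cancel[OF M p q])
  qed
  then show ?thesis
    using p q by (auto simp: stab_def conj_rel_def)
qed

lemma two_orbit_self: "\<lbrakk>finite_biset G M; m \<in> bset M\<rbrakk> \<Longrightarrow> m \<in> two_orbit G M m"
  unfolding two_orbit_def by (rule image_eqI[of _ _ "(\<one>, \<one>)"]) (simp_all add: finite_bisetD)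

lemma two_orbit_sub: "\<lbrakk>finite_biset G M; m \<in> bset M\<rbrakk> \<Longrightarrow> two_orbit G M m \<subseteq> bset M"
  unfolding two_orbit_def by (auto simp: finite_bisetD)

lemma two_orbit_closed:
  assumes M: "finite_biset G M" and m: "m \<in> bset M" and g: "g \<in> carrier G"
  shows "x \<in> bset M \<Longrightarrow> lact M g x \<in> two_orbit G M m \<longleftrightarrow> x \<in> two_orbit G M m"
    and "x \<in> bset M \<Longrightarrow> ract M x g \<in> two_orbit G M m \<longleftrightarrow> x \<in> two_orbit G M m"
proof -
  note D = finite_bisetD[OF M]
  have l: "lact M g x \<in> two_orbit G M m" if g: "g \<in> carrier G" and x: "x \<in> two_orbit G M m" for g x
  proof -
    obtain a b where ab: "a \<in> carrier G" "b \<in> carrier G" "x = ract M (lact M a m) b"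
      using x by (auto simp: two_orbit_def)
    then have "lact M g x = ract M (lact M (g \<otimes> a) m) b"
      using m g D by simp
    then show ?thesis
      using ab g unfolding two_orbit_def by (intro image_eqI[of _ _ "(g \<otimes> a, b)"]) auto
  qed
  have r: "ract M x g \<in> two_orbit G M m" if g: "g \<in> carrier G" and x: "x \<in> two_orbit G M m" for g x
  proof -
    obtain a b where ab: "a \<in> carrier G" "b \<in> carrier G" "x = ract M (lact M a m) b"
      using x by (auto simp: two_orbit_def)
    then have "ract M x g = ract M (lact M a m) (b \<otimes> g)"
      using m g D(4,7) by simp
    then show ?thesis
      using ab g unfolding two_orbit_def by (intro image_eqI[of _ _ "(a, b \<otimes> g)"]) auto
  qed
  have lx: "lact M (inv g) (lact M g x) = x" and rx: "ract M (ract M x g) (inv g) = x" if "x \<in> bset M"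
    using that g D(2,3,6,7) by simp_all
  show "lact M g x \<in> two_orbit G M m \<longleftrightarrow> x \<in> two_orbit G M m" if "x \<in> bset M"
    using l[OF inv_closed[OF g], of "lact M g x"] l[OF g, of x] lx[OF that] by auto
  show "ract M x g \<in> two_orbit G M m \<longleftrightarrow> x \<in> two_orbit G M m" if "x \<in> bset M"
    using r[OF inv_closed[OF g], of "ract M x g"] r[OF g, of x] rx[OF that] by auto
qed

subsection \<open>Isomorphism classes\<close>

lemma biset_isomorphic_sym:
  assumes M: "finite_biset G M" and "biset_isomorphic G M N"
  shows "biset_isomorphic G N M"
proof -
  obtain f where f: "bij_betw f (bset M) (bset N)"
    "\<And>g m. \<lbrakk>g \<in> carrier G; m \<in> bset M\<rbrakk> \<Longrightarrow> f (lact M g m) = lact N g (f m)"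
    "\<And>g m. \<lbrakk>g \<in> carrier G; m \<in> bset M\<rbrakk> \<Longrightarrow> f (ract M m g) = ract N (f m) g"
    using assms(2) unfolding biset_isomorphic_def by blast
  let ?h = "inv_into (bset M) f"
  note D = finite_bisetD[OF M]
  have h: "?h n \<in> bset M" "f (?h n) = n" if "n \<in> bset N" for n
    using f(1) that by (auto simp: bij_betw_def inv_into_into f_inv_into_f)
  have hf: "?h (f m) = m" if "m \<in> bset M" for m
    using f(1) that by (simp add: bij_betw_def)
  have "?h (lact N g n) = lact M g (?h n)" "?h (ract N n g) = ract M (?h n) g"
    if g: "g \<in> carrier G" and n: "n \<in> bset N" for g n
    using hf[OF D(4)[OF g h(1)[OF n]]] hf[OF D(5)[OF g h(1)[OF n]]] f(2,3)[OF g h(1)[OF n]] h(2)[OF n]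
    by simp_all
  then show ?thesis
    unfolding biset_isomorphic_def using bij_betw_inv_into[OF f(1)] by blast
qed

lemma biset_isomorphic_trans:
  assumes "biset_isomorphic G M N" "biset_isomorphic G N P"
  shows "biset_isomorphic G M P"
proof -
  obtain f where f: "bij_betw f (bset M) (bset N)"
    "\<And>g m. \<lbrakk>g \<in> carrier G; m \<in> bset M\<rbrakk> \<Longrightarrow> f (lact M g m) = lact N g (f m)"
    "\<And>g m. \<lbrakk>g \<in> carrier G; m \<in> bset M\<rbrakk> \<Longrightarrow> f (ract M m g) = ract N (f m) g"
    using assms(1) unfolding biset_isomorphic_def by blast
  obtain f' where f': "bij_betw f' (bset N) (bset P)"
    "\<And>g m. \<lbrakk>g \<in> carrier G; m \<in> bset N\<rbrakk> \<Longrightarrow> f' (lact N g m) = lact P g (f' m)"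
    "\<And>g m. \<lbrakk>g \<in> carrier G; m \<in> bset N\<rbrakk> \<Longrightarrow> f' (ract N m g) = ract P (f' m) g"
    using assms(2) unfolding biset_isomorphic_def by blast
  have "f m \<in> bset N" if "m \<in> bset M" for m using f(1) that by (rule bij_betw_apply)
  then show ?thesis
    unfolding biset_isomorphic_def using bij_betw_trans[OF f(1) f'(1)] f f'
    by (intro exI[of _ "f' \<circ> f"]) auto
qed

lemma finite_biset_nat_copy:
  assumes M: "finite_biset G M"
  obtains N :: "('a, nat) biset" where "finite_biset G N" "biset_isomorphic G M N"
proof -
  note D = finite_bisetD[OF M]
  obtain f :: "'c \<Rightarrow> nat" where f: "inj_on f (bset M)"
    using finite_imp_inj_to_nat_seg[OF D(1)] by blast
  let ?h = "inv_into (bset M) f"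
  have h: "?h (f m) = m" if "m \<in> bset M" for m using f that by simp
  define N where "N = \<lparr>bset = f ` bset M, lact = (\<lambda>g x. f (lact M g (?h x))), ract = (\<lambda>x g. f (ract M (?h x) g))\<rparr>"
  have "finite_biset G N"
    unfolding finite_biset_def using D by (auto simp: N_def h)
  moreover have "biset_isomorphic G M N"
    unfolding biset_isomorphic_def using f
    by (intro exI[of _ f]) (auto simp: N_def h bij_betw_def)
  ultimately show ?thesis by (rule that)
qed

lemma biset_class_eq:
  assumes "finite_biset G M" "finite_biset G N" "biset_isomorphic G M N"
  shows "biset_class G M = biset_class G N"
proof -
  have "biset_isomorphic G M P \<longleftrightarrow> biset_isomorphic G N P" for P :: "('a, nat) biset"
    using biset_isomorphic_trans[OF biset_isomorphic_sym[OF assms(1,3)], of P]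
      biset_isomorphic_trans[OF assms(3), of P] by blast
  then show ?thesis by (simp add: biset_class_def)
qed

lemma biset_class_nonempty: "finite_biset G M \<Longrightarrow> \<exists>P. P \<in> biset_class G M"
  by (rule finite_biset_nat_copy[of M]) (auto simp: biset_class_def)

lemma biset_class_in: "finite_biset G M \<Longrightarrow> biset_class G M \<in> biset_classes G"
proof -
  assume M: "finite_biset G M"
  obtain N :: "('a, nat) biset" where N: "finite_biset G N" "biset_isomorphic G M N"
    using finite_biset_nat_copy[OF M] by blast
  then show ?thesis using biset_class_eq[OF M N] by (auto simp: biset_classes_def)
qed

lemma stab_iso:
  assumes M: "finite_biset G M" and N: "finite_biset G N"
    and f: "bij_betw f (bset M) (bset N)"
      "\<And>g m. \<lbrakk>g \<in> carrier G; m \<in> bset M\<rbrakk> \<Longrightarrow> f (lact M g m) = lact N g (f m)"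
      "\<And>g m. \<lbrakk>g \<in> carrier G; m \<in> bset M\<rbrakk> \<Longrightarrow> f (ract M m g) = ract N (f m) g"
    and m: "m \<in> bset M"
  shows "stab G N (f m) = stab G M m"
proof -
  have "f (lact M g m) = f (ract M m h) \<longleftrightarrow> lact M g m = ract M m h"
    if "g \<in> carrier G" "h \<in> carrier G" for g h
    using that m f(1) finite_bisetD(4,5)[OF M] by (auto simp: bij_betw_def inj_on_eq_iff)
  then show ?thesis
    using f(2,3) m by (auto simp: stab_def)
qed

lemma mark_sum_iso:
  assumes M: "finite_biset G M" and N: "finite_biset G N" and "biset_isomorphic G M N"
  shows "mark_sum G w M = mark_sum G w N"
proof -
  obtain f where f: "bij_betw f (bset M) (bset N)"
    "\<And>g m. \<lbrakk>g \<in> carrier G; m \<in> bset M\<rbrakk> \<Longrightarrow> f (lact M g m) = lact N g (f m)"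
    "\<And>g m. \<lbrakk>g \<in> carrier G; m \<in> bset M\<rbrakk> \<Longrightarrow> f (ract M m g) = ract N (f m) g"
    using assms(3) unfolding biset_isomorphic_def by blast
  have "mark_sum G w N = (\<Sum>m\<in>bset M. w (stab G N (f m)))"
    unfolding mark_sum_def by (rule sum.reindex_bij_betw[OF f(1), symmetric])
  also have "\<dots> = mark_sum G w M"
    unfolding mark_sum_def by (intro sum.cong refl) (simp add: stab_iso[OF M N f])
  finally show ?thesis by simp
qed

lemma finite_biset_union:
  assumes "finite_biset G M" "finite_biset G N" shows "finite_biset G (biset_union M N)"
  using finite_bisetD[OF assms(1)] finite_bisetD[OF assms(2)]
  unfolding finite_biset_def by (auto simp: biset_union_def)

lemma mark_sum_union:
  assumes M: "finite_biset G M" and N: "finite_biset G N"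
  shows "mark_sum G w (biset_union M N) = mark_sum G w M + mark_sum G w N"
proof -
  have "stab G (biset_union M N) (Inl m) = stab G M m" "stab G (biset_union M N) (Inr n) = stab G N n" for m n
    by (auto simp: stab_def biset_union_def)
  then show ?thesis
    using finite_bisetD(1)[OF M] finite_bisetD(1)[OF N]
    by (simp add: mark_sum_def biset_union_def sum.Plus)
qed

definition sub_biset :: "('a, 'm) biset \<Rightarrow> 'm set \<Rightarrow> ('a, 'm) biset" where
  "sub_biset M X = M\<lparr>bset := X\<rparr>"

lemma finite_sub_biset:
  assumes M: "finite_biset G M" and X: "X \<subseteq> bset M"
    "\<And>g x. \<lbrakk>g \<in> carrier G; x \<in> X\<rbrakk> \<Longrightarrow> lact M g x \<in> X \<and> ract M x g \<in> X"
  shows "finite_biset G (sub_biset M X)"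
  using finite_bisetD[OF M] X finite_subset[OF X(1)]
  unfolding finite_biset_def by (auto simp: sub_biset_def subset_iff)

lemma biset_split:
  assumes X: "X \<subseteq> bset M"
    and "\<And>g x. \<lbrakk>g \<in> carrier G; x \<in> bset M\<rbrakk> \<Longrightarrow> lact M g x \<in> X \<longleftrightarrow> x \<in> X"
    and "\<And>g x. \<lbrakk>g \<in> carrier G; x \<in> bset M\<rbrakk> \<Longrightarrow> ract M x g \<in> X \<longleftrightarrow> x \<in> X"
  shows "biset_isomorphic G M (biset_union (sub_biset M X) (sub_biset M (bset M - X)))"
proof -
  let ?f = "\<lambda>x. if x \<in> X then Inl x else Inr x"
  have "bij_betw ?f (bset M) (X <+> (bset M - X))"
    using X by (auto simp: bij_betw_def inj_on_def image_iff split: if_splits)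
  then show ?thesis
    unfolding biset_isomorphic_def using assms(2,3)
    by (intro exI[of _ ?f]) (auto simp: biset_union_def sub_biset_def)
qed

lemma two_orbit_sub_biset: "two_orbit G (sub_biset M X) m = two_orbit G M m"
  by (simp add: two_orbit_def sub_biset_def)

subsection \<open>Transitive bisets\<close>

lemma two_sided_eq_iff:
  assumes M: "finite_biset G M" and m: "m \<in> bset M"
    and "a \<in> carrier G" "b \<in> carrier G" "a' \<in> carrier G" "b' \<in> carrier G"
  shows "ract M (lact M a m) b = ract M (lact M a' m) b' \<longleftrightarrow> (inv a' \<otimes> a, b' \<otimes> inv b) \<in> stab G M m"
proof -
  note D = finite_bisetD[OF M]
  have "ract M (lact M a m) b = ract M (lact M a' (lact M (inv a' \<otimes> a) m)) b"
    using assms(2-) D by (simp add: m_assoc[symmetric] r_inv)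
  moreover have "ract M (lact M a' m) b' = ract M (lact M a' (ract M m (b' \<otimes> inv b))) b"
    using assms(2-) D by (simp add: m_assoc l_inv)
  moreover have "lact M (inv a' \<otimes> a) m \<in> bset M" "ract M m (b' \<otimes> inv b) \<in> bset M"
    using assms(2-) D(4,5) by simp_all
  ultimately have "ract M (lact M a m) b = ract M (lact M a' m) b' \<longleftrightarrow>
      lact M (inv a' \<otimes> a) m = ract M m (b' \<otimes> inv b)"
    using assms(4,5) by (simp only: two_sided_cancel[OF M])
  then show ?thesis
    using assms(3-) by (simp add: stab_def)
qed

text \<open>The map sends a m b to a n b. Whether two pairs (a, b) yield the same point depends on
  the stabilizer alone, so the map is well defined and injective.\<close>

lemma transitive_isomorphic:
  assumes M: "finite_biset G M" and N: "finite_biset G N"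
    and m: "m \<in> bset M" "two_orbit G M m = bset M" and n: "n \<in> bset N" "two_orbit G N n = bset N"
    and stab: "stab G M m = stab G N n"
  shows "biset_isomorphic G M N"
proof -
  define loc where "loc x = (SOME q. q \<in> carrier G \<times> carrier G \<and> x = ract M (lact M (fst q) m) (snd q))" for x
  define f where "f x = ract N (lact N (fst (loc x)) n) (snd (loc x))" for x
  have loc: "loc x \<in> carrier G \<times> carrier G \<and> x = ract M (lact M (fst (loc x)) m) (snd (loc x))"
    if "x \<in> bset M" for x
  proof -
    obtain q where "q \<in> carrier G \<times> carrier G" "x = (\<lambda>(a, b). ract M (lact M a m) b) q"
      using \<open>x \<in> bset M\<close> unfolding m(2)[symmetric] two_orbit_def by blast
    then have "q \<in> carrier G \<times> carrier G \<and> x = ract M (lact M (fst q) m) (snd q)"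
      by (simp add: case_prod_beta)
    then show ?thesis unfolding loc_def by (rule someI)
  qed
  have f: "f (ract M (lact M a m) b) = ract N (lact N a n) b" if ab: "a \<in> carrier G" "b \<in> carrier G" for a b
  proof -
    let ?x = "ract M (lact M a m) b"
    have x: "?x \<in> bset M" using ab m(1) finite_bisetD[OF M] by simp
    have in_G: "fst (loc ?x) \<in> carrier G" "snd (loc ?x) \<in> carrier G" using loc[OF x] by auto
    have "ract M (lact M (fst (loc ?x)) m) (snd (loc ?x)) = ?x" using loc[OF x] by simp
    then show ?thesis
      unfolding f_def two_sided_eq_iff[OF M m(1) in_G ab] two_sided_eq_iff[OF N n(1) in_G ab] stab .
  qed
  have rep: "\<exists>a b. a \<in> carrier G \<and> b \<in> carrier G \<and> x = ract M (lact M a m) b" if "x \<in> bset M" for x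
    using loc[OF that] by (metis mem_Times_iff)
  have "inj_on f (bset M)"
  proof (rule inj_onI)
    fix x y assume xy: "x \<in> bset M" "y \<in> bset M" and eq: "f x = f y"
    obtain a b where ab: "a \<in> carrier G" "b \<in> carrier G" "x = ract M (lact M a m) b"
      using rep[OF xy(1)] by blast
    obtain c d where cd: "c \<in> carrier G" "d \<in> carrier G" "y = ract M (lact M c m) d"
      using rep[OF xy(2)] by blast
    show "x = y"
      using eq unfolding ab(3) cd(3) f[OF ab(1,2)] f[OF cd(1,2)]
        two_sided_eq_iff[OF M m(1) ab(1,2) cd(1,2)] two_sided_eq_iff[OF N n(1) ab(1,2) cd(1,2)] stab .
  qed
  moreover have "f ` bset M = bset N"
  proof -
    have "f ` bset M = (\<lambda>q. f (ract M (lact M (fst q) m) (snd q))) ` (carrier G \<times> carrier G)"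
      unfolding m(2)[symmetric] two_orbit_def by (simp add: image_image case_prod_beta)
    also have "\<dots> = (\<lambda>q. ract N (lact N (fst q) n) (snd q)) ` (carrier G \<times> carrier G)"
      by (intro image_cong refl) (auto simp: f)
    finally show ?thesis unfolding n(2)[symmetric] two_orbit_def by (simp add: case_prod_beta)
  qed
  moreover have "f (lact M g x) = lact N g (f x) \<and> f (ract M x g) = ract N (f x) g"
    if g: "g \<in> carrier G" and x: "x \<in> bset M" for g x
  proof -
    obtain a b where ab: "a \<in> carrier G" "b \<in> carrier G" "x = ract M (lact M a m) b"
      using rep[OF x] by blast
    have "lact M g x = ract M (lact M (g \<otimes> a) m) b" "ract M x g = ract M (lact M a m) (b \<otimes> g)"
      using ab g m(1) finite_bisetD[OF M] by simp_all
    moreover have "lact N g (ract N (lact N a n) b) = ract N (lact N (g \<otimes> a) n) b"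
      "ract N (ract N (lact N a n) b) g = ract N (lact N a n) (b \<otimes> g)"
      using ab g n(1) finite_bisetD[OF N] by simp_all
    ultimately show ?thesis using ab g f by simp
  qed
  ultimately show ?thesis unfolding biset_isomorphic_def bij_betw_def by blast
qed

lemma sum_uniform_fibres:
  fixes k :: nat
  assumes "finite A" "\<And>y. y \<in> f ` A \<Longrightarrow> card {x \<in> A. f x = y} = k"
  shows "card A = card (f ` A) * k"
proof -
  have "card A = (\<Sum>y\<in>f ` A. card {x \<in> A. f x = y})"
    using sum.image_gen[OF assms(1), of "\<lambda>_. 1::nat" f] by simp
  then show ?thesis using assms(2) by simp
qed

text \<open>Orbit-stabilizer: the pairs (c, d) with c m d = a m b correspond to the elements (a^{-1}
  c, b d^{-1}) of the stabilizer.\<close>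

lemma card_two_orbit:
  assumes M: "finite_biset G M" and m: "m \<in> bset M"
  shows "card (two_orbit G M m) * card (stab G M m) = card (carrier G) ^ 2"
proof -
  let ?f = "\<lambda>(a, b). ract M (lact M a m) b" and ?GG = "carrier G \<times> carrier G"
  have "card {q \<in> ?GG. ?f q = y} = card (stab G M m)" if y: "y \<in> ?f ` ?GG" for y
  proof -
    obtain a b where ab: "a \<in> carrier G" "b \<in> carrier G" "y = ract M (lact M a m) b" using y by auto
    have "bij_betw (\<lambda>(c, d). (inv a \<otimes> c, b \<otimes> inv d)) {q \<in> ?GG. ?f q = y} (stab G M m)"
    proof (rule bij_betw_byWitness[where f' = "\<lambda>(x, z). (a \<otimes> x, inv z \<otimes> b)"])
      show "\<forall>q\<in>{q \<in> ?GG. ?f q = y}.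
          (\<lambda>(x, z). (a \<otimes> x, inv z \<otimes> b)) ((\<lambda>(c, d). (inv a \<otimes> c, b \<otimes> inv d)) q) = q"
        using ab by (auto simp: m_assoc[symmetric] r_inv inv_mult_group) (simp add: m_assoc l_inv)
      show "\<forall>q\<in>stab G M m. (\<lambda>(c, d). (inv a \<otimes> c, b \<otimes> inv d)) ((\<lambda>(x, z). (a \<otimes> x, inv z \<otimes> b)) q) = q"
        using ab by (auto simp: stab_def m_assoc[symmetric] l_inv inv_mult_group r_inv)
      show "(\<lambda>(c, d). (inv a \<otimes> c, b \<otimes> inv d)) ` {q \<in> ?GG. ?f q = y} \<subseteq> stab G M m"
        using ab two_sided_eq_iff[OF M m _ _ ab(1,2)] by auto
      show "(\<lambda>(x, z). (a \<otimes> x, inv z \<otimes> b)) ` stab G M m \<subseteq> {q \<in> ?GG. ?f q = y}"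
      proof (rule image_subsetI)
        fix q assume "q \<in> stab G M m"
        then obtain x z where q: "q = (x, z)" and xz: "(x, z) \<in> stab G M m" by (cases q) auto
        then have G: "x \<in> carrier G" "z \<in> carrier G" by (auto simp: stab_def)
        have "(inv a \<otimes> (a \<otimes> x), b \<otimes> inv (inv z \<otimes> b)) = (x, z)"
          using ab G by (simp add: m_assoc[symmetric] l_inv inv_mult_group r_inv)
        then have "ract M (lact M (a \<otimes> x) m) (inv z \<otimes> b) = y"
          using two_sided_eq_iff[OF M m _ _ ab(1,2), of "a \<otimes> x" "inv z \<otimes> b"] ab G xz by simp
        then show "(case q of (x, z) \<Rightarrow> (a \<otimes> x, inv z \<otimes> b)) \<in> {q \<in> ?GG. ?f q = y}"
          using ab G q by simp
      qed
    qed
    then show ?thesis by (rule bij_betw_same_card)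
  qed
  then have "card ?GG = card (?f ` ?GG) * card (stab G M m)"
    using finite_carrier by (intro sum_uniform_fibres) auto
  then show ?thesis by (simp add: two_orbit_def card_cartesian_product power2_eq_square)
qed

text \<open>The points are the two-sided translates, inside G x G, of the set of all (x, y^{-1})
  with (x, y) in L. Inverting y makes multiplication on the right of the second coordinate a right
  action.\<close>

lemma exists_transitive:
  assumes L: "subgroup_rel G L"
  obtains T :: "('a, nat) biset" and t
  where "finite_biset G T" "t \<in> bset T" "two_orbit G T t = bset T" "stab G T t = L"
proof -
  have LG: "a \<in> carrier G" "b \<in> carrier G" if "(a, b) \<in> L" for a b
    using L that by (auto simp: subgroup_rel_def)
  have L1: "(\<one>, \<one>) \<in> L" and Lm: "\<And>a b c d. \<lbrakk>(a, b) \<in> L; (c, d) \<in> L\<rbrakk> \<Longrightarrow> (a \<otimes> c, b \<otimes> d) \<in> L"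
    using L by (auto simp: subgroup_rel_def)
  define base where "base = (\<lambda>(x, y). (x, inv y)) ` L"
  define tr where "tr a b X = (\<lambda>(x, y). (a \<otimes> x, y \<otimes> b)) ` X" for a b X
  define B where "B = \<lparr>bset = (\<lambda>(a, b). tr a b base) ` (carrier G \<times> carrier G),
    lact = (\<lambda>g. tr g \<one>), ract = (\<lambda>X g. tr \<one> g X)\<rparr>"
  have base_sub: "base \<subseteq> carrier G \<times> carrier G" using LG by (auto simp: base_def)
  have tr_sub: "tr a b X \<subseteq> carrier G \<times> carrier G"
    if "X \<subseteq> carrier G \<times> carrier G" "a \<in> carrier G" "b \<in> carrier G" for a b X
    using that by (auto simp: tr_def)
  have tr_tr: "tr a b (tr c d X) = tr (a \<otimes> c) (d \<otimes> b) X"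
    if "X \<subseteq> carrier G \<times> carrier G" "a \<in> carrier G" "b \<in> carrier G" "c \<in> carrier G" "d \<in> carrier G"
    for a b c d X
    unfolding tr_def image_image using that by (intro image_cong refl) (auto simp: m_assoc)
  have tr_one: "tr \<one> \<one> X = X" if "X \<subseteq> carrier G \<times> carrier G" for X
    unfolding tr_def using that by (force simp: image_iff)
  have Bsub: "X \<subseteq> carrier G \<times> carrier G" if "X \<in> bset B" for X
  proof -
    from that obtain a b where ab: "a \<in> carrier G" "b \<in> carrier G" "X = tr a b base"
      by (auto simp: B_def)
    then show ?thesis using tr_sub[OF base_sub ab(1,2)] by simp
  qed
  have Bcl: "tr g h X \<in> bset B" if X: "X \<in> bset B" and gh: "g \<in> carrier G" "h \<in> carrier G" for X g h
  proof -
    obtain a b where ab: "a \<in> carrier G" "b \<in> carrier G" "X = tr a b base" using X by (auto simp: B_def)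
    then have "tr g h X = tr (g \<otimes> a) (b \<otimes> h) base" using gh base_sub by (simp add: tr_tr)
    then show ?thesis
      using ab gh unfolding B_def by (auto intro!: image_eqI[of _ _ "(g \<otimes> a, b \<otimes> h)"])
  qed
  have "finite_biset G B"
    unfolding finite_biset_def
    using Bsub Bcl finite_carrier by (auto simp: B_def tr_one tr_tr)
  moreover have tB: "base \<in> bset B" using tr_one[OF base_sub] by (auto simp: B_def intro!: image_eqI[of _ _ "(\<one>, \<one>)"])
  moreover have "two_orbit G B base = bset B"
  proof -
    have "two_orbit G B base = (\<lambda>(a, b). tr a b base) ` (carrier G \<times> carrier G)"
      unfolding two_orbit_def using base_sub by (intro image_cong refl) (auto simp: B_def tr_tr)
    then show ?thesis by (simp add: B_def)
  qed
  moreover have "stab G B base = L"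
  proof -
    have eq_iff: "tr g \<one> base = tr \<one> h base \<longleftrightarrow> (g, h) \<in> L" if g: "g \<in> carrier G" and h: "h \<in> carrier G" for g h
    proof
      assume "tr g \<one> base = tr \<one> h base"
      moreover have "(g, \<one>) \<in> tr g \<one> base"
        using L1 g unfolding tr_def base_def by (force simp: image_iff)
      ultimately have "(g, \<one>) \<in> tr \<one> h base" by simp
      then obtain x y where xy: "(x, y) \<in> L" "g = \<one> \<otimes> x" "\<one> = inv y \<otimes> h"
        by (auto simp: tr_def base_def)
      then have "g = x" "y = h" using LG[OF xy(1)] h by (simp_all add: inv_solve_left)
      then show "(g, h) \<in> L" using xy(1) by simp
    next
      assume gh: "(g, h) \<in> L"
      have sub: "(\<lambda>(x, y). (g \<otimes> x, inv y)) ` L \<subseteq> (\<lambda>(x, y). (x, inv y \<otimes> h)) ` L"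
      proof (rule image_subsetI)
        fix q assume "q \<in> L"
        then obtain x y where q: "q = (x, y)" and xy: "(x, y) \<in> L" by (cases q) auto
        have "(g \<otimes> x, h \<otimes> y) \<in> L" using Lm[OF gh xy] .
        moreover have "inv y = inv (h \<otimes> y) \<otimes> h" using LG[OF xy] h by (simp add: inv_mult_group m_assoc l_inv)
        ultimately show "(case q of (x, y) \<Rightarrow> (g \<otimes> x, inv y)) \<in> (\<lambda>(x, y). (x, inv y \<otimes> h)) ` L"
          unfolding q by (intro image_eqI[of _ _ "(g \<otimes> x, h \<otimes> y)"]) auto
      qed
      have inj: "inj_on (\<lambda>(x, y). (g \<otimes> x, inv y)) L" "inj_on (\<lambda>(x, y). (x, inv y \<otimes> h)) L"
        using LG g h by (auto simp: inj_on_def)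
      \<comment> \<open>Only one inclusion has been shown. Both sides are injective images of the
        finite set L, so counting gives equality.\<close>
      have finL: "finite L" using L finite_carrier by (auto simp: subgroup_rel_def intro: finite_subset)
      have "(\<lambda>(x, y). (g \<otimes> x, inv y)) ` L = (\<lambda>(x, y). (x, inv y \<otimes> h)) ` L"
        using finL by (intro card_subset_eq sub) (simp_all add: card_image inj)
      moreover have "tr g \<one> base = (\<lambda>(x, y). (g \<otimes> x, inv y)) ` L"
        unfolding tr_def base_def image_image using LG g by (intro image_cong refl) auto
      moreover have "tr \<one> h base = (\<lambda>(x, y). (x, inv y \<otimes> h)) ` L"
        unfolding tr_def base_def image_image using LG h by (intro image_cong refl) auto
      ultimately show "tr g \<one> base = tr \<one> h base" by simp
    qed
    have "lact B g base = ract B base h \<longleftrightarrow> (g, h) \<in> L" if "g \<in> carrier G" "h \<in> carrier G" for g h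
      using eq_iff[OF that] by (simp add: B_def)
    then show ?thesis
      using LG unfolding stab_def by blast
  qed
  moreover obtain T :: "('a, nat) biset" where T: "finite_biset G T" "biset_isomorphic G B T"
    using finite_biset_nat_copy calculation(1) by blast
  ultimately show ?thesis
  proof -
    assume B: "finite_biset G B" and tB: "base \<in> bset B" and orb: "two_orbit G B base = bset B"
      and st: "stab G B base = L"
    obtain f where f: "bij_betw f (bset B) (bset T)"
      "\<And>g m. \<lbrakk>g \<in> carrier G; m \<in> bset B\<rbrakk> \<Longrightarrow> f (lact B g m) = lact T g (f m)"
      "\<And>g m. \<lbrakk>g \<in> carrier G; m \<in> bset B\<rbrakk> \<Longrightarrow> f (ract B m g) = ract T (f m) g"
      using T(2) unfolding biset_isomorphic_def by blast
    have "two_orbit G T (f base) = f ` two_orbit G B base"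
      unfolding two_orbit_def image_image
      using f(2,3) tB finite_bisetD(4)[OF B] by (intro image_cong refl) auto
    also have "\<dots> = bset T" using orb f(1) by (simp add: bij_betw_def)
    finally have orbT: "two_orbit G T (f base) = bset T" .
    have "f base \<in> bset T" using f(1) tB by (rule bij_betw_apply)
    moreover have "stab G T (f base) = L" using stab_iso[OF B T(1) f tB] st by simp
    ultimately show ?thesis using that[OF T(1)] orbT by blast
  qed
qed

subsection \<open>Tensor products\<close>

lemma orbit_act:
  assumes M: "finite_biset G M" and N: "finite_biset G N" and p: "p \<in> bset M \<times> bset N"
    and q: "q \<in> biset_orbit G M N p"
  shows "q \<in> bset M \<times> bset N" "biset_orbit G M N q = biset_orbit G M N p"
proof -
  note DM = finite_bisetD[OF M] and DN = finite_bisetD[OF N]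
  obtain g where g: "g \<in> carrier G" "q = (ract M (fst p) (inv g), lact N g (snd p))"
    using q by (auto simp: biset_orbit_def)
  then show "q \<in> bset M \<times> bset N" using p DM DN by auto
  have pM: "fst p \<in> bset M" "snd p \<in> bset N" using p by auto
  have "biset_orbit G M N q =
      (\<lambda>h. (ract M (fst p) (inv (h \<otimes> g)), lact N (h \<otimes> g) (snd p))) ` carrier G"
    unfolding biset_orbit_def using g pM DM(7) DN(6)
    by (intro image_cong refl) (simp add: inv_mult_group)
  also have "\<dots> = (\<lambda>h. (ract M (fst p) (inv h), lact N h (snd p))) ` ((\<lambda>h. h \<otimes> g) ` carrier G)"
    by (simp add: image_image)
  also have "(\<lambda>h. h \<otimes> g) ` carrier G = carrier G"
  proof
    show "carrier G \<subseteq> (\<lambda>h. h \<otimes> g) ` carrier G"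
    proof
      fix x assume "x \<in> carrier G"
      then show "x \<in> (\<lambda>h. h \<otimes> g) ` carrier G"
        using g(1) by (intro image_eqI[of _ _ "x \<otimes> inv g"]) (simp_all add: m_assoc l_inv)
    qed
  qed (use g(1) in auto)
  finally show "biset_orbit G M N q = biset_orbit G M N p" by (simp add: biset_orbit_def)
qed

lemma orbit_self:
  assumes "finite_biset G M" "finite_biset G N" "p \<in> bset M \<times> bset N"
  shows "p \<in> biset_orbit G M N p"
  unfolding biset_orbit_def
  using assms(3) finite_bisetD(3)[OF assms(1)] finite_bisetD(2)[OF assms(2)]
  by (intro image_eqI[of _ _ \<one>]) auto

lemma orbit_eq_iff:
  assumes "finite_biset G M" "finite_biset G N" "p \<in> bset M \<times> bset N" "q \<in> bset M \<times> bset N"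
  shows "biset_orbit G M N p = biset_orbit G M N q \<longleftrightarrow> p \<in> biset_orbit G M N q"
proof
  assume "biset_orbit G M N p = biset_orbit G M N q"
  with orbit_self[OF assms(1-3)] show "p \<in> biset_orbit G M N q" by simp
next
  assume "p \<in> biset_orbit G M N q"
  then show "biset_orbit G M N p = biset_orbit G M N q" by (rule orbit_act(2)[OF assms(1,2,4)])
qed

lemma lact_orbit:
  assumes M: "finite_biset G M" and mn: "m \<in> bset M" "n \<in> bset N" and h: "h \<in> carrier G"
  shows "map_prod (lact M h) id ` biset_orbit G M N (m, n) = biset_orbit G M N (lact M h m, n)"
  unfolding biset_orbit_def image_image
  using mn h finite_bisetD(8)[OF M] by (intro image_cong refl) simp

lemma ract_orbit:
  assumes N: "finite_biset G N" and mn: "m \<in> bset M" "n \<in> bset N" and h: "h \<in> carrier G"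
  shows "map_prod id (\<lambda>n. ract N n h) ` biset_orbit G M N (m, n) = biset_orbit G M N (m, ract N n h)"
  unfolding biset_orbit_def image_image
  using mn h finite_bisetD(8)[OF N] by (intro image_cong refl) simp

lemma tensor_sel:
  "bset (biset_tensor G M N) = biset_orbit G M N ` (bset M \<times> bset N)"
  "lact (biset_tensor G M N) = (\<lambda>h X. map_prod (lact M h) id ` X)"
  "ract (biset_tensor G M N) = (\<lambda>X p. map_prod id (\<lambda>n. ract N n p) ` X)"
  by (simp_all add: biset_tensor_def)

lemma finite_biset_tensor:
  assumes M: "finite_biset G M" and N: "finite_biset G N"
  shows "finite_biset G (biset_tensor G M N)"
  unfolding finite_biset_def tensor_sel
  using finite_bisetD[OF M] finite_bisetD[OF N]
  by (auto simp: lact_orbit[OF M] ract_orbit[OF N])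

text \<open>g [m, n] = [m, n] h holds iff some k satisfies g m = m k and k n = n h, and this is
  composition of relations.\<close>

lemma stab_tensor:
  assumes M: "finite_biset G M" and N: "finite_biset G N" and m: "m \<in> bset M" and n: "n \<in> bset N"
  shows "stab G (biset_tensor G M N) (biset_orbit G M N (m, n)) = stab G M m O stab G N n"
proof -
  note DM = finite_bisetD[OF M] and DN = finite_bisetD[OF N]
  have "biset_orbit G M N (lact M g m, n) = biset_orbit G M N (m, ract N n h) \<longleftrightarrow>
      (\<exists>k\<in>carrier G. lact M g m = ract M m k \<and> lact N k n = ract N n h)"
    if g: "g \<in> carrier G" and h: "h \<in> carrier G" for g h
  proof -
    have "biset_orbit G M N (lact M g m, n) = biset_orbit G M N (m, ract N n h) \<longleftrightarrow>
        (\<exists>k\<in>carrier G. lact M g m = ract M m (inv k) \<and> n = lact N k (ract N n h))"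
      using m n g h DM(4) DN(5)
      by (subst orbit_eq_iff[OF M N]) (auto simp: biset_orbit_def)
    also have "\<dots> \<longleftrightarrow> (\<exists>k\<in>carrier G. lact M g m = ract M m k \<and> n = lact N (inv k) (ract N n h))"
      by (metis inv_closed inv_inv)
    also have "\<dots> \<longleftrightarrow> (\<exists>k\<in>carrier G. lact M g m = ract M m k \<and> lact N k n = ract N n h)"
    proof -
      have "n = lact N (inv k) (ract N n h) \<longleftrightarrow> lact N k n = ract N n h" if k: "k \<in> carrier G" for k
      proof -
        have "lact N (inv k) (lact N k n) = n" using k n DN(2,6) by simp
        then show ?thesis
          using lact_cancel[OF N inv_closed[OF k] DN(4)[OF k n] DN(5)[OF h n]] by simp
      qed
      then show ?thesis by blast
    qed
    finally show ?thesis .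
  qed
  note key = this
  show ?thesis
  proof (rule Set.set_eqI)
    fix q :: "'a \<times> 'a"
    obtain g h where q: "q = (g, h)" by (cases q)
    show "q \<in> stab G (biset_tensor G M N) (biset_orbit G M N (m, n)) \<longleftrightarrow> q \<in> stab G M m O stab G N n"
    proof (cases "g \<in> carrier G \<and> h \<in> carrier G")
      case True
      then have "q \<in> stab G (biset_tensor G M N) (biset_orbit G M N (m, n)) \<longleftrightarrow>
          biset_orbit G M N (lact M g m, n) = biset_orbit G M N (m, ract N n h)"
        by (simp only: q stab_def mem_Collect_eq case_prod_conv tensor_sel lact_orbit[OF M m n]
            ract_orbit[where M = M, OF N m n] simp_thms)
      also have "\<dots> \<longleftrightarrow> q \<in> stab G M m O stab G N n"
        using True key by (auto simp: q stab_def)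
      finally show ?thesis .
    qed (auto simp: q stab_def)
  qed
qed

text \<open>Orbit-stabilizer for the action g(m, n) = (m g^{-1}, g n).\<close>

lemma card_orbit_middle:
  assumes M: "finite_biset G M" and N: "finite_biset G N" and p: "p \<in> bset M \<times> bset N"
  shows "card (biset_orbit G M N p) * card (middle G (stab G M (fst p)) (stab G N (snd p))) = card (carrier G)"
proof -
  note DM = finite_bisetD[OF M] and DN = finite_bisetD[OF N]
  let ?f = "\<lambda>g. (ract M (fst p) (inv g), lact N g (snd p))"
  have pM: "fst p \<in> bset M" "snd p \<in> bset N" using p by auto
  have "card {g \<in> carrier G. ?f g = y} = card (middle G (stab G M (fst p)) (stab G N (snd p)))"
    if y: "y \<in> ?f ` carrier G" for y
  proof -
    obtain k where k: "k \<in> carrier G" "y = ?f k" using y by auto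
    have kg: "?f g = ?f k \<longleftrightarrow> inv k \<otimes> g \<in> middle G (stab G M (fst p)) (stab G N (snd p))"
      if g: "g \<in> carrier G" for g
    proof -
      have "ract M (fst p) (inv g) = ract M (fst p) (inv k) \<longleftrightarrow> fst p = ract M (fst p) (inv k \<otimes> g)"
        using ract_cancel[OF M g DM(5)[OF inv_closed[OF g] pM(1)] DM(5)[OF inv_closed[OF k(1)] pM(1)]]
          g k(1) pM DM(3,7) by (simp add: l_inv)
      moreover have "lact N g (snd p) = lact N k (snd p) \<longleftrightarrow> lact N (inv k \<otimes> g) (snd p) = snd p"
        using lact_cancel[OF N inv_closed[OF k(1)] DN(4)[OF g pM(2)] DN(4)[OF k(1) pM(2)]]
          g k(1) pM DN(2,6) by (simp add: l_inv)
      ultimately show ?thesis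
        using g k(1) pM DM(2) DN(3) by (simp add: middle_def stab_def)
    qed
    have "bij_betw (\<lambda>g. inv k \<otimes> g) {g \<in> carrier G. ?f g = y} (middle G (stab G M (fst p)) (stab G N (snd p)))"
    proof (rule bij_betw_byWitness[where f' = "\<lambda>h. k \<otimes> h"])
      have mid: "h \<in> carrier G" if "h \<in> middle G (stab G M (fst p)) (stab G N (snd p))" for h
        using that by (auto simp: middle_def stab_def)
      show "\<forall>g\<in>{g \<in> carrier G. ?f g = y}. k \<otimes> (inv k \<otimes> g) = g"
        using k(1) by (simp add: m_assoc[symmetric] r_inv)
      show "\<forall>h\<in>middle G (stab G M (fst p)) (stab G N (snd p)). inv k \<otimes> (k \<otimes> h) = h"
        using k(1) mid by (simp add: m_assoc[symmetric] l_inv)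
      show "(\<lambda>g. inv k \<otimes> g) ` {g \<in> carrier G. ?f g = y} \<subseteq> middle G (stab G M (fst p)) (stab G N (snd p))"
        using kg k(2) by blast
      show "(\<lambda>h. k \<otimes> h) ` middle G (stab G M (fst p)) (stab G N (snd p)) \<subseteq> {g \<in> carrier G. ?f g = y}"
      proof (intro image_subsetI CollectI conjI)
        fix h assume h: "h \<in> middle G (stab G M (fst p)) (stab G N (snd p))"
        show kh: "k \<otimes> h \<in> carrier G" using k(1) mid[OF h] by simp
        have "inv k \<otimes> (k \<otimes> h) = h" using k(1) mid[OF h] by (simp add: m_assoc[symmetric] l_inv)
        then show "?f (k \<otimes> h) = y" using kg[OF kh] h k(2) by simp
      qed
    qed
    then show ?thesis by (rule bij_betw_same_card)
  qed
  then have "card (carrier G) = card (?f ` carrier G) * card (middle G (stab G M (fst p)) (stab G N (snd p)))"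
    using finite_carrier by (intro sum_uniform_fibres) auto
  then show ?thesis by (simp add: biset_orbit_def)
qed

text \<open>An orbit X has |G| / |middle| members, all with the same composite stabilizer. Weighting
  each pair (m, n) by |middle| therefore counts X exactly |G| times.\<close>

lemma mark_sum_tensor:
  assumes M: "finite_biset G M" and N: "finite_biset G N"
  shows "alg_scale (of_nat (card (carrier G))) (mark_sum G w (biset_tensor G M N)) =
    (\<Sum>m\<in>bset M. \<Sum>n\<in>bset N.
      alg_scale (of_nat (card (middle G (stab G M m) (stab G N n)))) (w (stab G M m O stab G N n)))"
proof -
  let ?S = "bset M \<times> bset N" and ?o = "biset_orbit G M N"
  let ?h = "\<lambda>p. alg_scale (of_nat (card (middle G (stab G M (fst p)) (stab G N (snd p)))))
    (w (stab G M (fst p) O stab G N (snd p)))"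
  have fin: "finite ?S" using finite_bisetD(1)[OF M] finite_bisetD(1)[OF N] by simp
  have fibre: "sum ?h {q \<in> ?S. ?o q = X} = alg_scale (of_nat (card (carrier G))) (w (stab G (biset_tensor G M N) X))"
    if X: "X \<in> ?o ` ?S" for X
  proof -
    obtain p where p: "p \<in> ?S" "X = ?o p" using X by auto
    have fib: "{q \<in> ?S. ?o q = X} = X"
    proof (rule Set.set_eqI)
      fix q
      have "q \<in> ?S \<and> ?o q = X" if "q \<in> X"
        using orbit_act[OF M N p(1), of q] that p(2) by simp
      moreover have "q \<in> X" if "q \<in> ?S" "?o q = X"
        using orbit_self[OF M N that(1)] that(2) by simp
      ultimately show "q \<in> {q \<in> ?S. ?o q = X} \<longleftrightarrow> q \<in> X"
        by (simp only: mem_Collect_eq) metis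
    qed
    have "X \<subseteq> ?S"
      unfolding p(2) by (rule subsetI) (rule orbit_act(1)[OF M N p(1)])
    then have finX: "finite X" using fin by (rule finite_subset)
    have "p \<in> X" using orbit_self[OF M N p(1)] p(2) by simp
    then have ne: "card X \<noteq> 0" using finX by (metis card_eq_0_iff empty_iff)
    have "?h q = alg_scale (of_nat (card (carrier G)) / of_nat (card X)) (w (stab G (biset_tensor G M N) X))"
      if q: "q \<in> X" for q
    proof -
      have qS: "q \<in> ?S" "?o q = X" using q fib by auto
      have "card X * card (middle G (stab G M (fst q)) (stab G N (snd q))) = card (carrier G)"
        using card_orbit_middle[OF M N qS(1)] qS(2) by simp
      then have "(of_nat (card X) * of_nat (card (middle G (stab G M (fst q)) (stab G N (snd q)))) :: rat) =
          of_nat (card (carrier G))"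
        by (simp only: flip: of_nat_mult)
      then have "of_nat (card (middle G (stab G M (fst q)) (stab G N (snd q)))) =
          (of_nat (card (carrier G)) / of_nat (card X) :: rat)"
        using ne by (simp add: field_simps)
      moreover have "stab G M (fst q) O stab G N (snd q) = stab G (biset_tensor G M N) X"
        using stab_tensor[OF M N, of "fst q" "snd q"] qS by (auto simp: mem_Times_iff)
      ultimately show ?thesis by simp
    qed
    then have "sum ?h X = (\<Sum>q\<in>X. alg_scale (of_nat (card (carrier G)) / of_nat (card X)) (w (stab G (biset_tensor G M N) X)))"
      by (intro sum.cong refl)
    also have "\<dots> = alg_scale (\<Sum>q\<in>X. of_nat (card (carrier G)) / of_nat (card X)) (w (stab G (biset_tensor G M N) X))"
      by (simp only: alg.scale_sum_left)
    also have "(\<Sum>q\<in>X. of_nat (card (carrier G)) / of_nat (card X) :: rat) = of_nat (card (carrier G))"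
      using ne by simp
    finally show ?thesis unfolding fib .
  qed
  have "alg_scale (of_nat (card (carrier G))) (mark_sum G w (biset_tensor G M N)) =
      (\<Sum>X\<in>?o ` ?S. sum ?h {q \<in> ?S. ?o q = X})"
    unfolding mark_sum_def tensor_sel(1) alg.scale_sum_right
    by (intro sum.cong refl fibre[symmetric])
  also have "\<dots> = sum ?h ?S" by (rule sum.image_gen[OF fin, symmetric])
  finally show ?thesis by (simp add: sum.cartesian_product case_prod_beta)
qed

lemma tensor_isomorphic:
  assumes M: "finite_biset G M" and M': "finite_biset G M'" and N: "finite_biset G N" and N': "finite_biset G N'"
    and MM: "biset_isomorphic G M M'" and NN: "biset_isomorphic G N N'"
  shows "biset_isomorphic G (biset_tensor G M N) (biset_tensor G M' N')"
proof -
  obtain f where f: "bij_betw f (bset M) (bset M')"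
    "\<And>g m. \<lbrakk>g \<in> carrier G; m \<in> bset M\<rbrakk> \<Longrightarrow> f (lact M g m) = lact M' g (f m)"
    "\<And>g m. \<lbrakk>g \<in> carrier G; m \<in> bset M\<rbrakk> \<Longrightarrow> f (ract M m g) = ract M' (f m) g"
    using MM unfolding biset_isomorphic_def by blast
  obtain f' where f': "bij_betw f' (bset N) (bset N')"
    "\<And>g m. \<lbrakk>g \<in> carrier G; m \<in> bset N\<rbrakk> \<Longrightarrow> f' (lact N g m) = lact N' g (f' m)"
    "\<And>g m. \<lbrakk>g \<in> carrier G; m \<in> bset N\<rbrakk> \<Longrightarrow> f' (ract N m g) = ract N' (f' m) g"
    using NN unfolding biset_isomorphic_def by blast
  let ?F = "map_prod f f'"
  have F: "?F ` biset_orbit G M N (m, n) = biset_orbit G M' N' (f m, f' n)"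
    if "m \<in> bset M" "n \<in> bset N" for m n
    unfolding biset_orbit_def image_image
    using that f(3) f'(2) by (intro image_cong refl) simp
  have F': "?F ` biset_orbit G M N p = biset_orbit G M' N' (?F p)" if p: "p \<in> bset M \<times> bset N" for p
  proof -
    obtain m n where "p = (m, n)" by (cases p)
    then show ?thesis using F[of m n] p by simp
  qed
  have bijF: "bij_betw ?F (bset M \<times> bset N) (bset M' \<times> bset N')"
    using f(1) f'(1) by (rule bij_betw_map_prod)
  have sub: "X \<subseteq> bset M \<times> bset N" if X: "X \<in> bset (biset_tensor G M N)" for X
  proof -
    obtain p where p: "p \<in> bset M \<times> bset N" "X = biset_orbit G M N p" using X by (auto simp: tensor_sel)
    show ?thesis using orbit_act(1)[OF M N p(1)] p(2) by blast
  qed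
  have inj: "inj_on ((`) ?F) (bset (biset_tensor G M N))"
    by (rule inj_onI) (metis bij_betw_imp_inj_on[OF bijF] inj_on_image_eq_iff sub)
  have "(`) ?F ` bset (biset_tensor G M N) = (\<lambda>p. ?F ` biset_orbit G M N p) ` (bset M \<times> bset N)"
    by (simp add: tensor_sel image_image)
  also have "\<dots> = (\<lambda>p. biset_orbit G M' N' (?F p)) ` (bset M \<times> bset N)"
    by (intro image_cong refl F')
  also have "\<dots> = biset_orbit G M' N' ` (?F ` (bset M \<times> bset N))" by (simp add: image_image)
  also have "?F ` (bset M \<times> bset N) = bset M' \<times> bset N'" using bijF by (simp add: bij_betw_def)
  finally have img: "(`) ?F ` bset (biset_tensor G M N) = bset (biset_tensor G M' N')"
    by (simp add: tensor_sel)
  have f_in: "f m \<in> bset M'" if "m \<in> bset M" for m using f(1) that by (rule bij_betw_apply)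
  have f'_in: "f' n \<in> bset N'" if "n \<in> bset N" for n using f'(1) that by (rule bij_betw_apply)
  have "?F ` lact (biset_tensor G M N) g X = lact (biset_tensor G M' N') g (?F ` X) \<and>
      ?F ` ract (biset_tensor G M N) X g = ract (biset_tensor G M' N') (?F ` X) g"
    if g: "g \<in> carrier G" and X: "X \<in> bset (biset_tensor G M N)" for g X
  proof -
    obtain m n where mn: "m \<in> bset M" "n \<in> bset N" "X = biset_orbit G M N (m, n)"
      using X by (auto simp: tensor_sel)
    show ?thesis
      unfolding tensor_sel mn(3)
      using mn(1,2) g f f' finite_bisetD(4)[OF M g mn(1)] finite_bisetD(5)[OF N g mn(2)]
      by (simp add: lact_orbit[OF M] lact_orbit[OF M'] ract_orbit[OF N] ract_orbit[OF N'] F f_in f'_in)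
  qed
  then show ?thesis
    unfolding biset_isomorphic_def bij_betw_def using inj img by blast
qed

lemma biset_class_mult_class:
  assumes M: "finite_biset G M" and N: "finite_biset G N"
  shows "biset_class_mult G (biset_class G M) (biset_class G N) = biset_class G (biset_tensor G M N)"
proof -
  have "biset_class G (biset_tensor G M' N') = biset_class G (biset_tensor G M N)"
    if "M' \<in> biset_class G M" "N' \<in> biset_class G N" for M' N'
    using that M N
    by (intro biset_class_eq[symmetric] finite_biset_tensor tensor_isomorphic) (auto simp: biset_class_def)
  moreover obtain M' N' where "M' \<in> biset_class G M" "N' \<in> biset_class G N"
    using biset_class_nonempty[OF M] biset_class_nonempty[OF N] by blast
  ultimately show ?thesis unfolding biset_class_mult_def by blast
qed

lemma finite_regular_biset: "finite_biset G (regular_biset G)"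
  unfolding finite_biset_def regular_biset_def using finite_carrier by (simp add: m_assoc)

lemma regular_transitive: "two_orbit G (regular_biset G) \<one> = carrier G"
proof
  show "carrier G \<subseteq> two_orbit G (regular_biset G) \<one>"
    unfolding two_orbit_def regular_biset_def by (auto intro!: image_eqI[of _ _ "(_, \<one>)"])
qed (auto simp: two_orbit_def regular_biset_def)

lemma stab_regular: "stab G (regular_biset G) \<one> = {(g, h). g \<in> carrier G \<and> g = h}"
  by (auto simp: stab_def regular_biset_def)

end

section \<open>Subgroups of the square of the symmetric group\<close>

datatype s3 = Id3 | C123 | C132 | T12 | T23 | T13

fun s3_mult :: "s3 \<Rightarrow> s3 \<Rightarrow> s3" where
  "s3_mult Id3 q = q" | "s3_mult C123 Id3 = C123" | "s3_mult C123 C123 = C132" |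
  "s3_mult C123 C132 = Id3" | "s3_mult C123 T12 = T13" | "s3_mult C123 T23 = T12" |
  "s3_mult C123 T13 = T23" | "s3_mult C132 Id3 = C132" | "s3_mult C132 C123 = Id3" |
  "s3_mult C132 C132 = C123" | "s3_mult C132 T12 = T23" | "s3_mult C132 T23 = T13" |
  "s3_mult C132 T13 = T12" | "s3_mult T12 Id3 = T12" | "s3_mult T12 C123 = T23" |
  "s3_mult T12 C132 = T13" | "s3_mult T12 T12 = Id3" | "s3_mult T12 T23 = C123" |
  "s3_mult T12 T13 = C132" | "s3_mult T23 Id3 = T23" | "s3_mult T23 C123 = T13" |
  "s3_mult T23 C132 = T12" | "s3_mult T23 T12 = C132" | "s3_mult T23 T23 = Id3" |
  "s3_mult T23 T13 = C123" | "s3_mult T13 Id3 = T13" | "s3_mult T13 C123 = T12" |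
  "s3_mult T13 C132 = T23" | "s3_mult T13 T12 = C123" | "s3_mult T13 T23 = C132" |
  "s3_mult T13 T13 = Id3"

fun s3_inv :: "s3 \<Rightarrow> s3" where
  "s3_inv Id3 = Id3" | "s3_inv C123 = C132" | "s3_inv C132 = C123" |
  "s3_inv T12 = T12" | "s3_inv T23 = T23" | "s3_inv T13 = T13"

lemma s3_UNIV: "UNIV = {Id3, C123, C132, T12, T23, T13}"
  using s3.exhaust by auto

lemma s3_all: "(\<forall>x. P x) \<longleftrightarrow> P Id3 \<and> P C123 \<and> P C132 \<and> P T12 \<and> P T23 \<and> P T13"
  by (metis s3.exhaust)

lemma s3_ex: "(\<exists>x. P x) \<longleftrightarrow> P Id3 \<or> P C123 \<or> P C132 \<or> P T12 \<or> P T23 \<or> P T13"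
  by (metis s3.exhaust)

instance s3 :: finite
  by standard (simp add: s3_UNIV)

text \<open>The group is written additively; \<open>group_add\<close> does not assume
  commutativity.\<close>

instantiation s3 :: group_add
begin
definition "0 = Id3"
definition "x + y = s3_mult x y"
definition "- x = s3_inv x"
definition "x - y = s3_mult x (s3_inv y)"
instance
proof
  fix a b c :: s3
  show "a + b + c = a + (b + c)"
    unfolding plus_s3_def by (cases a; cases b; cases c; simp)
  show "0 + a = a" "a + 0 = a" "- a + a = 0" "a + - b = a - b"
    by (cases a; simp add: plus_s3_def zero_s3_def uminus_s3_def minus_s3_def)+
qed
end

lemmas s3_ops = zero_s3_def plus_s3_def minus_s3_def uminus_s3_def

text \<open>Relations on \<^typ>\<open>s3\<close> are tabulated as bit matrices, so that the finite checks can be done by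
  rewriting. The shape of a subgroup of \<open>S\<^sub>3\<close> tells whether it contains an element of order 3 and
  whether it contains one of order 2; this determines the subgroup up to conjugation.\<close>

datatype row = Row bool bool bool bool bool bool
datatype rel = Rel row row row row row row

fun row_at :: "row \<Rightarrow> s3 \<Rightarrow> bool" where
  "row_at (Row a b c d e f) x = (case x of Id3 \<Rightarrow> a | C123 \<Rightarrow> b | C132 \<Rightarrow> c | T12 \<Rightarrow> d | T23 \<Rightarrow> e | T13 \<Rightarrow> f)"

fun rel_at :: "rel \<Rightarrow> s3 \<Rightarrow> row" where
  "rel_at (Rel a b c d e f) x = (case x of Id3 \<Rightarrow> a | C123 \<Rightarrow> b | C132 \<Rightarrow> c | T12 \<Rightarrow> d | T23 \<Rightarrow> e | T13 \<Rightarrow> f)"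

definition row_tab :: "(s3 \<Rightarrow> bool) \<Rightarrow> row" where
  "row_tab P = Row (P Id3) (P C123) (P C132) (P T12) (P T23) (P T13)"

definition tab :: "(s3 \<Rightarrow> s3 \<Rightarrow> bool) \<Rightarrow> rel" where
  "tab P = Rel (row_tab (P Id3)) (row_tab (P C123)) (row_tab (P C132))
     (row_tab (P T12)) (row_tab (P T23)) (row_tab (P T13))"

fun row_or :: "row \<Rightarrow> row \<Rightarrow> row" where
  "row_or (Row a b c d e f) (Row a' b' c' d' e' f') =
     Row (a \<or> a') (b \<or> b') (c \<or> c') (d \<or> d') (e \<or> e') (f \<or> f')"

fun row_and :: "row \<Rightarrow> row \<Rightarrow> row" where
  "row_and (Row a b c d e f) (Row a' b' c' d' e' f') =
     Row (a \<and> a') (b \<and> b') (c \<and> c') (d \<and> d') (e \<and> e') (f \<and> f')"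

definition row_empty :: row where "row_empty = Row False False False False False False"

fun row_comp :: "row \<Rightarrow> rel \<Rightarrow> row" where
  "row_comp (Row a b c d e f) (Rel r1 r2 r3 r4 r5 r6) =
     row_or (if a then r1 else row_empty) (row_or (if b then r2 else row_empty)
    (row_or (if c then r3 else row_empty) (row_or (if d then r4 else row_empty)
    (row_or (if e then r5 else row_empty) (if f then r6 else row_empty)))))"

fun rel_comp :: "rel \<Rightarrow> rel \<Rightarrow> rel" where
  "rel_comp (Rel r1 r2 r3 r4 r5 r6) s = Rel (row_comp r1 s) (row_comp r2 s) (row_comp r3 s)
     (row_comp r4 s) (row_comp r5 s) (row_comp r6 s)"

fun row_conj :: "s3 \<Rightarrow> row \<Rightarrow> row" where
  "row_conj g r = (let h = s3_inv g in row_tab (\<lambda>x. row_at r (s3_mult g (s3_mult x h))))"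

fun rel_rconj :: "s3 \<Rightarrow> rel \<Rightarrow> rel" where
  "rel_rconj g (Rel r1 r2 r3 r4 r5 r6) = Rel (row_conj g r1) (row_conj g r2) (row_conj g r3)
     (row_conj g r4) (row_conj g r5) (row_conj g r6)"

datatype shape = Sh bool bool

fun row_shape :: "row \<Rightarrow> shape" where
  "row_shape (Row a b c d e f) = Sh b (d \<or> e \<or> f)"

fun shape_size :: "shape \<Rightarrow> int" where
  "shape_size (Sh t s) = (if t then if s then 6 else 3 else if s then 2 else 1)"

fun row_ex :: "row \<Rightarrow> bool" where
  "row_ex (Row a b c d e f) \<longleftrightarrow> a \<or> b \<or> c \<or> d \<or> e \<or> f"

fun rel_dom :: "rel \<Rightarrow> row" where
  "rel_dom (Rel r1 r2 r3 r4 r5 r6) =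
     Row (row_ex r1) (row_ex r2) (row_ex r3) (row_ex r4) (row_ex r5) (row_ex r6)"

fun rel_ran :: "rel \<Rightarrow> row" where
  "rel_ran (Rel r1 r2 r3 r4 r5 r6) =
     row_or r1 (row_or r2 (row_or r3 (row_or r4 (row_or r5 r6))))"

fun rel_k1 :: "rel \<Rightarrow> row" where
  "rel_k1 (Rel r1 r2 r3 r4 r5 r6) =
     Row (row_at r1 Id3) (row_at r2 Id3) (row_at r3 Id3) (row_at r4 Id3) (row_at r5 Id3) (row_at r6 Id3)"

fun rel_k2 :: "rel \<Rightarrow> row" where
  "rel_k2 (Rel r1 r2 r3 r4 r5 r6) = r1"

text \<open>The order of a subgroup L as the order of its first projection times that of the kernel
  {y. (1, y) in L}, both read off from the shapes.\<close>

fun rel_size :: "rel \<Rightarrow> int" where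
  "rel_size r = shape_size (row_shape (rel_dom r)) * shape_size (row_shape (rel_k2 r))"

text \<open>The coordinates of an integral array, in the order of the rows of the \<open>6 \<times> 6\<close> array
  block by block: \<open>s\<^sub>1\<^sub>1, \<dots>, s\<^sub>3\<^sub>3, t, u, v, w, x, y, z\<^sub>1, z\<^sub>2, z\<^sub>3\<close>.\<close>

datatype iarr = IArr int int int int int int int int int int int int int int int int int int int int int int

fun iarr_mult :: "iarr \<Rightarrow> iarr \<Rightarrow> iarr" where
  "iarr_mult (IArr s11 s12 s13 s21 s22 s23 s31 s32 s33 t1 t2 t3 u v w x1 x2 x3 y z1 z2 z3)
   (IArr s11' s12' s13' s21' s22' s23' s31' s32' s33' t1' t2' t3' u' v' w' x1' x2' x3' y' z1' z2' z3') = IArr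
     (s11 * s11' + s12 * s21' + s13 * s31')
     (s11 * s12' + s12 * s22' + s13 * s32')
     (s11 * s13' + s12 * s23' + s13 * s33')
     (s21 * s11' + s22 * s21' + s23 * s31')
     (s21 * s12' + s22 * s22' + s23 * s32')
     (s21 * s13' + s22 * s23' + s23 * s33')
     (s31 * s11' + s32 * s21' + s33 * s31')
     (s31 * s12' + s32 * s22' + s33 * s32')
     (s31 * s13' + s32 * s23' + s33 * s33')
     (s11 * t1' + s12 * t2' + s13 * t3' + t1 * z1')
     (s21 * t1' + s22 * t2' + s23 * t3' + t2 * z1')
     (s31 * t1' + s32 * t2' + s33 * t3' + t3 * z1')
     (u * u')
     (u * v' + v * z1')
     (w * w')
     (x1 * s11' + x2 * s21' + x3 * s31' + z1 * x1')
     (x1 * s12' + x2 * s22' + x3 * s32' + z1 * x2')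
     (x1 * s13' + x2 * s23' + x3 * s33' + z1 * x3')
     (y * u' + z1 * y')
     (z1 * z1')
     (x1 * t1' + x2 * t2' + x3 * t3' - 12 * (y * v') + z1 * z2' + z2 * z1')
     (y * v' + z1 * z3' + z3 * z1')"

fun iarr_add :: "iarr \<Rightarrow> iarr \<Rightarrow> iarr" where
  "iarr_add (IArr s11 s12 s13 s21 s22 s23 s31 s32 s33 t1 t2 t3 u v w x1 x2 x3 y z1 z2 z3)
   (IArr s11' s12' s13' s21' s22' s23' s31' s32' s33' t1' t2' t3' u' v' w' x1' x2' x3' y' z1' z2' z3') = IArr
     (s11 + s11') (s12 + s12') (s13 + s13') (s21 + s21') (s22 + s22') (s23 + s23') (s31 + s31') (s32 + s32') (s33 + s33') (t1 + t1') (t2 + t2') (t3 + t3') (u + u') (v + v') (w + w') (x1 + x1') (x2 + x2') (x3 + x3') (y + y') (z1 + z1') (z2 + z2') (z3 + z3')"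

fun iarr_scale :: "int \<Rightarrow> iarr \<Rightarrow> iarr" where
  "iarr_scale k (IArr s11 s12 s13 s21 s22 s23 s31 s32 s33 t1 t2 t3 u v w x1 x2 x3 y z1 z2 z3) = IArr
     (k * s11) (k * s12) (k * s13) (k * s21) (k * s22) (k * s23) (k * s31) (k * s32) (k * s33) (k * t1) (k * t2) (k * t3) (k * u) (k * v) (k * w) (k * x1) (k * x2) (k * x3) (k * y) (k * z1) (k * z2) (k * z3)"

datatype mark = Mark int int int int

fun mark_of :: "shape \<Rightarrow> mark" where
  "mark_of (Sh t s) = (if t then if s then Mark 1 0 0 0 else Mark 1 0 1 0
     else if s then Mark 1 1 0 0 else Mark 1 2 1 1)"

text \<open>Twice an outer product: the fourth coordinate of the left vector goes to row 6, that of
  the right vector to column 6. Row 6 carries a further factor 3, as the congruences of the order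
  demand. Fourth coordinates never pair in a product because alpha_{1,4,1} = 0; this is the 0 in
  diag(1, 1, 1, 0).\<close>

fun mark_outer :: "mark \<Rightarrow> mark \<Rightarrow> iarr" where
  "mark_outer (Mark a1 a2 a3 a4) (Mark b1 b2 b3 b4) = IArr
     (2 * (a1 * b1)) (2 * (a1 * b2)) (2 * (a1 * b3)) (2 * (a2 * b1)) (2 * (a2 * b2)) (2 * (a2 * b3)) (2 * (a3 * b1)) (2 * (a3 * b2)) (2 * (a3 * b3)) (2 * (a1 * b4)) (2 * (a2 * b4)) (2 * (a3 * b4)) 0 0 0
     (6 * (a4 * b1)) (6 * (a4 * b2)) (6 * (a4 * b3)) 0 0 (6 * (a4 * b4)) 0"

text \<open>Twice the image in \<open>\<Lambda>\<^sub>(\<^sub>3\<^sub>)\<close> of the transitive biset with stabilizer \<open>r\<close>; the factor 2 clears a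
  denominator. On products \<open>P \<times> Q\<close> it is a matrix of rank one: the double coset numbers
  \<open>|P \ S\<^sub>3 / Q|\<close> form a symmetric integral \<open>4 \<times> 4\<close> matrix of rank 3, and \<open>mark_of\<close> gives the
  coordinates in a basis that brings it into the form \<open>diag(1, 1, 1, 0)\<close>. The other six values come from
  splitting off the idempotents of these 16 classes.\<close>

definition rel_mark :: "rel \<Rightarrow> iarr" where
  "rel_mark r = (let p1 = row_shape (rel_dom r); k1 = row_shape (rel_k1 r); p2 = row_shape (rel_ran r) in
     if p1 = k1 then mark_outer (mark_of p1) (mark_of p2)
     else if p1 = Sh False True
       then if p2 = Sh False True
         then IArr 2 2 0 2 4 2 0 2 2 0 2 2 2 2 0 0 6 6 2 0 (-18) 2
         else IArr 2 0 0 2 0 2 0 0 2 0 0 0 2 0 0 0 0 6 2 0 0 0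
     else if p1 = Sh True False
       then IArr 2 0 2 0 4 0 2 0 2 0 2 0 0 0 4 0 6 0 0 0 3 0
     else if k1 = Sh False False
       then IArr 2 0 0 0 2 0 0 0 2 0 0 0 2 0 2 0 0 0 0 2 0 0
     else if p2 = Sh False True
       then IArr 2 2 0 0 0 0 0 2 2 0 0 2 2 2 0 0 0 0 0 0 0 0
       else IArr 2 0 0 0 0 0 0 0 2 0 0 0 2 0 0 0 0 0 0 0 0 0)"

definition row_sub :: "shape \<Rightarrow> row" where
  "row_sub s = (if s = Sh True True then Row True True True True True True
    else if s = Sh True False then Row True True True False False False
    else if s = Sh False True then Row True False False True False False
    else Row True False False False False False)"

definition rel_prod :: "row \<Rightarrow> row \<Rightarrow> rel" where
  "rel_prod r s = tab (\<lambda>x y. row_at r x \<and> row_at s y)"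

text \<open>The fibre product of p1 and p2 over a common quotient of order 2, with kernels k1 and
  k2. Groups of order 2 have only one isomorphism between them, so no further datum is
  needed.\<close>

definition rel_ind2 :: "row \<Rightarrow> row \<Rightarrow> row \<Rightarrow> row \<Rightarrow> rel" where
  "rel_ind2 p1 k1 p2 k2 =
    tab (\<lambda>x y. row_at p1 x \<and> row_at p2 y \<and> (row_at k1 x \<longleftrightarrow> row_at k2 y))"

text \<open>By Goursat a subgroup amounts to an isomorphism between sections of S_3. Trivial
  sections give 4 * 4 products. Order 2 gives 2 * 2, from C_2/1 and S_3/C_3. Order 3 occurs only as
  C_3/1, whose two automorphisms are conjugate in S_3. Order 6 occurs only as S_3/1, where all
  automorphisms are inner. In total 16 + 4 + 1 + 1 = 22.\<close>

definition std_rels :: "rel list" where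
  "std_rels = (let a = row_sub (Sh False False); b = row_sub (Sh False True);
       c = row_sub (Sh True False); d = row_sub (Sh True True) in
     [rel_prod x y. x \<leftarrow> [a, b, c, d], y \<leftarrow> [a, b, c, d]] @
     [rel_ind2 p1 k1 p2 k2. (p1, k1) \<leftarrow> [(b, a), (d, c)], (p2, k2) \<leftarrow> [(b, a), (d, c)]] @
     [tab (\<lambda>x y. row_at c x \<and> x = y), tab (\<lambda>x y. x = y)])"

definition s3_list :: "s3 list" where "s3_list = [Id3, C123, C132, T12, T23, T13]"

text \<open>The sum is the Mackey formula for the product of two transitive bisets, cleared of
  denominators.\<close>

definition kf_sum :: "rel \<Rightarrow> rel \<Rightarrow> iarr" where
  "kf_sum r s = foldr (\<lambda>g. iarr_add (let r' = rel_rconj g r; c = rel_comp r' s in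
     iarr_scale (2 * (shape_size (row_shape (row_and (rel_k2 r') (rel_k1 s))) * rel_size c)) (rel_mark c)))
     s3_list (IArr 0 0 0 0 0 0 0 0 0 0 0 0 0 0 0 0 0 0 0 0 0 0)"

definition kf_check :: "rel \<Rightarrow> rel \<Rightarrow> bool" where
  "kf_check r s \<longleftrightarrow> kf_sum r s = iarr_scale (rel_size r * rel_size s) (iarr_mult (rel_mark r) (rel_mark s))"

definition sub_rows :: "row list" where
  "sub_rows = map row_sub [Sh False False, Sh True False, Sh True True] @
     map (\<lambda>t. row_tab (\<lambda>x. x = Id3 \<or> x = t)) [T12, T23, T13]"

fun rel_conj :: "s3 \<Rightarrow> s3 \<Rightarrow> rel \<Rightarrow> rel" where
  "rel_conj p q r = rel_rconj q (let p' = s3_inv p; c = (\<lambda>x. rel_at r (s3_mult p' (s3_mult x p))) in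
     Rel (c Id3) (c C123) (c C132) (c T12) (c T23) (c T13))"

definition rel_closed :: "rel \<Rightarrow> bool" where
  "rel_closed r \<longleftrightarrow> list_all (\<lambda>x. list_all (\<lambda>y. if row_at (rel_at r x) y then
     list_all (\<lambda>x'. list_all (\<lambda>y'. if row_at (rel_at r x') y'
       then row_at (rel_at r (s3_mult x x')) (s3_mult y y') else True) s3_list) s3_list
     else True) s3_list) s3_list"

text \<open>A subgroup \<open>L\<close> of \<open>S\<^sub>3 \<times> S\<^sub>3\<close> is determined by its first projection \<open>p\<close>, by \<open>k = {y. (1, y) \<in> L}\<close>
  and by lifts \<open>b\<close>, \<open>d\<close> of generators of \<open>p\<close> to \<open>L\<close>.\<close>

fun lift_word :: "s3 \<Rightarrow> s3 \<Rightarrow> s3 \<Rightarrow> s3" where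
  "lift_word b d Id3 = Id3" | "lift_word b d C123 = b" | "lift_word b d C132 = s3_mult b b" |
  "lift_word b d T12 = d" | "lift_word b d T23 = s3_mult (s3_mult b b) d" |
  "lift_word b d T13 = s3_mult b d"

definition rel_lift :: "row \<Rightarrow> row \<Rightarrow> s3 \<Rightarrow> s3 \<Rightarrow> rel" where
  "rel_lift p k b d = tab (\<lambda>x y. row_at p x \<and> row_at k (s3_mult (s3_inv (lift_word b d x)) y))"

text \<open>An arbitrary choice of lifts need not define a subgroup, so tables that are not closed
  must be accepted as well.\<close>

definition class_check :: "rel \<Rightarrow> bool" where
  "class_check r \<longleftrightarrow> (if list_ex (\<lambda>p. list_ex (\<lambda>q. List.member std_rels (rel_conj p q r)) s3_list) s3_list
     then True else \<not> rel_closed r)"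

text \<open>The lift b varies only if p contains the 3-cycles, and d only if p contains a
  transposition; otherwise the lift is \<open>Id3\<close>, which keeps the enumeration
  small.\<close>

definition class_check_all :: "row \<Rightarrow> bool" where
  "class_check_all p \<longleftrightarrow> list_all (\<lambda>k. list_all (\<lambda>b. list_all (\<lambda>d. class_check (rel_lift p k b d))
     (if row_shape p = Sh True False \<or> row_shape p = Sh False False then [Id3] else s3_list))
     (if row_at p C123 then s3_list else [Id3])) sub_rows"

text \<open>The central computation, over 22 * 22 pairs; \<open>closed_rel_std\<close> and
  \<open>kf_conj\<close> extend it to all pairs of subgroups.\<close>

lemma kf_std: "list_all (\<lambda>r. list_all (kf_check r) std_rels) std_rels"
  by code_simp

lemma class_check_rows: "class_check_all (sub_rows ! 0)" "class_check_all (sub_rows ! 1)"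
  "class_check_all (sub_rows ! 2)"
  "class_check_all (sub_rows ! 3)" "class_check_all (sub_rows ! 4)" "class_check_all (sub_rows ! 5)"
  by code_simp+

section \<open>Integral arrays as elements of A, and permutations of three points\<close>

fun of_iarr :: "iarr \<Rightarrow> alg" where
  "of_iarr (IArr s11 s12 s13 s21 s22 s23 s31 s32 s33 t1 t2 t3 u v w x1 x2 x3 y z1 z2 z3) =
    Alg (vector [vector [of_int s11, of_int s12, of_int s13], vector [of_int s21, of_int s22, of_int s23],
          vector [of_int s31, of_int s32, of_int s33]])
      (vector [of_int t1, of_int t2, of_int t3]) (of_int u) (of_int v) (of_int w)
      (vector [of_int x1, of_int x2, of_int x3]) (of_int y) (QEX (of_int z1) (of_int z2) (of_int z3))"

lemma of_iarr_hom:
  "of_iarr (iarr_add a b) = of_iarr a + of_iarr b"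
  "of_iarr (iarr_scale k a) = alg_scale (of_int k) (of_iarr a)"
  "of_iarr (iarr_mult a b) = of_iarr a * of_iarr b"
  "of_iarr (IArr 0 0 0 0 0 0 0 0 0 0 0 0 0 0 0 0 0 0 0 0 0 0) = 0"
  by (cases a; cases b; simp add: alg_calc alg_scale_def)+

fun perm_of :: "s3 \<Rightarrow> nat \<Rightarrow> nat" where
  "perm_of Id3 n = n"
| "perm_of C123 n = (if n = 1 then 2 else if n = 2 then 3 else if n = 3 then 1 else n)"
| "perm_of C132 n = (if n = 1 then 3 else if n = 2 then 1 else if n = 3 then 2 else n)"
| "perm_of T12 n = (if n = 1 then 2 else if n = 2 then 1 else n)"
| "perm_of T23 n = (if n = 2 then 3 else if n = 3 then 2 else n)"
| "perm_of T13 n = (if n = 1 then 3 else if n = 3 then 1 else n)"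

lemma perm_of_add: "perm_of (a + b) = perm_of a \<circ> perm_of b"
  by (cases a; cases b; simp add: s3_ops fun_eq_iff)

lemma perm_of_0: "perm_of 0 = id"
  by (simp add: s3_ops fun_eq_iff)

lemma perm_of_inj: "inj perm_of"
proof (rule injI)
  fix a b assume "perm_of a = perm_of b"
  then have "perm_of a 1 = perm_of b 1" "perm_of a 2 = perm_of b 2" by simp_all
  then show "a = b" by (cases a; cases b; simp)
qed

lemma perm_of_permutes: "perm_of a permutes {1..3}"
proof -
  have "bij (perm_of a)"
  proof (rule o_bij)
    show "perm_of (- a) \<circ> perm_of a = id" "perm_of a \<circ> perm_of (- a) = id"
      by (simp_all add: perm_of_0 flip: perm_of_add)
  qed
  moreover have "perm_of a x = x" if "x \<notin> {1..3}" for x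
    using that by (cases a) auto
  ultimately show ?thesis by (simp add: permutes_def bij_iff)
qed

lemma s3_card: "card (UNIV :: s3 set) = 6"
  by (simp add: s3_UNIV)

abbreviation S3 :: "(nat \<Rightarrow> nat) monoid" where "S3 \<equiv> sym_group 3"

lemma S3_carrier: "carrier S3 = range perm_of"
proof -
  have "range perm_of \<subseteq> {p. p permutes {1..3 :: nat}}" using perm_of_permutes by auto
  moreover have "card (range perm_of) = card {p. p permutes {1..3 :: nat}}"
    using card_image[OF perm_of_inj] card_permutations[of "{1..3 :: nat}" 3]
    by (simp add: s3_card fact_numeral)
  ultimately have "range perm_of = {p. p permutes {1..3 :: nat}}"
    by (intro card_subset_eq) (simp_all add: finite_permutations)
  then show ?thesis by (simp add: sym_group_def)
qed

interpretation S3: finite_group S3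
  by (intro finite_group.intro sym_group_is_group finite_group_axioms.intro) (simp add: S3_carrier)

lemma S3_card: "card (carrier S3) = 6"
  by (simp add: S3_carrier card_image perm_of_inj s3_card)

lemma S3_mult: "perm_of a \<otimes>\<^bsub>S3\<^esub> perm_of b = perm_of (a + b)"
  by (simp add: sym_group_def perm_of_add)

lemma S3_one: "\<one>\<^bsub>S3\<^esub> = perm_of 0"
  by (simp add: sym_group_def perm_of_0)

lemma S3_inv: "inv\<^bsub>S3\<^esub> (perm_of a) = perm_of (- a)"
  by (rule S3.inv_equality) (simp_all add: S3_mult S3_one S3_carrier)

section \<open>Subgroups as predicates, and their tables\<close>

definition closed_pred :: "(s3 \<Rightarrow> bool) \<Rightarrow> bool" where
  "closed_pred S \<longleftrightarrow> S 0 \<and> (\<forall>a b. S a \<longrightarrow> S b \<longrightarrow> S (a + b))"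

definition closed_rel :: "(s3 \<Rightarrow> s3 \<Rightarrow> bool) \<Rightarrow> bool" where
  "closed_rel P \<longleftrightarrow> P 0 0 \<and> (\<forall>a b c d. P a b \<longrightarrow> P c d \<longrightarrow> P (a + c) (b + d))"

definition conjP :: "s3 \<Rightarrow> s3 \<Rightarrow> (s3 \<Rightarrow> s3 \<Rightarrow> bool) \<Rightarrow> (s3 \<Rightarrow> s3 \<Rightarrow> bool)" where
  "conjP p q P = (\<lambda>x y. P (- p + x + p) (q + y + - q))"

lemma row_at_tab [simp]: "row_at (row_tab S) x = S x"
  by (cases x) (simp_all add: row_tab_def)

lemma rel_at_tab [simp]: "rel_at (tab P) x = row_tab (P x)"
  by (cases x) (simp_all add: tab_def)

lemma row_tab_eq_iff: "row_tab S = row_tab S' \<longleftrightarrow> S = S'"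
  by (auto simp: row_tab_def fun_eq_iff s3_all)

lemma tab_eq_iff: "tab P = tab Q \<longleftrightarrow> P = Q"
  unfolding tab_def rel.inject row_tab_eq_iff by (simp add: fun_eq_iff[of P] s3_all)

lemma row_or_tab: "row_or (row_tab S) (row_tab S') = row_tab (\<lambda>x. S x \<or> S' x)"
  by (simp add: row_tab_def)

lemma row_and_tab: "row_and (row_tab S) (row_tab S') = row_tab (\<lambda>x. S x \<and> S' x)"
  by (simp add: row_tab_def)

lemma row_comp_tab: "row_comp (row_tab S) (tab Q) = row_tab (\<lambda>z. \<exists>y. S y \<and> Q y z)"
proof -
  have if_row: "(if b then row_tab S' else row_empty) = row_tab (\<lambda>x. b \<and> S' x)" for b S'
    by (simp add: row_tab_def row_empty_def)
  have "row_comp (row_tab S) (tab Q) =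
    row_or (if S Id3 then row_tab (Q Id3) else row_empty) (row_or (if S C123 then row_tab (Q C123) else row_empty)
    (row_or (if S C132 then row_tab (Q C132) else row_empty) (row_or (if S T12 then row_tab (Q T12) else row_empty)
    (row_or (if S T23 then row_tab (Q T23) else row_empty) (if S T13 then row_tab (Q T13) else row_empty)))))"
    by (simp only: row_tab_def[of S] tab_def row_comp.simps)
  then show ?thesis
    by (simp only: if_row row_or_tab s3_ex)
qed

lemma rel_comp_tab: "rel_comp (tab P) (tab Q) = tab (\<lambda>x z. \<exists>y. P x y \<and> Q y z)"
  by (simp only: tab_def[of P] rel_comp.simps row_comp_tab) (simp only: tab_def)

lemma row_conj_tab: "row_conj g (row_tab S) = row_tab (\<lambda>x. S (g + x + - g))"
  by (simp add: Let_def add.assoc flip: plus_s3_def uminus_s3_def del: add_uminus_conv_diff)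

lemma rel_rconj_tab: "rel_rconj g (tab P) = tab (conjP 0 g P)"
  by (simp only: tab_def rel_rconj.simps row_conj_tab conjP_def minus_zero add_0_left add_0_right)

lemma rel_conj_tab: "rel_conj p q (tab P) = tab (conjP p q P)"
proof -
  have "rel_conj p q (tab P) = rel_rconj q (tab (conjP p 0 P))"
    by (simp only: rel_conj.simps Let_def rel_at_tab tab_def[of "conjP p 0 P"])
      (simp add: conjP_def add.assoc flip: plus_s3_def uminus_s3_def zero_s3_def del: add_uminus_conv_diff)
  then show ?thesis by (simp add: rel_rconj_tab) (simp add: conjP_def)
qed

lemma row_ex_tab: "row_ex (row_tab S) \<longleftrightarrow> (\<exists>x. S x)"
  by (simp add: row_tab_def s3_ex)

lemma rel_dom_tab: "rel_dom (tab P) = row_tab (\<lambda>x. \<exists>y. P x y)"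
  by (simp only: tab_def rel_dom.simps row_ex_tab) (simp only: row_tab_def)

lemma rel_ran_tab: "rel_ran (tab P) = row_tab (\<lambda>y. \<exists>x. P x y)"
  by (simp only: tab_def rel_ran.simps row_or_tab s3_ex)

lemma rel_k1_tab: "rel_k1 (tab P) = row_tab (\<lambda>x. P x 0)"
  by (simp only: tab_def rel_k1.simps row_at_tab) (simp only: row_tab_def zero_s3_def)

lemma rel_k2_tab: "rel_k2 (tab P) = row_tab (P 0)"
  by (simp only: tab_def rel_k2.simps zero_s3_def)

lemma closed_pred_sections:
  assumes "closed_rel P"
  shows "closed_pred (\<lambda>x. \<exists>y. P x y)" "closed_pred (\<lambda>y. \<exists>x. P x y)"
    "closed_pred (\<lambda>x. P x 0)" "closed_pred (P 0)"
  using assms unfolding closed_rel_def closed_pred_def by (blast, blast, metis add_0_left, metis add_0_left)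

text \<open>Conjugation permutes the transpositions and preserves the set of 3-cycles, and a
  submonoid contains both 3-cycles or neither.\<close>

lemma row_shape_conj:
  assumes "closed_pred S"
  shows "row_shape (row_tab (\<lambda>x. S (p + x + - p))) = row_shape (row_tab S)"
proof -
  have "C123 + C123 = C132" "C132 + C132 = C123" by (simp_all add: s3_ops)
  then have "S C123 \<longleftrightarrow> S C132" using assms unfolding closed_pred_def by metis
  then show ?thesis
    by (cases p) (auto simp: row_tab_def s3_ops)
qed

lemma closed_rel_conjP: "closed_rel P \<Longrightarrow> closed_rel (conjP p q P)"
  unfolding closed_rel_def conjP_def
proof (intro conjI allI impI)
  fix a b c d assume P: "P 0 0 \<and> (\<forall>a b c d. P a b \<longrightarrow> P c d \<longrightarrow> P (a + c) (b + d))"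
    and "P (- p + a + p) (q + b + - q)" "P (- p + c + p) (q + d + - q)"
  then have "P ((- p + a + p) + (- p + c + p)) ((q + b + - q) + (q + d + - q))" by blast
  then show "P (- p + (a + c) + p) (q + (b + d) + - q)"
    by (simp add: add.assoc del: add_uminus_conv_diff)
qed simp

lemma conjP_shapes:
  assumes P: "closed_rel P"
  shows "row_shape (rel_dom (tab (conjP p q P))) = row_shape (rel_dom (tab P))"
    "row_shape (rel_ran (tab (conjP p q P))) = row_shape (rel_ran (tab P))"
    "row_shape (rel_k1 (tab (conjP p q P))) = row_shape (rel_k1 (tab P))"
    "row_shape (rel_k2 (tab (conjP p q P))) = row_shape (rel_k2 (tab P))"
proof -
  have ex_conj: "(\<exists>y. Q (q + y + - q)) \<longleftrightarrow> (\<exists>y. Q y)" for Q and q :: s3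
  proof
    assume "\<exists>y. Q y"
    then obtain y where "Q y" ..
    then have "Q (q + (- q + y + q) + - q)" by (simp add: add.assoc)
    then show "\<exists>y. Q (q + y + - q)" by blast
  qed blast
  have ex1: "(\<exists>x. P (- p + x + p) c) \<longleftrightarrow> (\<exists>x. P x c)" for c
    using ex_conj[of "\<lambda>x. P x c" "- p"] by simp
  have ex2: "(\<exists>y. P c (q + y - q)) \<longleftrightarrow> (\<exists>y. P c y)" for c
    using ex_conj[of "P c" q] by simp
  note sh = closed_pred_sections[OF P, THEN row_shape_conj]
  show "row_shape (rel_dom (tab (conjP p q P))) = row_shape (rel_dom (tab P))"
    using sh(1)[of "- p"] by (simp add: rel_dom_tab conjP_def ex2)
  show "row_shape (rel_ran (tab (conjP p q P))) = row_shape (rel_ran (tab P))"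
    using sh(2)[of q] by (simp add: rel_ran_tab conjP_def ex1)
  show "row_shape (rel_k1 (tab (conjP p q P))) = row_shape (rel_k1 (tab P))"
    using sh(3)[of "- p"] by (simp add: rel_k1_tab conjP_def)
  show "row_shape (rel_k2 (tab (conjP p q P))) = row_shape (rel_k2 (tab P))"
    using sh(4)[of q] by (simp add: rel_k2_tab conjP_def)
qed

text \<open>The stabilizers of the \<open>36 / |L|\<close> points of a transitive biset contribute equally; the remaining
  factor 2 is the one in \<^const>\<open>rel_mark\<close>.\<close>

definition weight :: "(s3 \<Rightarrow> s3 \<Rightarrow> bool) \<Rightarrow> alg" where
  "weight P = alg_scale (of_int (rel_size (tab P)) / 72) (of_iarr (rel_mark (tab P)))"

text \<open>The weight sees a subgroup only through the shapes of its projections and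
  kernels.\<close>

lemma weight_conjP: "closed_rel P \<Longrightarrow> weight (conjP p q P) = weight P"
  by (simp only: weight_def rel_mark_def rel_size.simps conjP_shapes)

section \<open>The Mackey identity for pairs of subgroups\<close>

definition compP :: "(s3 \<Rightarrow> s3 \<Rightarrow> bool) \<Rightarrow> (s3 \<Rightarrow> s3 \<Rightarrow> bool) \<Rightarrow> (s3 \<Rightarrow> s3 \<Rightarrow> bool)" where
  "compP P Q = (\<lambda>x z. \<exists>y. P x y \<and> Q y z)"

lemma closed_rel_compP: "\<lbrakk>closed_rel P; closed_rel Q\<rbrakk> \<Longrightarrow> closed_rel (compP P Q)"
  unfolding closed_rel_def compP_def by blast

lemma card_closed_pred:
  assumes "closed_pred S"
  shows "int (card {h. S h}) = shape_size (row_shape (row_tab S))"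
proof -
  have "card {h. S h} = (\<Sum>h\<in>UNIV. if S h then 1 else 0)"
    by (simp add: sum.If_cases)
  then have card: "card {h. S h} = (if S Id3 then 1 else 0) + (if S C123 then 1 else 0) + (if S C132 then 1 else 0)
      + (if S T12 then 1 else 0) + (if S T23 then 1 else 0) + (if S T13 then 1 else 0)"
    by (simp add: s3_UNIV)
  have "S Id3" "\<forall>a b. S a \<longrightarrow> S b \<longrightarrow> S (s3_mult a b)"
    using assms by (simp_all add: closed_pred_def s3_ops)
  then show ?thesis
    unfolding card row_tab_def s3_all
    by (cases "S C123"; cases "S C132"; cases "S T12"; cases "S T23"; cases "S T13"; simp)
qed

lemma of_iarr_foldr:
  "of_iarr (foldr (\<lambda>g. iarr_add (f g)) s3_list (IArr 0 0 0 0 0 0 0 0 0 0 0 0 0 0 0 0 0 0 0 0 0 0)) =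
    (\<Sum>g\<in>UNIV. of_iarr (f g))"
  unfolding s3_list_def foldr.simps o_def of_iarr_hom(1,4) id_def
  by (simp add: s3_UNIV add.assoc)

text \<open>The contribution of one pair of points (m, n) in \<open>mark_sum_tensor\<close>, with P
  = stab m and Q = stab n.\<close>

definition pair_term :: "(s3 \<Rightarrow> s3 \<Rightarrow> bool) \<Rightarrow> (s3 \<Rightarrow> s3 \<Rightarrow> bool) \<Rightarrow> alg" where
  "pair_term P Q = alg_scale (of_nat (card {h. P 0 h \<and> Q h 0})) (weight (compP P Q))"

text \<open>Multiplicativity in local form. The factor 36 is |G|^2: one |G| comes from
  \<open>mark_sum_tensor\<close>, the other from letting g run over the group while m is replaced by
  m g.\<close>

definition kf :: "(s3 \<Rightarrow> s3 \<Rightarrow> bool) \<Rightarrow> (s3 \<Rightarrow> s3 \<Rightarrow> bool) \<Rightarrow> bool" where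
  "kf P Q \<longleftrightarrow> (\<Sum>g\<in>UNIV. pair_term (conjP 0 g P) Q) = alg_scale 36 (weight P * weight Q)"

text \<open>Scaling by 144 clears denominators. On the right 144 * 36 = 72 * 72 cancels those of the
  two weights; on the left 144 / 72 leaves the 2 that stands in \<open>kf_sum\<close>.\<close>

lemma kf_of_check:
  assumes P: "closed_rel P" and Q: "closed_rel Q" and check: "kf_check (tab P) (tab Q)"
  shows "kf P Q"
proof -
  define mid where "mid g = shape_size (row_shape (row_and (rel_k2 (tab (conjP 0 g P))) (rel_k1 (tab Q))))" for g
  define C where "C g = tab (compP (conjP 0 g P) Q)" for g
  have summand: "alg_scale 144 (pair_term (conjP 0 g P) Q) =
      of_iarr (iarr_scale (2 * (mid g * rel_size (C g))) (rel_mark (C g)))" for g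
  proof -
    have "closed_pred (\<lambda>h. conjP 0 g P 0 h \<and> Q h 0)"
      using closed_pred_sections(4)[OF closed_rel_conjP[OF P]] closed_pred_sections(3)[OF Q]
      unfolding closed_pred_def by blast
    then have "mid g = int (card {h. conjP 0 g P 0 h \<and> Q h 0})"
      by (simp add: mid_def rel_k2_tab rel_k1_tab row_and_tab card_closed_pred)
    then show ?thesis
      by (simp add: of_iarr_hom pair_term_def weight_def C_def mult_ac del: rel_size.simps)
  qed
  have "kf_sum (tab P) (tab Q) = foldr (\<lambda>g. iarr_add (iarr_scale (2 * (mid g * rel_size (C g))) (rel_mark (C g))))
      s3_list (IArr 0 0 0 0 0 0 0 0 0 0 0 0 0 0 0 0 0 0 0 0 0 0)"
    by (simp only: kf_sum_def Let_def rel_rconj_tab rel_comp_tab mid_def C_def compP_def)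
  then have "of_iarr (kf_sum (tab P) (tab Q)) = (\<Sum>g\<in>UNIV. alg_scale 144 (pair_term (conjP 0 g P) Q))"
    unfolding summand by (simp only: of_iarr_foldr)
  then have "alg_scale 144 (\<Sum>g\<in>UNIV. pair_term (conjP 0 g P) Q) =
      of_iarr (iarr_scale (rel_size (tab P) * rel_size (tab Q)) (iarr_mult (rel_mark (tab P)) (rel_mark (tab Q))))"
    using check by (simp add: kf_check_def alg.scale_sum_right)
  also have "\<dots> = alg_scale 144 (alg_scale 36 (weight P * weight Q))"
    by (simp add: of_iarr_hom weight_def alg_scale_mult del: rel_size.simps)
  finally have "alg_scale (1 / 144) (alg_scale 144 (\<Sum>g\<in>UNIV. pair_term (conjP 0 g P) Q)) =
      alg_scale (1 / 144) (alg_scale 144 (alg_scale 36 (weight P * weight Q)))" by (rule arg_cong)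
  then show ?thesis by (simp add: kf_def)
qed

lemma conjP_conjP: "conjP p q (conjP p' q' P) = conjP (p + p') (q' + q) P"
  by (simp add: conjP_def fun_eq_iff add.assoc minus_add del: add_uminus_conv_diff)

text \<open>Conjugating an outer coordinate does not touch the middle elements and conjugates the
  composite, to which \<open>weight\<close> is insensitive.\<close>

lemma pair_term_left:
  assumes "closed_rel P" "closed_rel Q"
  shows "pair_term (conjP p 0 P) Q = pair_term P Q" "pair_term P (conjP 0 q Q) = pair_term P Q"
proof -
  have "compP (conjP p 0 P) Q = conjP p 0 (compP P Q)" "compP P (conjP 0 q Q) = conjP 0 q (compP P Q)"
    by (auto simp: compP_def conjP_def fun_eq_iff)
  then show "pair_term (conjP p 0 P) Q = pair_term P Q" "pair_term P (conjP 0 q Q) = pair_term P Q"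
    by (simp_all add: pair_term_def weight_conjP closed_rel_compP assms) (simp_all add: conjP_def add.assoc)
qed

text \<open>Conjugating the shared coordinate in both relations at once merely renames the
  intermediate element y.\<close>

lemma pair_term_middle: "pair_term (conjP 0 q P) (conjP (- q) 0 Q) = pair_term P Q"
proof -
  have "compP (conjP 0 q P) (conjP (- q) 0 Q) = compP P Q"
  proof (intro ext iffI)
    fix x z assume "compP P Q x z"
    then obtain y where "P x y" "Q y z" by (auto simp: compP_def)
    then show "compP (conjP 0 q P) (conjP (- q) 0 Q) x z"
      unfolding compP_def conjP_def by (intro exI[of _ "- q + y + q"]) (simp add: add.assoc)
  qed (auto simp: compP_def conjP_def)
  moreover have "card {h. conjP 0 q P 0 h \<and> conjP (- q) 0 Q h 0} = card {h. P 0 h \<and> Q h 0}"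
  proof (rule bij_betw_same_card)
    show "bij_betw (\<lambda>y. q + y + - q) {h. conjP 0 q P 0 h \<and> conjP (- q) 0 Q h 0} {h. P 0 h \<and> Q h 0}"
      by (rule bij_betw_byWitness[where f' = "\<lambda>y. - q + y + q"])
        (auto simp: conjP_def add.assoc simp del: add_uminus_conv_diff)
  qed
  ultimately show ?thesis by (simp add: pair_term_def)
qed

text \<open>The elements p and q' act on outer coordinates and drop out. The elements q and p' act
  in the middle, where they only shift the summation index from g to q + g + p'.\<close>

lemma kf_conj:
  assumes P: "closed_rel P" and Q: "closed_rel Q" and kf: "kf (conjP p q P) (conjP p' q' Q)"
  shows "kf P Q"
proof -
  have "pair_term (conjP 0 g (conjP p q P)) (conjP p' q' Q) = pair_term (conjP 0 (q + g + p') P) Q" for g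
  proof -
    have "conjP 0 g (conjP p q P) = conjP p 0 (conjP 0 (- p') (conjP 0 (q + g + p') P))"
      by (simp add: conjP_conjP add.assoc del: add_uminus_conv_diff)
    moreover have "conjP p' q' Q = conjP 0 q' (conjP (- (- p')) 0 Q)"
      by (simp add: conjP_conjP)
    ultimately show ?thesis
      by (simp only: pair_term_left closed_rel_conjP P Q pair_term_middle)
  qed
  then have "(\<Sum>g\<in>UNIV. pair_term (conjP 0 g (conjP p q P)) (conjP p' q' Q)) =
      (\<Sum>g\<in>UNIV. pair_term (conjP 0 (q + g + p') P) Q)" by simp
  also have "\<dots> = (\<Sum>g\<in>UNIV. pair_term (conjP 0 g P) Q)"
  proof (rule sum.reindex_bij_betw)
    show "bij (\<lambda>g. q + g + p')"
    proof (rule bijI')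
      show "\<exists>x. y = q + x + p'" for y by (rule exI[of _ "- q + y + - p'"]) (simp add: add.assoc)
    qed simp
  qed
  finally show ?thesis
    using kf by (simp add: kf_def weight_conjP P Q)
qed

section \<open>Classification of the subgroups up to conjugation\<close>

lemma uminus_closed:
  assumes "closed_rel P" "P a b" shows "P (- a) (- b)"
proof -
  \<comment> \<open>The group has exponent 6, so inverses are fifth powers, and the same exponent
    serves both coordinates.\<close>
  have neg: "- x = x + (x + (x + (x + x)))" for x :: s3
    by (cases x) (simp_all add: s3_ops)
  show ?thesis unfolding neg[of a] neg[of b] using assms unfolding closed_rel_def by blast
qed

lemma closed_pred_rows:
  assumes "closed_pred S" shows "row_tab S \<in> set sub_rows"
proof -
  have "S Id3" "\<forall>a b. S a \<longrightarrow> S b \<longrightarrow> S (s3_mult a b)"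
    using assms by (simp_all add: closed_pred_def s3_ops)
  then show ?thesis
    unfolding row_tab_def s3_all sub_rows_def row_sub_def
    by (cases "S C123"; cases "S C132"; cases "S T12"; cases "S T23"; cases "S T13"; simp)
qed

lemma class_check_all_rows: "p \<in> set sub_rows \<Longrightarrow> class_check_all p"
  using class_check_rows by (auto simp: sub_rows_def)

text \<open>For x in the first projection, the y related to x form the coset of P 0 through any one
  lift of x.\<close>

lemma tab_eq_rel_lift:
  assumes P: "closed_rel P" and f: "\<And>x y. P x y \<Longrightarrow> P x (lift_word b d x)"
  shows "tab P = rel_lift (row_tab (\<lambda>x. \<exists>y. P x y)) (row_tab (P 0)) b d"
proof -
  have key: "P x y \<longleftrightarrow> (\<exists>y. P x y) \<and> P 0 (- lift_word b d x + y)" for x y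
  proof
    assume xy: "P x y"
    then have "P (- x) (- lift_word b d x)" using uminus_closed[OF P f] by blast
    then have "P (- x + x) (- lift_word b d x + y)" using P xy unfolding closed_rel_def by blast
    then show "(\<exists>y. P x y) \<and> P 0 (- lift_word b d x + y)" using xy by auto
  next
    assume "(\<exists>y. P x y) \<and> P 0 (- lift_word b d x + y)"
    then have "P (x + 0) (lift_word b d x + (- lift_word b d x + y))"
      using P f unfolding closed_rel_def by blast
    then show "P x y" by (simp add: add.assoc[symmetric])
  qed
  show ?thesis
    unfolding rel_lift_def row_at_tab plus_s3_def[symmetric] uminus_s3_def[symmetric] tab_eq_iff
    by (intro ext) (rule key)
qed

text \<open>The first projection, the kernel P 0 and suitable lifts b, d recover P as a
  \<open>rel_lift\<close>, so P is among the tables examined by \<open>class_check_all\<close>.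
  Being closed, it must be conjugate to a standard one.\<close>

lemma closed_rel_std:
  assumes P: "closed_rel P"
  obtains p q where "tab (conjP p q P) \<in> set std_rels"
proof -
  define S where "S x \<longleftrightarrow> (\<exists>y. P x y)" for x
  have S: "closed_pred S" unfolding S_def by (rule closed_pred_sections(1)[OF P])
  have rows: "row_tab S \<in> set sub_rows" "row_tab (P 0) \<in> set sub_rows"
    using S closed_pred_sections(4)[OF P] by (simp_all add: closed_pred_rows)
  have add: "P (a + c) (b + d)" if "P a b" "P c d" for a b c d
    using P that unfolding closed_rel_def by blast
  have P0: "P 0 0" using P by (simp add: closed_rel_def)
  have Sadd: "S (a + b)" if "S a" "S b" for a b using S that unfolding closed_pred_def by blast
  obtain b where b: "if S C123 then P C123 b else b = Id3"
    unfolding S_def by (cases "\<exists>y. P C123 y") auto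
  \<comment> \<open>d lifts a transposition of S. If S has order 2, then b is \<open>Id3\<close> and
    \<open>lift_word\<close> sends every transposition to d, so d may lift whichever transposition S
    contains.\<close>
  define d where "d = (if S T12 then SOME y. P T12 y else if S T23 then SOME y. P T23 y
    else if S T13 then SOME y. P T13 y else Id3)"
  have "P x (SOME y. P x y)" if "S x" for x
    using that unfolding S_def by (rule someI_ex)
  then have d: "if S T12 then P T12 d else if S T23 then P T23 d else if S T13 then P T13 d else d = Id3"
    by (simp add: d_def)
  have sums: "C123 + C123 = C132" "C132 + C132 = C123" "C123 + T12 = T13" "C132 + T12 = T23" "T12 + T13 = C132"
    "T12 + T23 = C123" "T13 + T23 = C132"
    by (simp_all add: s3_ops)
  have f: "P x (lift_word b d x)" if "P x y" for x y
  proof (cases "S C123")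
    case True
    then have C: "P C123 b" "P C132 (b + b)" using b add[of C123 b C123 b] sums by auto
    have "P T12 d \<and> P T13 (b + d) \<and> P T23 (b + b + d)" if "S T12"
      using that d C add[of C123 b T12 d] add[of C132 "b + b" T12 d] sums by auto
    moreover have "S T12" if "S T13 \<or> S T23"
    proof -
      have "T13 + C123 = T12" "T23 + C132 = T12" "S C132"
        using True Sadd[of C123 C123] sums by (simp_all add: s3_ops)
      then show ?thesis using that True Sadd by metis
    qed
    moreover have "S x" using \<open>P x y\<close> by (auto simp: S_def)
    ultimately show ?thesis
      using C P0 by (cases x) (auto simp: s3_ops)
  next
    case False
    then have "\<not> S C132" using Sadd[of C132 C132] sums by auto
    moreover have "\<not> (S T12 \<and> S T13)" "\<not> (S T12 \<and> S T23)" "\<not> (S T13 \<and> S T23)"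
      using False \<open>\<not> S C132\<close> Sadd[of T12 T13] Sadd[of T12 T23] Sadd[of T13 T23] sums by auto
    moreover have "S x" using \<open>P x y\<close> by (auto simp: S_def)
    moreover have "b = Id3" using False b by simp
    ultimately show ?thesis
      using P0 d False by (cases x) (auto simp: s3_ops)
  qed
  have lift: "tab P = rel_lift (row_tab S) (row_tab (P 0)) b d"
    unfolding S_def by (rule tab_eq_rel_lift[OF P f])
  have all: "x \<in> set s3_list" for x by (cases x) (simp_all add: s3_list_def)
  have "row_shape (row_tab S) = Sh True False \<or> row_shape (row_tab S) = Sh False False \<Longrightarrow> d = Id3"
    using d by (auto simp: row_tab_def)
  then have d_in: "d \<in> set (if row_shape (row_tab S) = Sh True False \<or> row_shape (row_tab S) = Sh False False
      then [Id3] else s3_list)"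
    using all by auto
  have b_in: "b \<in> set (if row_at (row_tab S) C123 then s3_list else [Id3])"
    using b all by auto
  have "class_check (rel_lift (row_tab S) (row_tab (P 0)) b d)"
    using class_check_all_rows[OF rows(1)] rows(2) b_in d_in
    unfolding class_check_all_def list_all_iff by blast
  then have check: "class_check (tab P)" by (simp only: lift)
  have "rel_closed (tab P)"
    unfolding rel_closed_def list_all_iff using add by (simp flip: plus_s3_def)
  then have "\<exists>p q. tab (conjP p q P) \<in> set std_rels"
    using check unfolding class_check_def list_ex_iff rel_conj_tab by (auto split: if_splits)
  then show ?thesis using that by blast
qed

lemma kf_all:
  assumes P: "closed_rel P" and Q: "closed_rel Q"
  shows "kf P Q"
proof -
  obtain p q where p: "tab (conjP p q P) \<in> set std_rels" using closed_rel_std[OF P] by blast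
  obtain p' q' where q: "tab (conjP p' q' Q) \<in> set std_rels" using closed_rel_std[OF Q] by blast
  have "kf (conjP p q P) (conjP p' q' Q)"
    using kf_std p q by (intro kf_of_check closed_rel_conjP P Q) (auto simp: list_all_iff)
  then show ?thesis by (rule kf_conj[OF P Q])
qed

section \<open>The double Burnside algebra of the symmetric group\<close>

definition pull :: "((nat \<Rightarrow> nat) \<times> (nat \<Rightarrow> nat)) set \<Rightarrow> s3 \<Rightarrow> s3 \<Rightarrow> bool" where
  "pull L a b \<longleftrightarrow> (perm_of a, perm_of b) \<in> L"

lemma perm_of_eq_iff [simp]: "perm_of a = perm_of b \<longleftrightarrow> a = b"
  using perm_of_inj by (auto dest: injD)

lemma perm_of_carrier [simp]: "perm_of a \<in> carrier S3"
  by (simp add: S3_carrier)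

lemma S3_carrierE:
  assumes "x \<in> carrier S3" obtains a where "x = perm_of a"
  using assms by (auto simp: S3_carrier)

lemma closed_rel_pull: "subgroup_rel S3 L \<Longrightarrow> closed_rel (pull L)"
  unfolding subgroup_rel_def closed_rel_def pull_def by (simp add: S3_one flip: S3_mult)

lemma pull_conj_rel: "pull (conj_rel S3 (perm_of p) (perm_of q) L) = conjP p q (pull L)"
  by (auto simp: pull_def conj_rel_def conjP_def S3_inv S3_mult fun_eq_iff simp del: add_uminus_conv_diff)

lemma pull_relcomp:
  assumes "L \<subseteq> carrier S3 \<times> carrier S3"
  shows "pull (L O L') = compP (pull L) (pull L')"
proof (intro ext iffI)
  fix x z assume "pull (L O L') x z"
  then obtain y where y: "(perm_of x, y) \<in> L" "(y, perm_of z) \<in> L'" by (auto simp: pull_def)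
  then obtain b where "y = perm_of b" using assms S3_carrierE by blast
  then show "compP (pull L) (pull L') x z" using y by (auto simp: compP_def pull_def)
qed (auto simp: compP_def pull_def)

lemma card_middle_pull:
  assumes "L \<subseteq> carrier S3 \<times> carrier S3"
  shows "card (middle S3 L L') = card {h. pull L 0 h \<and> pull L' h 0}"
proof -
  have "middle S3 L L' = perm_of ` {h. pull L 0 h \<and> pull L' h 0}"
    using assms by (auto simp: middle_def pull_def S3_one image_iff elim!: S3_carrierE)
  then show ?thesis by (simp add: card_image inj_on_subset[OF perm_of_inj])
qed

abbreviation mk :: "(nat \<Rightarrow> nat, 'm) biset \<Rightarrow> alg" where
  "mk \<equiv> mark_sum S3 (\<lambda>L. weight (pull L))"

lemma stab_S3:
  assumes M: "finite_biset S3 M" and m: "m \<in> bset M"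
  shows "subgroup_rel S3 (stab S3 M m)" "stab S3 M m \<subseteq> carrier S3 \<times> carrier S3" "closed_rel (pull (stab S3 M m))"
  using S3.subgroup_rel_stab[OF M m] closed_rel_pull by (auto simp: stab_def)

lemma alg_scale_of_nat: "alg_scale (of_nat n) x = of_nat n * x"
  by (induction n) (simp_all add: alg.scale_left_distrib distrib_right)

lemma mk_tensor:
  assumes M: "finite_biset S3 M" and N: "finite_biset S3 N"
  shows "mk (biset_tensor S3 M N) = mk M * mk N"
proof -
  note D = S3.finite_bisetD[OF M]
  let ?P = "\<lambda>m. pull (stab S3 M m)" and ?Q = "\<lambda>n. pull (stab S3 N n)"
  \<comment> \<open>The map m -> m g is a bijection of M and conjugates the second coordinate of
    each stabilizer.\<close>
  have shift: "(\<Sum>m\<in>bset M. pair_term (?P m) Q) = (\<Sum>m\<in>bset M. pair_term (conjP 0 g (?P m)) Q)" for g Q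
  proof -
    have "bij_betw (\<lambda>m. ract M m (perm_of g)) (bset M) (bset M)"
      using D(3,5,7) S3.r_inv[of "perm_of g"] S3.l_inv[of "perm_of g"]
      by (intro bij_betw_byWitness[where f' = "\<lambda>m. ract M m (perm_of (- g))"])
        (auto simp: S3_mult perm_of_0 S3_one)
    then have "(\<Sum>m\<in>bset M. pair_term (?P m) Q) = (\<Sum>m\<in>bset M. pair_term (?P (ract M m (perm_of g))) Q)"
      by (rule sum.reindex_bij_betw[symmetric])
    also have "\<dots> = (\<Sum>m\<in>bset M. pair_term (conjP 0 g (?P m)) Q)"
    proof (intro sum.cong refl)
      fix m assume m: "m \<in> bset M"
      have "stab S3 M (ract M m (perm_of g)) = conj_rel S3 (perm_of 0) (perm_of g) (stab S3 M m)"
        using S3.stab_two_sided[OF M m, of "\<one>\<^bsub>S3\<^esub>" "perm_of g"] m D(2) by (simp add: S3_one)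
      then show "pair_term (?P (ract M m (perm_of g))) Q = pair_term (conjP 0 g (?P m)) Q"
        by (simp add: pull_conj_rel)
    qed
    finally show ?thesis .
  qed
  \<comment> \<open>By \<open>shift\<close> all six group elements contribute the same sum.\<close>
  have six: "(\<Sum>g\<in>UNIV. \<Sum>m\<in>bset M. pair_term (conjP 0 g (?P m)) Q) =
      alg_scale 6 (\<Sum>m\<in>bset M. pair_term (?P m) Q)" for Q
    using alg_scale_of_nat[of 6] by (simp add: s3_card flip: shift)
  have "alg_scale 6 (mk (biset_tensor S3 M N)) = (\<Sum>m\<in>bset M. \<Sum>n\<in>bset N. pair_term (?P m) (?Q n))"
    using S3.mark_sum_tensor[OF M N, of "\<lambda>L. weight (pull L)"]
    by (simp add: S3_card pair_term_def stab_S3(2)[OF M] card_middle_pull pull_relcomp)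
  also have "\<dots> = (\<Sum>n\<in>bset N. \<Sum>m\<in>bset M. pair_term (?P m) (?Q n))" by (rule sum.swap)
  finally have eq6: "alg_scale 6 (mk (biset_tensor S3 M N)) = (\<Sum>n\<in>bset N. \<Sum>m\<in>bset M. pair_term (?P m) (?Q n))" .
  have "alg_scale 36 (mk (biset_tensor S3 M N)) = alg_scale 6 (\<Sum>n\<in>bset N. \<Sum>m\<in>bset M. pair_term (?P m) (?Q n))"
    unfolding eq6[symmetric] by simp
  also have "\<dots> = (\<Sum>n\<in>bset N. \<Sum>g\<in>UNIV. \<Sum>m\<in>bset M. pair_term (conjP 0 g (?P m)) (?Q n))"
    by (simp only: six alg.scale_sum_right)
  also have "\<dots> = (\<Sum>n\<in>bset N. \<Sum>m\<in>bset M. \<Sum>g\<in>UNIV. pair_term (conjP 0 g (?P m)) (?Q n))"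
    by (intro sum.cong refl sum.swap)
  also have "\<dots> = (\<Sum>n\<in>bset N. \<Sum>m\<in>bset M. alg_scale 36 (weight (?P m) * weight (?Q n)))"
    by (intro sum.cong refl) (use kf_all[OF stab_S3(3)[OF M] stab_S3(3)[OF N]] in \<open>simp add: kf_def\<close>)
  also have "\<dots> = (\<Sum>m\<in>bset M. \<Sum>n\<in>bset N. alg_scale 36 (weight (?P m) * weight (?Q n)))" by (rule sum.swap)
  also have "\<dots> = alg_scale 36 (mk M * mk N)"
    by (simp add: mark_sum_def sum_product alg.scale_sum_right)
  finally have "alg_scale (1 / 36) (alg_scale 36 (mk (biset_tensor S3 M N))) = alg_scale (1 / 36) (alg_scale 36 (mk M * mk N))"
    by (rule arg_cong)
  then show ?thesis by simp
qed

subsection \<open>The standard transitive bisets\<close>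

text \<open>The fibre of the first projection over a is the coset b + {h. P 0 h}, for any b with P a
  b.\<close>

lemma card_closed_rel:
  assumes P: "closed_rel P"
  shows "int (card {(a, b). P a b}) = rel_size (tab P)"
proof -
  have "card {(a, b). P a b} = card (fst ` {(a, b). P a b}) * card {h. P 0 h}"
  proof (rule S3.sum_uniform_fibres)
    fix a assume "a \<in> fst ` {(a, b). P a b}"
    then obtain b where b: "P a b" by auto
    have "bij_betw (\<lambda>h. (a, b + h)) {h. P 0 h} {x \<in> {(a, b). P a b}. fst x = a}"
    proof (rule bij_betw_byWitness[where f' = "\<lambda>x. - b + snd x"])
      show "(\<lambda>h. (a, b + h)) ` {h. P 0 h} \<subseteq> {x \<in> {(a, b). P a b}. fst x = a}"
        using P b unfolding closed_rel_def by (auto, metis add_0_right)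
      show "(\<lambda>x. - b + snd x) ` {x \<in> {(a, b). P a b}. fst x = a} \<subseteq> {h. P 0 h}"
        using P uminus_closed[OF P b] unfolding closed_rel_def by (auto, metis left_minus)
    qed (auto simp flip: add.assoc)
    then show "card {x \<in> {(a, b). P a b}. fst x = a} = card {h. P 0 h}"
      by (rule bij_betw_same_card[symmetric])
  qed simp
  moreover have "fst ` {(a, b). P a b} = {a. \<exists>b. P a b}" by force
  ultimately show ?thesis
    using card_closed_pred[OF closed_pred_sections(1)[OF P]] card_closed_pred[OF closed_pred_sections(4)[OF P]]
    by (simp add: rel_dom_tab rel_k2_tab)
qed

lemma card_pull: "L \<subseteq> carrier S3 \<times> carrier S3 \<Longrightarrow> card L = card {(a, b). pull L a b}"
proof -
  assume L: "L \<subseteq> carrier S3 \<times> carrier S3"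
  have "L = map_prod perm_of perm_of ` {(a, b). pull L a b}"
  proof (rule Set.set_eqI)
    fix q :: "(nat \<Rightarrow> nat) \<times> (nat \<Rightarrow> nat)"
    obtain x y where q: "q = (x, y)" by (cases q)
    show "q \<in> L \<longleftrightarrow> q \<in> map_prod perm_of perm_of ` {(a, b). pull L a b}"
    proof
      assume "q \<in> L"
      then obtain a b where "q = (perm_of a, perm_of b)" using L q by (auto elim!: S3_carrierE)
      then show "q \<in> map_prod perm_of perm_of ` {(a, b). pull L a b}"
        using \<open>q \<in> L\<close> by (intro image_eqI[of _ _ "(a, b)"]) (auto simp: pull_def)
    qed (auto simp: pull_def)
  qed
  moreover have "inj (map_prod perm_of perm_of)" by (rule prod.inj_map[OF perm_of_inj perm_of_inj])
  ultimately show ?thesis by (metis card_image inj_on_subset subset_UNIV)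
qed

lemma two_orbit_point:
  assumes M: "finite_biset S3 M" and m: "m \<in> bset M" and x: "x \<in> two_orbit S3 M m"
  shows "two_orbit S3 M x = two_orbit S3 M m"
proof -
  have sub: "two_orbit S3 M y \<subseteq> two_orbit S3 M z" if "z \<in> bset M" "y \<in> two_orbit S3 M z" for y z
    using that S3.two_orbit_closed[OF M that(1)] S3.two_orbit_sub[OF M that(1)] S3.finite_bisetD(4)[OF M]
    unfolding two_orbit_def[of _ _ y] by (auto simp: subset_iff)
  obtain a b where ab: "a \<in> carrier S3" "b \<in> carrier S3" "x = ract M (lact M a m) b"
    using x by (auto simp: two_orbit_def)
  have xM: "x \<in> bset M" using x S3.two_orbit_sub[OF M m] by auto
  have "x \<in> two_orbit S3 M x" by (rule S3.two_orbit_self[OF M xM])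
  then have "m \<in> two_orbit S3 M x"
    using S3.two_orbit_closed[OF M xM] ab m S3.finite_bisetD(4)[OF M] by simp
  then show ?thesis using sub m x xM by blast
qed

definition half_mark :: "rel \<Rightarrow> alg" where
  "half_mark r = alg_scale (1 / 2) (of_iarr (rel_mark r))"

text \<open>All stabilizers are conjugate, hence of equal weight. The number of points is 36 / |L|
  and each weight carries |L| / 72, so the factor 1 / 2 remains.\<close>

lemma mk_transitive:
  assumes M: "finite_biset S3 M" and m: "m \<in> bset M" "two_orbit S3 M m = bset M"
  shows "mk M = half_mark (tab (pull (stab S3 M m)))"
proof -
  let ?P = "pull (stab S3 M m)"
  have "weight (pull (stab S3 M x)) = weight ?P" if "x \<in> bset M" for x
  proof -
    obtain p q where "x = ract M (lact M (perm_of p) m) (perm_of q)"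
      using \<open>x \<in> bset M\<close> unfolding m(2)[symmetric] two_orbit_def by (auto elim!: S3_carrierE)
    then have "stab S3 M x = conj_rel S3 (perm_of p) (perm_of q) (stab S3 M m)"
      using S3.stab_two_sided[OF M m(1)] by simp
    then show ?thesis by (simp add: pull_conj_rel weight_conjP stab_S3(3)[OF M m(1)])
  qed
  then have "mk M = (\<Sum>x\<in>bset M. weight ?P)" unfolding mark_sum_def by (intro sum.cong refl)
  also have "\<dots> = alg_scale (of_nat (card (bset M))) (weight ?P)"
    by (simp add: alg_scale_of_nat)
  also have "\<dots> = half_mark (tab ?P)"
  proof -
    have "card (bset M) * card (stab S3 M m) = 36"
      using S3.card_two_orbit[OF M m(1)] m(2) by (simp add: S3_card)
    then have "int (card (bset M)) * rel_size (tab ?P) = 36"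
      using card_closed_rel[OF stab_S3(3)[OF M m(1)]] card_pull[OF stab_S3(2)[OF M m(1)]]
      by (metis of_nat_mult of_nat_numeral)
    then have "(of_nat (card (bset M)) * of_int (rel_size (tab ?P)) :: rat) = 36"
      by (metis of_int_mult of_int_numeral of_int_of_nat_eq)
    then show ?thesis by (simp add: weight_def half_mark_def del: rel_size.simps)
  qed
  finally show ?thesis .
qed

lemma std_rels_closed: "list_all rel_closed std_rels"
  by code_simp

lemma std_rels_one: "list_all (\<lambda>r. row_at (rel_at r Id3) Id3) std_rels"
  by code_simp

lemma std_rels_length: "length std_rels = 22"
  by code_simp

lemma tab_rel_at: "tab (\<lambda>x y. row_at (rel_at r x) y) = r"
proof -
  have row: "row_tab (row_at s) = s" for s by (cases s) (simp add: row_tab_def)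
  show ?thesis by (cases r) (simp add: tab_def row)
qed

lemma std_closed_rel:
  assumes "r \<in> set std_rels" shows "closed_rel (\<lambda>x y. row_at (rel_at r x) y)"
proof -
  have all: "x \<in> set s3_list" for x by (cases x) (simp_all add: s3_list_def)
  have "rel_closed r" "row_at (rel_at r Id3) Id3"
    using assms std_rels_closed std_rels_one by (auto simp: list_all_iff)
  then show ?thesis
    using all unfolding closed_rel_def rel_closed_def list_all_iff plus_s3_def zero_s3_def
    by (auto split: if_splits)
qed

definition is_std :: "rel \<Rightarrow> (nat \<Rightarrow> nat, nat) biset \<Rightarrow> bool" where
  "is_std r T \<longleftrightarrow> finite_biset S3 T \<and> (\<exists>t\<in>bset T. two_orbit S3 T t = bset T \<and> tab (pull (stab S3 T t)) = r)"

definition std_biset :: "rel \<Rightarrow> (nat \<Rightarrow> nat, nat) biset" where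
  "std_biset r = (SOME T. is_std r T)"

lemma std_biset:
  assumes r: "r \<in> set std_rels" shows "is_std r (std_biset r)"
proof -
  let ?P = "\<lambda>x y. row_at (rel_at r x) y"
  define L where "L = {(perm_of a, perm_of b) | a b. ?P a b}"
  have pull: "pull L = ?P" by (intro ext) (auto simp: pull_def L_def)
  have "subgroup_rel S3 L"
    using std_closed_rel[OF r] unfolding subgroup_rel_def closed_rel_def L_def
    by (auto simp: S3_one S3_mult)
  then obtain T :: "(nat \<Rightarrow> nat, nat) biset" and t where "finite_biset S3 T" "t \<in> bset T"
    "two_orbit S3 T t = bset T" "stab S3 T t = L"
    by (rule S3.exists_transitive)
  then have "is_std r T"
    unfolding is_std_def using pull tab_rel_at[of r] by (auto intro!: bexI[of _ t])
  then show ?thesis unfolding std_biset_def by (rule someI)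
qed

lemma finite_std_biset: "r \<in> set std_rels \<Longrightarrow> finite_biset S3 (std_biset r)"
  using std_biset by (simp add: is_std_def)

lemma mk_std_biset: "r \<in> set std_rels \<Longrightarrow> mk (std_biset r) = half_mark r"
proof -
  assume "r \<in> set std_rels"
  then obtain t where t: "t \<in> bset (std_biset r)" "two_orbit S3 (std_biset r) t = bset (std_biset r)"
    "tab (pull (stab S3 (std_biset r) t)) = r" and fin: "finite_biset S3 (std_biset r)"
    using std_biset[of r] unfolding is_std_def by blast
  show "mk (std_biset r) = half_mark r" using mk_transitive[OF fin t(1,2)] t(3) by simp
qed

lemma pull_eq:
  assumes "L \<subseteq> carrier S3 \<times> carrier S3" "L' \<subseteq> carrier S3 \<times> carrier S3" "pull L = pull L'"
  shows "L = L'"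
proof (rule Set.set_eqI)
  fix q show "q \<in> L \<longleftrightarrow> q \<in> L'"
  proof (cases "q \<in> carrier S3 \<times> carrier S3")
    case True
    then obtain a b where "q = (perm_of a, perm_of b)" by (auto elim!: S3_carrierE)
    then show ?thesis using fun_cong[OF fun_cong[OF assms(3)], of a b] by (simp add: pull_def)
  qed (use assms(1,2) in blast)
qed

text \<open>Some point p m q has a standard stabilizer, and transitive bisets with a common point
  stabilizer are isomorphic.\<close>

lemma transitive_std:
  assumes M: "finite_biset S3 M" and m: "m \<in> bset M" "two_orbit S3 M m = bset M"
  obtains r where "r \<in> set std_rels" "biset_isomorphic S3 M (std_biset r)"
proof -
  obtain p q where pq: "tab (conjP p q (pull (stab S3 M m))) \<in> set std_rels"
    using closed_rel_std[OF stab_S3(3)[OF M m(1)]] by blast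
  let ?r = "tab (conjP p q (pull (stab S3 M m)))"
  let ?x = "ract M (lact M (perm_of p) m) (perm_of q)"
  have x: "?x \<in> bset M" using m(1) S3.finite_bisetD(4,5)[OF M] by simp
  then have xo: "two_orbit S3 M ?x = bset M" using two_orbit_point[OF M m(1)] m(2) by simp
  have px: "pull (stab S3 M ?x) = conjP p q (pull (stab S3 M m))"
    using S3.stab_two_sided[OF M m(1)] by (simp add: pull_conj_rel)
  obtain t where T: "finite_biset S3 (std_biset ?r)" and t: "t \<in> bset (std_biset ?r)"
    "two_orbit S3 (std_biset ?r) t = bset (std_biset ?r)" "tab (pull (stab S3 (std_biset ?r) t)) = ?r"
    using std_biset[OF pq] unfolding is_std_def by blast
  have "stab S3 M ?x = stab S3 (std_biset ?r) t"
    using t(3) px by (intro pull_eq stab_S3(2)[OF M x] stab_S3(2)[OF T t(1)]) (simp add: tab_eq_iff)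
  then have "biset_isomorphic S3 M (std_biset ?r)"
    by (rule S3.transitive_isomorphic[OF M T x xo t(1,2)])
  then show ?thesis using that pq by blast
qed

subsection \<open>The change of basis\<close>

definition coords :: "alg \<Rightarrow> rat list" where
  "coords x = [b11 x $ 1 $ 1, b11 x $ 1 $ 2, b11 x $ 1 $ 3, b11 x $ 2 $ 1, b11 x $ 2 $ 2, b11 x $ 2 $ 3,
     b11 x $ 3 $ 1, b11 x $ 3 $ 2, b11 x $ 3 $ 3, b14 x $ 1, b14 x $ 2, b14 x $ 3, b22 x, b24 x, b33 x,
     b41 x $ 1, b41 x $ 2, b41 x $ 3, b42 x, cst (b44 x), eta_part (b44 x), xi_part (b44 x)]"

fun iarr_coords :: "iarr \<Rightarrow> int list" where
  "iarr_coords (IArr s11 s12 s13 s21 s22 s23 s31 s32 s33 t1 t2 t3 u v w x1 x2 x3 y z1 z2 z3) =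
    [s11, s12, s13, s21, s22, s23, s31, s32, s33, t1, t2, t3, u, v, w, x1, x2, x3, y, z1, z2, z3]"

text \<open>Row \<open>k\<close> holds 12 times the coefficients of the \<open>k\<close>-th coordinate vector of \<open>A\<close> with respect to
  the images of the standard transitive bisets.\<close>

definition basis_rows :: "int list list" where
  "basis_rows =
    [[0, 0, 0, 0, 0, 0, 0, 0, 0, 0, 0, 0, 0, 0, 0, 12, 0, 0, 0, 0, 0, 0],
    [0, 0, 0, 0, 0, 0, 0, 0, 0, 0, 0, 0, 0, 12, 0, - 12, 0, 0, 0, 0, 0, 0],
    [0, 0, 0, 0, 0, 0, 0, 0, 0, 0, 0, 0, 0, 0, 12, - 12, 0, 0, 0, 0, 0, 0],
    [0, 0, 0, 0, 0, 0, 0, 12, 0, 0, 0, 0, 0, 0, 0, - 12, 0, 0, 0, 0, 0, 0],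
    [0, 0, 0, 0, 0, 12, 0, - 12, 0, 0, 0, 0, 0, - 12, 0, 12, 0, 0, 0, 0, 0, 0],
    [0, 0, 0, 0, 0, 0, 12, - 12, 0, 0, 0, 0, 0, 0, - 12, 12, 0, 0, 0, 0, 0, 0],
    [0, 0, 0, 0, 0, 0, 0, 0, 0, 0, 0, 12, 0, 0, 0, - 12, 0, 0, 0, 0, 0, 0],
    [0, 0, 0, 0, 0, 0, 0, 0, 0, 12, 0, - 12, 0, - 12, 0, 12, 0, 0, 0, 0, 0, 0],
    [0, 0, 0, 0, 0, 0, 0, 0, 0, 0, 12, - 12, 0, 0, - 12, 12, 0, 0, 0, 0, 0, 0],
    [0, 0, 0, 0, 0, 0, 0, 0, 0, 0, 0, 0, 12, - 24, - 12, 24, 0, 0, 0, 0, 0, 0],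
    [0, 0, 0, 0, 12, - 24, - 12, 24, 0, 0, 0, 0, - 12, 24, 12, - 24, 0, 0, 0, 0, 0, 0],
    [0, 0, 0, 0, 0, 0, 0, 0, 12, - 24, - 12, 24, - 12, 24, 12, - 24, 0, 0, 0, 0, 0, 0],
    [0, 0, 0, 0, 0, 0, 0, 0, 0, 0, - 12, 12, 0, 0, 12, - 24, 0, 0, 0, 12, 0, 0],
    [0, 0, 0, 0, 0, 0, 0, 0, - 12, 12, 12, - 12, 12, - 24, - 12, 24, 0, 0, 12, - 12, 0, 0],
    [- 3, 0, 3, 0, 0, 0, 0, 0, 3, 0, - 9, 0, 0, 0, 0, 0, 0, 0, 0, 0, 6, 0],
    [0, 0, 0, 4, 0, 0, 0, - 8, 0, 0, 0, - 4, 0, 0, 0, 8, 0, 0, 0, 0, 0, 0],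
    [0, 4, 0, - 4, 0, - 8, 0, 8, 0, - 4, 0, 4, 0, 8, 0, - 8, 0, 0, 0, 0, 0, 0],
    [0, 0, 4, - 4, 0, 0, - 8, 8, 0, 0, - 4, 4, 0, 0, 8, - 8, 0, 0, 0, 0, 0, 0],
    [0, 0, - 12, 12, 0, 0, 12, - 24, 0, 0, 12, - 12, 0, 0, - 12, 24, 0, 12, 0, - 12, 0, 0],
    [3, 0, - 3, 0, 0, - 12, 0, 12, - 3, 0, 9, 0, 0, 12, 0, - 12, 0, 0, 0, - 12, - 6, 12],
    [4, - 8, - 4, 8, - 8, 16, 8, - 16, - 4, 8, 4, - 8, 8, - 16, - 8, 16, 0, 0, 0, 0, 0, 0],
    [36, - 84, - 36, 84, - 84, 168, 84, - 168, - 36, 84, 36, - 84, 84, - 168, - 84, 168, 12, - 12, - 12, 12, 0, 0]]"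

definition mark_rows :: "int list list" where
  "mark_rows = map (\<lambda>r. iarr_coords (rel_mark r)) std_rels"

definition columns :: "int list list \<Rightarrow> int list list" where
  "columns m = map (\<lambda>j. map (\<lambda>r. r ! j) m) [0..<22]"

definition dot :: "int list \<Rightarrow> int list \<Rightarrow> int" where
  "dot xs ys = sum_list (map2 (*) xs ys)"

text \<open>24 = 2 * 12, since \<open>rel_mark\<close> is doubled and \<open>basis_rows\<close> is
  scaled by 12.\<close>

definition diag24 :: "int list list" where
  "diag24 = map (\<lambda>i. map (\<lambda>j. if i = j then 24 else 0) [0..<22]) [0..<22]"

text \<open>The two matrix products serve different ends: this one shows that the marks are
  independent (\<open>coeff_half_mark\<close>), the next one that they span
  (\<open>coeff_expand\<close>).\<close>

lemma mark_basis: "map (\<lambda>r. map (dot r) (columns basis_rows)) mark_rows = diag24"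
  by code_simp

lemma basis_mark: "map (\<lambda>r. map (dot r) (columns mark_rows)) basis_rows = diag24"
  by code_simp

lemma row_lengths: "list_all (\<lambda>r. length r = 22) basis_rows" "list_all (\<lambda>r. length r = 22) mark_rows"
  "length basis_rows = 22" "length mark_rows = 22"
  by code_simp+

text \<open>The positions of x_1, x_2, x_3 and z_2, the coordinates subject to a congruence modulo
  3.\<close>

definition three_pos :: "nat list" where "three_pos = [15, 16, 17, 20]"

text \<open>Prepares division by 12 over Z_(3): rows outside \<open>three_pos\<close> supply the
  factor 3 themselves, the others leave it to the coordinates of an element of the order.\<close>

lemma basis_div: "list_all (\<lambda>k. k \<in> set three_pos \<or> list_all (\<lambda>a. 3 dvd a) (basis_rows ! k)) [0..<22]"
  by code_simp

lemma mark_div: "list_all (\<lambda>r. list_all (\<lambda>k. 3 dvd r ! k) three_pos) mark_rows"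
  by code_simp

lemma dot_sum: "\<lbrakk>length xs = 22; length ys = 22\<rbrakk> \<Longrightarrow> dot xs ys = (\<Sum>k<22. xs ! k * ys ! k)"
  by (simp add: dot_def sum_list_sum_nth atLeast0LessThan)

lemma rows_product:
  assumes "map (\<lambda>r. map (dot r) (columns b)) a = diag24"
    and "list_all (\<lambda>r. length r = 22) a" "length a = 22" "length b = 22" and ij: "i < 22" "j < 22"
  shows "(\<Sum>k<22. a ! i ! k * b ! k ! j) = (if i = j then 24 else 0)"
proof -
  have "map (\<lambda>r. map (dot r) (columns b)) a ! i ! j = diag24 ! i ! j" using assms(1) by simp
  then have "dot (a ! i) (map (\<lambda>r. r ! j) b) = (if i = j then 24 else 0)"
    using assms by (simp add: columns_def diag24_def)
  then show ?thesis using assms by (simp add: dot_sum list_all_length)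
qed

lemma coords_hom:
  assumes "k < 22"
  shows "coords (x + y) ! k = coords x ! k + coords y ! k" "coords (alg_scale r x) ! k = r * coords x ! k"
    "coords 0 ! k = 0"
proof -
  have "coords (x + y) = map2 (+) (coords x) (coords y)" "coords (alg_scale r x) = map ((*) r) (coords x)"
    "coords 0 = map (\<lambda>_. 0) [0..<22]"
    by (simp_all add: coords_def alg_ops alg_scale_def qex_ops upt_conv_Cons)
  moreover have "length (coords x) = 22" for x by (simp add: coords_def)
  ultimately show "coords (x + y) ! k = coords x ! k + coords y ! k" "coords (alg_scale r x) ! k = r * coords x ! k"
    "coords 0 ! k = 0"
    using assms by simp_all
qed

lemma coords_sum: "k < 22 \<Longrightarrow> coords (\<Sum>i\<in>I. f i) ! k = (\<Sum>i\<in>I. coords (f i) ! k)"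
  by (induction I rule: infinite_finite_induct) (simp_all add: coords_hom)

lemma coords_eqI:
  assumes "\<And>k. k < 22 \<Longrightarrow> coords x ! k = coords y ! k" shows "x = y"
proof -
  have "coords x = coords y"
    by (rule nth_equalityI) (use assms in \<open>simp_all add: coords_def\<close>)
  then show ?thesis
    by (simp add: coords_def alg_eq_iff vec_eq_iff forall_3 qex_eq_iff)
qed

lemma coords_half_mark:
  assumes "i < 22" "k < 22"
  shows "coords (half_mark (std_rels ! i)) ! k = of_int (mark_rows ! i ! k) / 2"
proof -
  have "coords (of_iarr a) = map of_int (iarr_coords a)" "length (iarr_coords a) = 22" for a
    by (cases a; simp add: coords_def)+
  then show ?thesis
    using assms by (simp add: half_mark_def coords_hom mark_rows_def std_rels_length)
qed

lemma Lam3_coords: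
  "x \<in> Lam3 \<longleftrightarrow> (\<forall>k<22. coords x ! k \<in> zloc 3) \<and> (\<forall>k\<in>set three_pos. coords x ! k \<in> threes)"
proof -
  have "length (coords x) = 22" by (simp add: coords_def)
  then have "(\<forall>k<22. coords x ! k \<in> zloc 3) \<longleftrightarrow> (\<forall>c\<in>set (coords x). c \<in> zloc 3)"
    by (simp add: all_set_conv_all_nth)
  then show ?thesis
    by (auto simp: Lam3_iff coords_def three_pos_def forall_3)
qed

definition coeff :: "nat \<Rightarrow> alg \<Rightarrow> rat" where
  "coeff i x = (\<Sum>k<22. of_int (basis_rows ! k ! i) * coords x ! k) / 12"

lemma coeff_hom:
  "coeff i (x + y) = coeff i x + coeff i y" "coeff i (alg_scale r x) = r * coeff i x" "coeff i 0 = 0"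
  by (simp_all add: coeff_def coords_hom distrib_left sum.distrib add_divide_distrib sum_distrib_left mult_ac)

lemma coeff_half_mark:
  assumes "i < 22" "j < 22"
  shows "coeff j (half_mark (std_rels ! i)) = (if i = j then 1 else 0)"
proof -
  have "coeff j (half_mark (std_rels ! i)) = of_int (\<Sum>k<22. mark_rows ! i ! k * basis_rows ! k ! j) / 24"
    using assms by (simp add: coeff_def coords_half_mark sum_divide_distrib mult_ac)
  also have "\<dots> = (if i = j then 1 else 0)"
    using rows_product[OF mark_basis row_lengths(2,4,3) assms] by simp
  finally show ?thesis .
qed

lemma coeff_expand: "(\<Sum>i<22. alg_scale (coeff i x) (half_mark (std_rels ! i))) = x"
proof (rule coords_eqI)
  fix l :: nat assume l: "l < 22"
  have "coords (\<Sum>i<22. alg_scale (coeff i x) (half_mark (std_rels ! i))) ! l =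
      (\<Sum>i<22. coeff i x * (of_int (mark_rows ! i ! l) / 2))"
    using l by (simp add: coords_sum coords_hom coords_half_mark)
  also have "\<dots> = (\<Sum>i<22. \<Sum>k<22. of_int (basis_rows ! k ! i * mark_rows ! i ! l) * coords x ! k / 24)"
    by (simp add: coeff_def sum_distrib_left sum_distrib_right sum_divide_distrib mult_ac)
  also have "\<dots> = (\<Sum>k<22. \<Sum>i<22. of_int (basis_rows ! k ! i * mark_rows ! i ! l) * coords x ! k / 24)"
    by (rule sum.swap)
  also have "\<dots> = (\<Sum>k<22. of_int (\<Sum>i<22. basis_rows ! k ! i * mark_rows ! i ! l) * coords x ! k / 24)"
    by (simp add: sum_distrib_right sum_divide_distrib)
  also have "\<dots> = (\<Sum>k<22. if k = l then coords x ! k else 0)"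
    using rows_product[OF basis_mark row_lengths(1,3,4) _ l] by (intro sum.cong) auto
  also have "\<dots> = coords x ! l" using l by simp
  finally show "coords (\<Sum>i<22. alg_scale (coeff i x) (half_mark (std_rels ! i))) ! l = coords x ! l" .
qed

text \<open>Every summand is 3 times an element of Z_(3), and of 12 = 3 * 4 the factor 4 is a unit
  there.\<close>

lemma coeff_zloc:
  assumes x: "x \<in> Lam3" and i: "i < 22"
  shows "coeff i x \<in> zloc 3"
proof -
  have "of_int (basis_rows ! k ! i) * coords x ! k / 12 \<in> zloc 3" if k: "k < 22" for k
  proof -
    have quarter: "1 / 4 \<in> zloc 3"
      unfolding zloc_def by (intro CollectI exI[of _ 1] exI[of _ 4]) simp
    have xk: "coords x ! k \<in> zloc 3" using x k by (simp add: Lam3_coords)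
    have "of_int (basis_rows ! k ! i) * coords x ! k \<in> threes"
    proof (cases "k \<in> set three_pos")
      case True
      then show ?thesis using x by (simp add: Lam3_coords)
    next
      case False
      moreover have "k \<in> set three_pos \<or> list_all (\<lambda>a. 3 dvd a) (basis_rows ! k)"
        using basis_div k by (simp add: list_all_iff)
      ultimately have "3 dvd basis_rows ! k ! i"
        using i k row_lengths(1,3) by (auto simp: list_all_length)
      then obtain a where "basis_rows ! k ! i = 3 * a" by (auto simp: dvd_def)
      then have "of_int (basis_rows ! k ! i) * coords x ! k = 3 * (of_int a * coords x ! k)" by simp
      then show ?thesis using xk by (simp only: threes_closed zloc_mult zloc_of_int prime_3_nat)
    qed
    then obtain y where y: "y \<in> zloc 3" "of_int (basis_rows ! k ! i) * coords x ! k = 3 * y"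
      by (auto simp: threes_def)
    have "1 / 4 * y \<in> zloc 3" using quarter y(1) by (intro zloc_mult) simp_all
    then show ?thesis by (simp add: y(2))
  qed
  then show ?thesis unfolding coeff_def sum_divide_distrib by (intro zloc_sum) auto
qed

text \<open>Halving is harmless because 2 is a unit in Z_(3); the congruences come from
  \<open>mark_div\<close>.\<close>

lemma half_mark_Lam3:
  assumes "r \<in> set std_rels" shows "half_mark r \<in> Lam3"
proof -
  obtain i where i: "i < 22" "r = std_rels ! i" using assms by (auto simp: in_set_conv_nth std_rels_length)
  have half: "1 / 2 \<in> zloc 3"
    unfolding zloc_def by (intro CollectI exI[of _ 1] exI[of _ 2]) simp
  have "of_int a / 2 \<in> zloc 3" for a
    using zloc_mult[OF _ zloc_of_int half] by simp
  moreover have "of_int (mark_rows ! i ! k) / 2 \<in> threes" if "k \<in> set three_pos" for k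
  proof -
    have "3 dvd mark_rows ! i ! k"
      using mark_div that i(1) row_lengths(4) by (simp add: list_all_iff)
    then obtain a where "mark_rows ! i ! k = 3 * a" by (auto simp: dvd_def)
    then have "of_int (mark_rows ! i ! k) / 2 = 3 * (of_int a / 2 :: rat)" by simp
    then show ?thesis using calculation by (simp only: threes_closed)
  qed
  moreover have "k < 22" if "k \<in> set three_pos" for k using that by (auto simp: three_pos_def)
  ultimately show ?thesis using i by (simp add: Lam3_coords coords_half_mark)
qed

subsection \<open>The isomorphism with the order\<close>

definition class_val :: "(nat \<Rightarrow> nat, nat) biset set \<Rightarrow> alg" where
  "class_val X = mk (SOME M. M \<in> X)"

lemma class_val_class:
  assumes M: "finite_biset S3 M" shows "class_val (biset_class S3 M) = mk M"
proof -
  let ?N = "SOME P. P \<in> biset_class S3 M"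
  have "?N \<in> biset_class S3 M"
    using S3.biset_class_nonempty[OF M] by (rule someI_ex)
  then have "finite_biset S3 ?N" "biset_isomorphic S3 M ?N" unfolding biset_class_def by blast+
  then show ?thesis unfolding class_val_def by (rule S3.mark_sum_iso[OF M, symmetric])
qed

interpretation burn: free_alg 3 "biset_classes S3" "\<lambda>X Y. Some (biset_class_mult S3 X Y)"
  "{biset_class S3 (regular_biset S3)}"
proof unfold_locales
  show "prime (3::nat)" by simp
  show "{biset_class S3 (regular_biset S3)} \<subseteq> biset_classes S3"
    using S3.biset_class_in[OF S3.finite_regular_biset] by simp
  fix X Y Z assume "X \<in> biset_classes S3" "Y \<in> biset_classes S3" "Some (biset_class_mult S3 X Y) = Some Z"
  then show "Z \<in> biset_classes S3"
    using S3.biset_class_in[OF S3.finite_biset_tensor]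
    by (auto simp: biset_classes_def[of S3] S3.biset_class_mult_class) (auto simp: biset_classes_def)
qed simp

abbreviation BF :: "(rat, (nat \<Rightarrow> nat, nat) biset set \<Rightarrow> rat) module" where
  "BF \<equiv> burn.F"

abbreviation bev :: "((nat \<Rightarrow> nat, nat) biset set \<Rightarrow> rat) \<Rightarrow> alg" where
  "bev \<equiv> burn.ev class_val"

abbreviation be :: "(nat \<Rightarrow> nat, 'm) biset \<Rightarrow> (nat \<Rightarrow> nat, nat) biset set \<Rightarrow> rat" where
  "be M \<equiv> basis_elem (zloc_ring 3) (biset_class S3 M)"

lemma free_biset_algebra_eq: "free_biset_algebra (zloc_ring 3) S3 = BF"
  by (simp add: free_biset_algebra_def)

lemma be_closed: "finite_biset S3 M \<Longrightarrow> be M \<in> carrier BF"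
  by (intro burn.basis_elem_closed S3.biset_class_in)

lemma bev_be: "finite_biset S3 M \<Longrightarrow> bev (be M) = mk M"
  by (simp add: burn.ev_basis_elem class_val_class)

text \<open>A linear section of \<open>bev\<close>: x is expanded in the marks of the standard
  bisets, and their classes are put in place of the marks. For x in the order the coefficients lie
  in Z_(3).\<close>

definition lift_alg :: "alg \<Rightarrow> (nat \<Rightarrow> nat, nat) biset set \<Rightarrow> rat" where
  "lift_alg x X = (\<Sum>i<22. coeff i x * be (std_biset (std_rels ! i)) X)"

lemma std_rels_nth: "i < 22 \<Longrightarrow> std_rels ! i \<in> set std_rels"
  by (simp add: std_rels_length)

lemma lift_alg_hom:
  "lift_alg (x + y) = (\<lambda>X. lift_alg x X + lift_alg y X)" "lift_alg (alg_scale r x) = (\<lambda>X. r * lift_alg x X)"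
  "lift_alg 0 = (\<lambda>X. 0)"
  by (simp_all add: lift_alg_def fun_eq_iff coeff_hom distrib_right sum.distrib sum_distrib_left mult.assoc)

lemma lift_alg_half_mark:
  assumes "i < 22" shows "lift_alg (half_mark (std_rels ! i)) = be (std_biset (std_rels ! i))"
proof
  fix X
  have "lift_alg (half_mark (std_rels ! i)) X =
      (\<Sum>j<22. if i = j then be (std_biset (std_rels ! j)) X else 0)"
    unfolding lift_alg_def using assms by (intro sum.cong) (auto simp: coeff_half_mark)
  also have "\<dots> = be (std_biset (std_rels ! i)) X" using assms by simp
  finally show "lift_alg (half_mark (std_rels ! i)) X = be (std_biset (std_rels ! i)) X" .
qed

lemma lift_alg_closed_ev:
  assumes x: "x \<in> Lam3"
  shows "lift_alg x \<in> carrier BF" "bev (lift_alg x) = x"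
proof -
  have part: "(\<lambda>X. \<Sum>i<k. coeff i x * be (std_biset (std_rels ! i)) X) \<in> carrier BF \<and>
      bev (\<lambda>X. \<Sum>i<k. coeff i x * be (std_biset (std_rels ! i)) X) =
        (\<Sum>i<k. alg_scale (coeff i x) (half_mark (std_rels ! i)))" if "k \<le> 22" for k
    using that
  proof (induction k)
    case 0
    then show ?case using burn.F_closed(3) by (simp add: burn.ev_def)
  next
    case (Suc k)
    let ?b = "be (std_biset (std_rels ! k))"
    have fin: "finite_biset S3 (std_biset (std_rels ! k))"
      using Suc by (intro finite_std_biset std_rels_nth) simp
    have t: "(\<lambda>X. coeff k x * ?b X) \<in> carrier BF"
      using coeff_zloc[OF x, of k] Suc by (intro burn.F_closed(2) be_closed fin) simp
    have IH: "(\<lambda>X. \<Sum>i<k. coeff i x * be (std_biset (std_rels ! i)) X) \<in> carrier BF"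
      "bev (\<lambda>X. \<Sum>i<k. coeff i x * be (std_biset (std_rels ! i)) X) =
        (\<Sum>i<k. alg_scale (coeff i x) (half_mark (std_rels ! i)))"
      using Suc by auto
    have "mk (std_biset (std_rels ! k)) = half_mark (std_rels ! k)"
      using Suc by (intro mk_std_biset std_rels_nth) simp
    then show ?case
      using burn.F_closed(1)[OF IH(1) t] burn.ev_add[OF IH(1) t, of class_val]
        burn.ev_scale[OF be_closed[OF fin], of class_val "coeff k x"] IH(2) bev_be[OF fin]
      by simp
  qed
  from part[of 22] show "lift_alg x \<in> carrier BF" "bev (lift_alg x) = x"
    by (simp_all add: lift_alg_def[abs_def] coeff_expand)
qed

lemma mk_union_iso:
  assumes "finite_biset S3 M" "finite_biset S3 M1" "finite_biset S3 M2"
    and "biset_isomorphic S3 M (biset_union M1 M2)"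
  shows "mk M = mk M1 + mk M2" "biset_class S3 M = biset_class S3 (biset_union M1 M2)"
  using S3.mark_sum_iso[OF assms(1) S3.finite_biset_union[OF assms(2,3)] assms(4)]
    S3.mark_sum_union[OF assms(2,3)] S3.biset_class_eq[OF assms(1) S3.finite_biset_union[OF assms(2,3)] assms(4)]
  by simp_all

text \<open>One orbit is split off at a time. M is only isomorphic to the union of the two parts,
  because \<open>biset_union\<close> lives on a sum type.\<close>

lemma finite_biset_induct [consumes 1, case_names empty union]:
  fixes M :: "(nat \<Rightarrow> nat, 'm) biset" and P :: "(nat \<Rightarrow> nat, 'm) biset \<Rightarrow> bool"
  assumes "finite_biset S3 M"
    and empty: "\<And>M :: (nat \<Rightarrow> nat, 'm) biset. \<lbrakk>finite_biset S3 M; bset M = {}\<rbrakk> \<Longrightarrow> P M"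
    and union: "\<And>(M :: (nat \<Rightarrow> nat, 'm) biset) (M1 :: (nat \<Rightarrow> nat, 'm) biset)
      (M2 :: (nat \<Rightarrow> nat, 'm) biset) m. \<lbrakk>finite_biset S3 M; finite_biset S3 M1; finite_biset S3 M2; m \<in> bset M1;
      two_orbit S3 M1 m = bset M1; biset_isomorphic S3 M (biset_union M1 M2); P M2\<rbrakk> \<Longrightarrow> P M"
  shows "P M"
  using assms(1)
proof (induction "card (bset M)" arbitrary: M rule: less_induct)
  case less
  show ?case
  proof (cases "bset M = {}")
    case True
    then show ?thesis by (rule empty[OF less(2)])
  next
    case False
    then obtain m where m: "m \<in> bset M" by blast
    let ?X = "two_orbit S3 M m"
    have X: "?X \<subseteq> bset M" by (rule S3.two_orbit_sub[OF less(2) m])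
    have mX: "m \<in> ?X" by (rule S3.two_orbit_self[OF less(2) m])
    note cl = S3.two_orbit_closed[OF less(2) m] and D = S3.finite_bisetD[OF less(2)]
    have "finite_biset S3 (S3.sub_biset M ?X)"
      using cl X by (intro S3.finite_sub_biset[OF less(2) X]) blast
    moreover have fin2: "finite_biset S3 (S3.sub_biset M (bset M - ?X))"
      using cl D(4,5) by (intro S3.finite_sub_biset[OF less(2)]) auto
    moreover have "biset_isomorphic S3 M (biset_union (S3.sub_biset M ?X) (S3.sub_biset M (bset M - ?X)))"
      by (rule S3.biset_split[OF X]) (use cl in blast)+
    moreover have "card (bset (S3.sub_biset M (bset M - ?X))) < card (bset M)"
      using D(1) m mX by (simp add: S3.sub_biset_def) (intro psubset_card_mono, auto)
    ultimately show ?thesis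
      using union[OF less(2), of "S3.sub_biset M ?X" "S3.sub_biset M (bset M - ?X)" m] less(1)[OF _ fin2] mX
      by (simp add: S3.two_orbit_sub_biset) (simp add: S3.sub_biset_def)
  qed
qed

lemma mk_Lam3:
  assumes "finite_biset S3 M" shows "mk M \<in> Lam3"
  using assms
proof (induction rule: finite_biset_induct)
  case (empty M)
  then show ?case by (simp add: mark_sum_def Lam3_closed)
next
  case (union M M1 M2 m)
  obtain r where r: "r \<in> set std_rels" "biset_isomorphic S3 M1 (std_biset r)"
    using transitive_std[OF union(2,4,5)] by blast
  then have "mk M1 = half_mark r"
    using S3.mark_sum_iso[OF union(2) finite_std_biset[OF r(1)] r(2)] mk_std_biset[OF r(1)] by simp
  then show ?case
    using mk_union_iso(1)[OF union(1-3,6)] half_mark_Lam3[OF r(1)] union(7) by (simp add: Lam3_closed)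
qed

lemma bev_Lam3:
  assumes "f \<in> carrier BF" shows "bev f \<in> Lam3"
  using assms
proof (induction rule: burn.F_decompose_induct)
  case zero
  then show ?case by (simp add: burn.ev_def Lam3_closed)
next
  case (add r s g)
  obtain M :: "(nat \<Rightarrow> nat, nat) biset" where M: "finite_biset S3 M" "s = biset_class S3 M" using add(2) by (auto simp: biset_classes_def)
  have "(\<lambda>X. r * be M X) \<in> carrier BF" using add(1) by (intro burn.F_closed(2) be_closed M(1))
  then have "bev (\<lambda>X. r * be M X + g X) = alg_scale r (mk M) + bev g"
    using burn.ev_add[of _ g] burn.ev_scale[OF be_closed[OF M(1)]] add(4) bev_be[OF M(1)] by simp
  then show ?case using add(1,5) mk_Lam3[OF M(1)] by (simp add: M(2) Lam3_closed)
qed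

lemma bev_image: "bev ` carrier BF = Lam3"
proof
  show "Lam3 \<subseteq> bev ` carrier BF"
  proof
    fix x assume "x \<in> Lam3"
    from lift_alg_closed_ev[OF this] show "x \<in> bev ` carrier BF" by (metis imageI)
  qed
qed (use bev_Lam3 in blast)

text \<open>The stabilizer of the unit element is the diagonal, the last of the standard
  relations.\<close>

lemma mk_regular: "mk (regular_biset S3) = 1"
proof -
  have "\<one>\<^bsub>S3\<^esub> \<in> bset (regular_biset S3)" "two_orbit S3 (regular_biset S3) \<one>\<^bsub>S3\<^esub> = bset (regular_biset S3)"
    using S3.regular_transitive by (simp_all add: regular_biset_def)
  then have "mk (regular_biset S3) = half_mark (tab (pull (stab S3 (regular_biset S3) \<one>\<^bsub>S3\<^esub>)))"
    by (rule mk_transitive[OF S3.finite_regular_biset])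
  moreover have "pull (stab S3 (regular_biset S3) \<one>\<^bsub>S3\<^esub>) = (\<lambda>x y. x = y)"
    by (intro ext) (simp add: pull_def S3.stab_regular)
  moreover have "rel_mark (tab (\<lambda>x y. x = y)) = IArr 2 0 0 0 2 0 0 0 2 0 0 0 2 0 2 0 0 0 0 2 0 0"
    by code_simp
  ultimately show ?thesis
    by (simp add: half_mark_def alg_calc alg_scale_def)
qed

lemma class_val_mult:
  assumes "X \<in> biset_classes S3" "Y \<in> biset_classes S3"
  shows "class_val X * class_val Y = class_val (biset_class_mult S3 X Y)"
proof -
  obtain M N :: "(nat \<Rightarrow> nat, nat) biset" where M: "finite_biset S3 M" "X = biset_class S3 M" and N: "finite_biset S3 N" "Y = biset_class S3 N"
    using assms by (auto simp: biset_classes_def)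
  then show ?thesis
    by (simp add: S3.biset_class_mult_class class_val_class S3.finite_biset_tensor mk_tensor)
qed

interpretation bpres: ring_presentation BF "sub_alg Lam3 1" bev
proof (intro ring_presentation.intro ring_presentation_axioms.intro)
  show "abelian_group BF" by (rule burn.F_abelian_group)
  show "Ring.ring (sub_alg Lam3 1)" by (rule r_algebra_ring[OF Lam3_algebra])
  show "bev ` carrier BF = carrier (sub_alg Lam3 1)" by (simp add: bev_image)
  show "bev \<one>\<^bsub>BF\<^esub> = \<one>\<^bsub>sub_alg Lam3 1\<^esub>"
    unfolding burn.ev_one by (simp add: class_val_class S3.finite_regular_biset mk_regular)
qed (simp_all add: burn.ev_add burn.F_mult_closed burn.ev_mult class_val_mult burn.F_one_closed del: burn.F_sel(4))

section \<open>The span of the relations as a kernel\<close>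

lemma biset_relations_eq:
  "biset_relations (zloc_ring 3) S3 =
    {(\<lambda>X. be (biset_union M N) X - (be M X + be N X)) | (M :: (nat \<Rightarrow> nat, nat) biset) (N :: (nat \<Rightarrow> nat, nat) biset).
      finite_biset S3 M \<and> finite_biset S3 N}"
proof -
  have "be (biset_union M N) \<ominus>\<^bsub>BF\<^esub> (be M \<oplus>\<^bsub>BF\<^esub> be N) = (\<lambda>X. be (biset_union M N) X - (be M X + be N X))"
    if "finite_biset S3 M" "finite_biset S3 N" for M N :: "(nat \<Rightarrow> nat, nat) biset"
    using that burn.F_closed(1)[OF be_closed[OF that(1)] be_closed[OF that(2)]]
    by (simp add: burn.F_minus be_closed S3.finite_biset_union)
  note key = this
  have "f = be (biset_union M N) \<ominus>\<^bsub>BF\<^esub> (be M \<oplus>\<^bsub>BF\<^esub> be N) \<and> finite_biset S3 M \<and> finite_biset S3 N \<longleftrightarrow>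
      f = (\<lambda>X. be (biset_union M N) X - (be M X + be N X)) \<and> finite_biset S3 M \<and> finite_biset S3 N"
    for f and M N :: "(nat \<Rightarrow> nat, nat) biset"
    by (cases "finite_biset S3 M \<and> finite_biset S3 N") (simp_all only: key simp_thms)
  then show ?thesis
    unfolding biset_relations_def Let_def free_biset_algebra_eq by (simp only:)
qed

text \<open>Modulo the relations every f is congruent to \<open>lift_alg (bev f)\<close>, which is 0
  when f lies in the kernel. As a kernel the span is compatible with multiplication, although it is
  defined as a mere submodule.\<close>

lemma relation_span_eq: "module_span (zloc_ring 3) BF (biset_relations (zloc_ring 3) S3) = bpres.Ker"
proof
  have "submodule bpres.Ker (zloc_ring 3) BF"
  proof (rule burn.F.submoduleI)
    show "\<ominus>\<^bsub>BF\<^esub> f \<in> bpres.Ker" if "f \<in> bpres.Ker" for f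
      using that burn.F_closed(2)[of "- 1" f] burn.ev_scale[of f class_val "- 1"]
      by (simp add: bpres.fib_def burn.F_uminus prime_3_nat)
  qed (auto simp: bpres.fib_def burn.F_closed burn.ev_add burn.ev_scale burn.ev_def[of _ "\<lambda>s. 0"])
  moreover have "biset_relations (zloc_ring 3) S3 \<subseteq> bpres.Ker"
  proof
    fix f assume "f \<in> biset_relations (zloc_ring 3) S3"
    then obtain M N :: "(nat \<Rightarrow> nat, nat) biset" where MN: "finite_biset S3 M" "finite_biset S3 N"
      and f: "f = (\<lambda>X. be (biset_union M N) X - (be M X + be N X))"
      unfolding biset_relations_eq by blast
    note cl = be_closed[OF S3.finite_biset_union[OF MN]] be_closed[OF MN(1)] be_closed[OF MN(2)]
    have sum: "(\<lambda>X. be M X + be N X) \<in> carrier BF" by (rule burn.F_closed(1)[OF cl(2,3)])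
    have f': "f = be (biset_union M N) \<ominus>\<^bsub>BF\<^esub> (\<lambda>X. be M X + be N X)"
      by (simp add: f burn.F_minus cl sum)
    have "f \<in> carrier BF" unfolding f' using cl sum by (intro burn.F.minus_closed)
    moreover have "bev f = \<zero>\<^bsub>sub_alg Lam3 1\<^esub>"
    proof -
      have "bev (be (biset_union M N)) = bev (\<lambda>X. be M X + be N X)"
        using MN by (simp add: burn.ev_add cl bev_be S3.finite_biset_union S3.mark_sum_union)
      then show ?thesis
        unfolding f' bpres.h_minus[OF cl(1) sum]
        using bpres.h_closed[OF sum] by (simp only: bpres.T.minus_eq bpres.T.r_neg)
    qed
    ultimately show "f \<in> bpres.Ker" by (simp add: bpres.fib_def)
  qed
  ultimately show "module_span (zloc_ring 3) BF (biset_relations (zloc_ring 3) S3) \<subseteq> bpres.Ker"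
    unfolding module_span_def by blast
next
  have "bpres.Ker \<subseteq> H" if H: "submodule H (zloc_ring 3) BF" and rel: "biset_relations (zloc_ring 3) S3 \<subseteq> H" for H
  proof
    note HE = burn.F.submoduleE[OF H]
    have addH: "(\<lambda>X. f X + g X) \<in> H" if "f \<in> H" "g \<in> H" for f g using HE(5)[OF that] by simp
    have smult: "(\<lambda>X. r * f X) \<in> H" if "r \<in> zloc 3" "f \<in> H" for r f using HE(4)[of r f] that by simp
    obtain f0 where "f0 \<in> H" using HE(2) by blast
    then have zeroH: "(\<lambda>X. 0) \<in> H" using smult[of 0 f0] by (simp add: prime_3_nat)
    have rels: "(\<lambda>X. be (biset_union M N) X - (be M X + be N X)) \<in> H"
      if "finite_biset S3 M" "finite_biset S3 N" for M N :: "(nat \<Rightarrow> nat, nat) biset"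
      using that rel unfolding biset_relations_eq by blast
    have main: "(\<lambda>X. be M X - lift_alg (mk M) X) \<in> H" if "finite_biset S3 M" for M :: "(nat \<Rightarrow> nat, nat) biset"
      using that
    proof (induction rule: finite_biset_induct)
      case (empty M)
      \<comment> \<open>For the empty biset, M + M and M are isomorphic, so the relation for the
        pair (M, M) is minus the basis element of M.\<close>
      have "biset_isomorphic S3 (biset_union M M) M"
        using empty(2) by (auto simp: biset_isomorphic_def biset_union_def bij_betw_def)
      then have "be (biset_union M M) = be M"
        using S3.biset_class_eq[OF S3.finite_biset_union[OF empty(1,1)] empty(1)] by simp
      then have "(\<lambda>X. - 1 * (be M X - (be M X + be M X))) \<in> H"
        using smult[OF _ rels[OF empty(1,1)], of "- 1"] zloc_of_int[OF prime_3_nat, of "- 1"] by simp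
      then show ?case using empty(2) by (simp add: mark_sum_def lift_alg_hom(3))
    next
      case (union M M1 M2 m)
      note U = mk_union_iso[OF union(1-3,6)]
      obtain r where r: "r \<in> set std_rels" "biset_isomorphic S3 M1 (std_biset r)"
        using transitive_std[OF union(2,4,5)] by blast
      obtain i where i: "i < 22" "r = std_rels ! i" using r(1) by (auto simp: in_set_conv_nth std_rels_length)
      have "mk M1 = half_mark r"
        using S3.mark_sum_iso[OF union(2) finite_std_biset[OF r(1)] r(2)] mk_std_biset[OF r(1)] by simp
      moreover have "be M1 = be (std_biset r)"
        using S3.biset_class_eq[OF union(2) finite_std_biset[OF r(1)] r(2)] by simp
      ultimately have "lift_alg (mk M1) = be M1" using lift_alg_half_mark[OF i(1)] i(2) by simp
      \<comment> \<open>Up to a relation \<open>be M\<close> is \<open>be M1 + be M2\<close>, and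
        for the transitive part M1 the basis element cancels against its lift.\<close>
      then have "(\<lambda>X. be M X - lift_alg (mk M) X) =
          (\<lambda>X. (be (biset_union M1 M2) X - (be M1 X + be M2 X)) + (be M2 X - lift_alg (mk M2) X))"
        unfolding U lift_alg_hom(1) by (simp add: fun_eq_iff)
      then show ?case using addH[OF rels[OF union(2,3)] union(7)] by simp
    qed
    fix f assume "f \<in> bpres.Ker"
    then have f: "f \<in> carrier BF" "bev f = 0" by (simp_all add: bpres.fib_def)
    from f(1) have "(\<lambda>X. f X - lift_alg (bev f) X) \<in> H"
    proof (induction rule: burn.F_decompose_induct)
      case zero
      then show ?case using zeroH by (simp add: burn.ev_def lift_alg_hom(3))
    next
      case (add r s g)
      obtain M :: "(nat \<Rightarrow> nat, nat) biset" where M: "finite_biset S3 M" "s = biset_class S3 M" using add(2) by (auto simp: biset_classes_def)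
      have "(\<lambda>X. r * be M X) \<in> carrier BF" using add(1) by (intro burn.F_closed(2) be_closed M(1))
      then have "bev (\<lambda>X. r * be M X + g X) = alg_scale r (mk M) + bev g"
        using burn.ev_add[of _ g] burn.ev_scale[OF be_closed[OF M(1)]] add(4) bev_be[OF M(1)] by simp
      then have "(\<lambda>X. r * be M X + g X - lift_alg (bev (\<lambda>X. r * be M X + g X)) X) =
          (\<lambda>X. r * (be M X - lift_alg (mk M) X) + (g X - lift_alg (bev g) X))"
        by (simp add: lift_alg_hom fun_eq_iff algebra_simps)
      then show ?case
        using addH[OF smult[OF add(1) main[OF M(1)]] add(5)]
        by (simp add: M(2))
    qed
    then show "f \<in> H" by (simp add: f(2) lift_alg_hom(3))
  qed
  then show "bpres.Ker \<subseteq> module_span (zloc_ring 3) BF (biset_relations (zloc_ring 3) S3)"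
    unfolding module_span_def by blast
qed

lemma double_burnside_eq: "double_burnside (zloc_ring 3) S3 = quot_algebra BF bpres.Ker"
  by (simp add: double_burnside_def free_biset_algebra_eq relation_span_eq)

subsection \<open>The corner\<close>

definition unit_elem :: "3 \<Rightarrow> 3 \<Rightarrow> alg" where
  "unit_elem i j = Alg (\<chi> a b. if a = i \<and> b = j then 1 else 0) 0 0 0 0 0 0 0"

text \<open>With E_ij the matrix units of the first block, 1 = E_13 E_31 + E_23 E_32 + e_corner
  e_corner. These factors are the witnesses of fullness that \<open>full_corner\<close> asks
  for.\<close>

definition corner_col :: "nat \<Rightarrow> alg" where
  "corner_col i = [unit_elem 1 3, unit_elem 2 3, e_corner] ! i"

definition corner_row :: "nat \<Rightarrow> alg" where
  "corner_row i = [unit_elem 3 1, unit_elem 3 2, e_corner] ! i"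

lemma corner_col_row_facts:
  assumes "i < 3"
  shows "corner_col i \<in> Lam3" "corner_row i \<in> Lam3" "corner_col i * e_corner = corner_col i"
    "e_corner * corner_row i = corner_row i"
proof -
  have "unit_elem a b \<in> Lam3" for a b by (simp add: unit_elem_def Lam3_iff prime_3_nat qex_ops)
  moreover have "i = 0 \<or> i = 1 \<or> i = 2" using assms by auto
  moreover have "unit_elem 1 3 * e_corner = unit_elem 1 3" "unit_elem 2 3 * e_corner = unit_elem 2 3"
    "e_corner * unit_elem 3 1 = unit_elem 3 1" "e_corner * unit_elem 3 2 = unit_elem 3 2"
    by (simp_all add: unit_elem_def e_corner_def elem_defs alg_calc)
  ultimately show "corner_col i \<in> Lam3" "corner_row i \<in> Lam3" "corner_col i * e_corner = corner_col i"
    "e_corner * corner_row i = corner_row i"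
    by (auto simp: corner_col_def corner_row_def e_corner_Lam3 e_corner_idem)
qed

lemma corner_full:
  "corner_col 0 * corner_row 0 + (corner_col 1 * corner_row 1 + corner_col 2 * corner_row 2) = 1"
  by (simp add: corner_col_def corner_row_def e_corner_idem)
    (simp add: unit_elem_def e_corner_def elem_defs alg_calc)

text \<open>\<open>bpres.fib\<close> is an isomorphism from the order onto the double Burnside
  algebra, so it carries the corner of the order and the witnesses of its fullness along.\<close>

lemma burnside_full_corner:
  "full_corner (double_burnside (zloc_ring 3) S3) Lam3' bpres.fib 3
     (\<lambda>i. bpres.fib (corner_col i)) (\<lambda>i. bpres.fib (corner_row i))"
proof -
  let ?Q = "quot_algebra BF bpres.Ker"
  note sub_alg_sel(4) [simp del]
  interpret Q: Ring.ring ?Q by (rule bpres.quot_is_ring)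
  have add: "bpres.fib x \<oplus>\<^bsub>?Q\<^esub> bpres.fib y = bpres.fib (x + y)"
    and mult: "bpres.fib x \<otimes>\<^bsub>?Q\<^esub> bpres.fib y = bpres.fib (x * y)" if "x \<in> Lam3" "y \<in> Lam3" for x y
    using that bpres.fib_add[of x y] bpres.fib_mult[of x y] by simp_all
  have in_Q: "bpres.fib x \<in> carrier ?Q" if "x \<in> Lam3" for x
    unfolding bpres.quot_carrier using that by simp
  have sub: "x \<in> Lam3" if "x \<in> carrier Lam3'" for x using that by (simp add: Lam3'_carrier)
  show ?thesis
    unfolding double_burnside_eq
  proof (intro full_corner.intro full_corner_axioms.intro Q.ring_axioms)
    show "Ring.ring Lam3'" by (rule r_algebra_ring[OF Lam3'_algebra])
    show "inj_on bpres.fib (carrier Lam3')"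
      using bpres.fib_inj by (rule inj_on_subset) (use sub in auto)
    have carr: "carrier Lam3' = (\<lambda>x. e_corner * x * e_corner) ` Lam3"
      by (simp add: Lam3'_def e_corner_def Let_def)
    show "bpres.fib ` carrier Lam3' =
        (\<lambda>X. bpres.fib \<one>\<^bsub>Lam3'\<^esub> \<otimes>\<^bsub>?Q\<^esub> X \<otimes>\<^bsub>?Q\<^esub> bpres.fib \<one>\<^bsub>Lam3'\<^esub>) ` carrier ?Q"
      unfolding carr bpres.quot_carrier image_image
      by (intro image_cong) (simp_all add: mult e_corner_Lam3 Lam3_closed)
    have term_in: "bpres.fib (corner_col i) \<otimes>\<^bsub>?Q\<^esub> bpres.fib (corner_row i) = bpres.fib (corner_col i * corner_row i)"
      "corner_col i * corner_row i \<in> Lam3" if "i < 3" for i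
      using corner_col_row_facts[OF that] by (simp_all add: mult Lam3_closed)
    have "(\<Oplus>\<^bsub>?Q\<^esub>i\<in>{..<3}. bpres.fib (corner_col i) \<otimes>\<^bsub>?Q\<^esub> bpres.fib (corner_row i)) =
        (\<Oplus>\<^bsub>?Q\<^esub>i\<in>{0, 1, 2}. bpres.fib (corner_col i * corner_row i))"
      using in_Q term_in by (intro Q.finsum_cong') (auto simp: numeral_3_eq_3 lessThan_Suc)
    also have "\<dots> = bpres.fib (corner_col 0 * corner_row 0 + (corner_col 1 * corner_row 1 + corner_col 2 * corner_row 2))"
      using in_Q term_in(2)[of 0] term_in(2)[of 1] term_in(2)[of 2]
      by (simp add: Pi_iff add Lam3_closed)
    finally show "(\<Oplus>\<^bsub>?Q\<^esub>i\<in>{..<3}. bpres.fib (corner_col i) \<otimes>\<^bsub>?Q\<^esub> bpres.fib (corner_row i)) = \<one>\<^bsub>?Q\<^esub>"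
      using bpres.fib_one by (simp only: corner_full) simp
  qed (use sub corner_col_row_facts e_corner_Lam3 in \<open>simp_all add: in_Q add mult\<close>)
qed

theorem proposition15:
  shows "let R = zloc_ring 3; P = path_algebra R Psi; I = Psi_ideal R in
         (\<exists>\<phi> \<in> r_algebra_iso R Lam3' (quot_algebra P I).
            \<phi> e3 = I +>\<^bsub>P\<^esub> vertex_elem R V3 \<and>
            \<phi> e4 = I +>\<^bsub>P\<^esub> vertex_elem R V4 \<and>
            \<phi> e5 = I +>\<^bsub>P\<^esub> vertex_elem R V5 \<and>
            \<phi> e6 = I +>\<^bsub>P\<^esub> vertex_elem R V6 \<and>
            \<phi> tau1 = I +>\<^bsub>P\<^esub> arrow_elem R Psi T1 \<and>
            \<phi> tau2 = I +>\<^bsub>P\<^esub> arrow_elem R Psi T2 \<and>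
            \<phi> tau3 = I +>\<^bsub>P\<^esub> arrow_elem R Psi T3 \<and>
            \<phi> tau4 = I +>\<^bsub>P\<^esub> arrow_elem R Psi T4) \<and>
         morita_equivalent TYPE('u::infinite) (double_burnside R (sym_group 3)) Lam3'"
  unfolding Let_def
  using Lam3'_iso_path_algebra full_corner.morita_full_corner[OF burnside_full_corner]
  by blast

end
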